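(* Let $n\ge 1$, $d=2^n$, let $|z\rangle\in\mathbb{C}^d$ be a unit vector and let $\mathcal{M}=\mathcal{M}_{C,z}$ be the Clifford POVM generated by $|z\rangle$. Then for every nonzero Hermitian $X\in\mathbb{C}^{d\times d}$, $$\|\mathcal{M}(X)\|_{\ell_1}\ \ge\ \frac{\|X\|_1}{\sqrt{\big(6\,d\,\alpha(z)\,r_{\mathrm{eff}}(X)+10\big)\,r_{\mathrm{eff}}(X)}},$$ where $r_{\mathrm{eff}}(X)=\|X\|_1^2/\|X\|_2^2$.
   Context: $d=2^n$. The Pauli operators $W_1=\mathbb{I},W_2,\dots,W_{d^2}$ are all $n$-fold tensor products $\sigma_{k_1}\otimes\cdots\otimes\sigma_{k_n}$ with $\sigma_0=\mathbb{I}$ and $\sigma_1,\sigma_2,\sigma_3$ the single-qubit Pauli matrices; the Pauli group is $\{\pm W_k,\pm iW_k\}$. The Clifford group $\mathrm{C}_n$ is the group of unitaries $U$ on $\mathbb{C}^d$ with $UPU^\dagger$ in the Pauli group for every element $P$ of the Pauli group. For a unit vector $|z\rangle$, let $\{|x_1\rangle\langle x_1|,\dots,|x_N\rangle\langle x_N|\}$ be the set of distinct projectors in the orbit $\{U|z\rangle\langle z|U^\dagger: U\in\mathrm{C}_n\}$; the Clifford POVM $\mathcal{M}_{C,z}$ has elements $M_k=\frac{d}{N}|x_k\rangle\langle x_k|$, $k=1,\dots,N$. For a POVM $\{M_k\}_{k=1}^N$ and Hermitian $X$, $\mathcal{M}(X)=(\mathrm{tr}(M_kX))_{k=1}^N\in\mathbb{R}^N$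 and $\|\cdot\|_{\ell_1}$ is the vector $\ell_1$-norm. $\|X\|_p$ denotes the Schatten $p$-norm. $\alpha(z)=\frac{1}{d^2}\sum_{k=1}^{d^2}\langle z|W_k|z\rangle^4$. *)

theory Defs
  imports "Jordan_Normal_Form.Schur_Decomposition" "Jordan_Normal_Form.Char_Poly"
begin

definition pauli1 :: "nat \<Rightarrow> complex mat" where
  "pauli1 k = (if k = 1 then mat_of_rows_list 2 [[0, 1], [1, 0]]
          else if k = 2 then mat_of_rows_list 2 [[0, -\<i>], [\<i>, 0]]
          else if k = 3 then mat_of_rows_list 2 [[1, 0], [0, -1]]
          else 1\<^sub>m 2)"

definition kron :: "complex mat \<Rightarrow> complex mat \<Rightarrow> complex mat" where
  "kron A B = mat (dim_row A * dim_row B) (dim_col A * dim_col B)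
     (\<lambda>(i, j). A $$ (i div dim_row B, j div dim_col B) * B $$ (i mod dim_row B, j mod dim_col B))"

definition pauli_op :: "nat list \<Rightarrow> complex mat" where
  "pauli_op ks = foldr (\<lambda>k M. kron (pauli1 k) M) ks (1\<^sub>m 1)"

definition pauli_indices :: "nat \<Rightarrow> nat list set" where
  "pauli_indices n = {ks. length ks = n \<and> set ks \<subseteq> {0..<4}}"

definition pauli_ops :: "nat \<Rightarrow> complex mat set" where
  "pauli_ops n = pauli_op ` pauli_indices n"

definition pauli_group :: "nat \<Rightarrow> complex mat set" where
  "pauli_group n = {c \<cdot>\<^sub>m W | c W. c \<in> {1, -1, \<i>, -\<i>} \<and> W \<in> pauli_ops n}"

definition unitary_mat :: "nat \<Rightarrow> complex mat \<Rightarrow> bool" where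
  "unitary_mat d U \<longleftrightarrow> U \<in> carrier_mat d d \<and> mat_adjoint U * U = 1\<^sub>m d"

definition clifford_group :: "nat \<Rightarrow> complex mat set" where
  "clifford_group n = {U. unitary_mat (2 ^ n) U \<and>
       (\<forall>P \<in> pauli_group n. U * P * mat_adjoint U \<in> pauli_group n)}"

definition proj :: "complex vec \<Rightarrow> complex mat" where
  "proj z = mat (dim_vec z) (dim_vec z) (\<lambda>(i, j). z $ i * cnj (z $ j))"

definition clifford_orbit :: "nat \<Rightarrow> complex vec \<Rightarrow> complex mat set" where
  "clifford_orbit n z = {U * proj z * mat_adjoint U | U. U \<in> clifford_group n}"

definition clifford_povm_elem :: "nat \<Rightarrow> complex vec \<Rightarrow> complex mat \<Rightarrow> complex mat" where
  "clifford_povm_elem n z P = complex_of_real (2 ^ n / real (card (clifford_orbit n z))) \<cdot>\<^sub>m P"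

definition mtrace :: "complex mat \<Rightarrow> complex" where
  "mtrace A = (\<Sum>i < dim_row A. A $$ (i, i))"

definition clifford_povm_l1 :: "nat \<Rightarrow> complex vec \<Rightarrow> complex mat \<Rightarrow> real" where
  "clifford_povm_l1 n z X = (\<Sum>P \<in> clifford_orbit n z. cmod (mtrace (clifford_povm_elem n z P * X)))"

definition singular_values :: "complex mat \<Rightarrow> real multiset" where
  "singular_values X = image_mset (\<lambda>\<mu>. sqrt (Re \<mu>)) (proots (char_poly (mat_adjoint X * X)))"

definition schatten_norm :: "real \<Rightarrow> complex mat \<Rightarrow> real" where
  "schatten_norm p X = (\<Sum>\<^sub># (image_mset (\<lambda>s. s powr p) (singular_values X))) powr (1 / p)"

definition r_eff :: "complex mat \<Rightarrow> real" where
  "r_eff X = (schatten_norm 1 X)\<^sup>2 / (schatten_norm 2 X)\<^sup>2"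

definition pauli_alpha :: "nat \<Rightarrow> complex vec \<Rightarrow> real" where
  "pauli_alpha n z = (1 / (2 ^ n)\<^sup>2) * (\<Sum>ks \<in> pauli_indices n. (Re ((pauli_op ks *\<^sub>v z) \<bullet>c z)) ^ 4)"

end

theory Submission
  imports Defs "Jordan_Normal_Form.Spectral_Radius" "HOL-Analysis.Convex"
begin

text \<open>With \<open>S = tr (P X)\<close> for \<open>P\<close> uniform on the orbit, the norm in question is \<open>d E |S|\<close>, and
  \<open>(E S\<^sup>2)\<^sup>3 \<le> (E |S|)\<^sup>2 (E S\<^sup>4)\<close>, so the second moment and an upper bound on the fourth moment suffice.

  The orbit is invariant under the Pauli operators and under the Clifford gates \<open>(V + V') / sqrt 2\<close>, where \<open>V\<close>
  and \<open>V'\<close> are anticommuting Pauli operators. On Pauli operators, a symmetric four-linear form with this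
  invariance depends only on the commutation pattern of its arguments. If the form is moreover supported on the
  symmetric subspace, then expanding the swap of two tensor factors in Pauli operators gives linear relations
  between the patterns, and all values are determined by two of them: the value at the identity and the sum
  over \<open>W \<otimes> W \<otimes> W \<otimes> W\<close>. Hence the fourth moment operator is a combination of \<open>P\<^sub>s\<^sub>y\<^sub>m\<close> and \<open>Q P\<^sub>s\<^sub>y\<^sub>m\<close>, where
  \<open>Q\<close> is the projector \<open>(1/d\<^sup>2) \<Sum>W. W \<otimes> W \<otimes> W \<otimes> W\<close>, with coefficients determined by \<open>\<alpha>\<close>.

  The first term is a polynomial in the power sums of the eigenvalues of \<open>X\<close>. For the second one, positivity of
  \<open>Q\<close> in an eigenbasis of \<open>X\<close> bounds each permutation by \<open>(1/d\<^sup>2) \<Sum>W. (tr (W |X|))\<^sup>4\<close>, which is at most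
  \<open>\<parallel>X\<parallel>\<^sub>1\<^sup>2 \<parallel>X\<parallel>\<^sub>2\<^sup>2 / d\<close>.\<close>

section \<open>Pauli bases\<close>

text \<open>The orbit shares its second moment with the uniform distribution on pure states, but in
  general not its fourth, so \<open>E S^4\<close> is no combination of permutation traces alone. One
  extra parameter records the defect: \<alpha> is the weight of the fourth moment operator on the
  range of Q. Instead of computing the commutant of the Clifford action, the proof shows that an
  invariant form on the symmetric subspace which is zero at the two normalising values is zero
  everywhere. What shapes this part is that conjugation moves Pauli operators only up to sign. The
  quantities tracked are therefore chosen so that signs come in pairs, or only their vanishing is
  transported.

  In the final bound, 10 comes from the \<open>P_sym\<close> contribution and 6 d \<alpha> from the
  absolute value of the coefficient of \<open>Q P_sym\<close>. The trace of X enters through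
  \<open>(tr X)^2 + tr (X^2)\<close>, whose cube occurs on both sides of the moment inequality and
  cancels; the bound thus holds whatever the trace is.\<close>

abbreviation "tr \<equiv> mtrace"

section \<open>Traces, products and adjoints of complex matrices\<close>

lemma mtrace_carrier: "A \<in> carrier_mat d d \<Longrightarrow> tr A = (\<Sum>i<d. A $$ (i, i))"
  by (simp add: mtrace_def)

lemma mtrace_mult:
  assumes "A \<in> carrier_mat d d" "B \<in> carrier_mat d d"
  shows "tr (A * B) = (\<Sum>i<d. \<Sum>j<d. A $$ (i, j) * B $$ (j, i))"
  using assms by (auto simp: mtrace_def scalar_prod_def atLeast0LessThan intro!: sum.cong)

lemma mult_mat_index:
  "A \<in> carrier_mat n n \<Longrightarrow> B \<in> carrier_mat n n \<Longrightarrow> i < n \<Longrightarrow> j < n \<Longrightarrow>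
    (A * B) $$ (i, j) = (\<Sum>k<n. A $$ (i, k) * B $$ (k, j))"
  by (auto simp: scalar_prod_def atLeast0LessThan intro!: sum.cong)

lemma mtrace_mult3:
  assumes "A \<in> carrier_mat d d" "B \<in> carrier_mat d d" "C \<in> carrier_mat d d"
  shows "tr (A * (B * C)) = (\<Sum>i<d. \<Sum>j<d. \<Sum>k<d. A $$ (i,j) * (B $$ (j,k) * C $$ (k,i)))"
proof -
  have "tr (A * (B * C)) = (\<Sum>i<d. \<Sum>j<d. A $$ (i,j) * (B * C) $$ (j,i))"
    using assms by (intro mtrace_mult mult_carrier_mat)
  also have "\<dots> = (\<Sum>i<d. \<Sum>j<d. A $$ (i,j) * (\<Sum>k<d. B $$ (j,k) * C $$ (k,i)))"
    using assms by (intro sum.cong refl arg_cong2[where f = "(*)"] mult_mat_index) auto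
  finally show ?thesis by (simp only: sum_distrib_left)
qed

lemma mtrace_mult4:
  assumes "A \<in> carrier_mat d d" "B \<in> carrier_mat d d" "C \<in> carrier_mat d d" "E \<in> carrier_mat d d"
  shows "tr (A * (B * (C * E))) = (\<Sum>i<d. \<Sum>j<d. \<Sum>k<d. \<Sum>m<d. A $$ (i,j) * (B $$ (j,k) * (C $$ (k,m) * E $$ (m,i))))"
proof -
  have "tr (A * (B * (C * E))) = (\<Sum>i<d. \<Sum>j<d. \<Sum>k<d. A $$ (i,j) * (B $$ (j,k) * (C * E) $$ (k,i)))"
    using assms by (intro mtrace_mult3 mult_carrier_mat)
  also have "\<dots> = (\<Sum>i<d. \<Sum>j<d. \<Sum>k<d. A $$ (i,j) * (B $$ (j,k) * (\<Sum>m<d. C $$ (k,m) * E $$ (m,i))))"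
    using assms by (intro sum.cong refl arg_cong2[where f = "(*)"] mult_mat_index) auto
  finally show ?thesis by (simp only: sum_distrib_left)
qed

lemma mtrace_comm:
  assumes "A \<in> carrier_mat d d" "B \<in> carrier_mat d d"
  shows "tr (A * B) = tr (B * A)"
  unfolding mtrace_mult[OF assms] mtrace_mult[OF assms(2,1)]
  by (subst sum.swap) (simp add: mult.commute)

lemma mtrace_smult: "A \<in> carrier_mat d d \<Longrightarrow> tr (c \<cdot>\<^sub>m A) = c * tr A"
  by (simp add: mtrace_def sum_distrib_left)

lemma mtrace_one: "tr (1\<^sub>m d) = of_nat d"
  by (simp add: mtrace_def)

lemma mat_adjoint_index [simp]:
  "i < dim_col A \<Longrightarrow> j < dim_row A \<Longrightarrow> mat_adjoint A $$ (i, j) = cnj (A $$ (j, i))"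
  by (auto simp: mat_adjoint_def mat_of_rows_def col_def)

lemma dim_mat_adjoint [simp]:
  "dim_row (mat_adjoint A) = dim_col A" "dim_col (mat_adjoint A) = dim_row A"
  by (auto simp: mat_adjoint_def)

lemma mat_adjoint_carrier [simp]: "A \<in> carrier_mat m k \<Longrightarrow> mat_adjoint A \<in> carrier_mat k m"
  by (metis carrier_matD(1) carrier_matD(2) carrier_matI dim_mat_adjoint)

lemma mat_adjoint_mult:
  fixes A B :: "complex mat"
  assumes "A \<in> carrier_mat d d" "B \<in> carrier_mat d d"
  shows "mat_adjoint (A * B) = mat_adjoint B * mat_adjoint A"
  using assms by (intro eq_matI) (auto simp: scalar_prod_def mult.commute intro!: sum.cong)

lemma mat_adjoint_smult: "mat_adjoint (c \<cdot>\<^sub>m A) = cnj c \<cdot>\<^sub>m mat_adjoint A"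
  by (intro eq_matI) auto

lemma mat_adjoint_add:
  fixes A B :: "complex mat"
  assumes "A \<in> carrier_mat d d" "B \<in> carrier_mat d d"
  shows "mat_adjoint (A + B) = mat_adjoint A + mat_adjoint B"
  using assms by (intro eq_matI) auto

lemma mat_adjoint_adjoint [simp]: "mat_adjoint (mat_adjoint A) = (A :: complex mat)"
  by (intro eq_matI) auto

lemma mat_adjoint_one [simp]: "mat_adjoint (1\<^sub>m d) = (1\<^sub>m d :: complex mat)"
  by (intro eq_matI) auto

lemma smult_one_mat [simp]: "(1::complex) \<cdot>\<^sub>m A = A"
  by (intro eq_matI) auto

lemma mtrace_adjoint: "A \<in> carrier_mat d d \<Longrightarrow> tr (mat_adjoint A) = cnj (tr A)"
  by (auto simp: mtrace_def)

lemma mtrace_hermitian_mult: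
  assumes "A \<in> carrier_mat d d" "B \<in> carrier_mat d d" "mat_adjoint A = A" "mat_adjoint B = B"
  shows "complex_of_real (Re (tr (A * B))) = tr (A * B)"
proof -
  have "cnj (tr (A * B)) = tr (B * A)"
    using mtrace_adjoint[of "A * B" d] assms by (simp add: mat_adjoint_mult[of _ d])
  also have "\<dots> = tr (A * B)" using assms by (intro mtrace_comm)
  finally show ?thesis by (simp add: complex_eq_iff)
qed

lemma smult_smult_mat: "c \<cdot>\<^sub>m (k \<cdot>\<^sub>m A) = (c * k :: complex) \<cdot>\<^sub>m A"
  by (intro eq_matI) auto

lemma add_mat_rearrange:
  fixes A B C E :: "complex mat"
  assumes "A \<in> carrier_mat d d" "B \<in> carrier_mat d d" "C \<in> carrier_mat d d" "E \<in> carrier_mat d d"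
  shows "(A + B) + (C + E) = (A + E) + (B + C)"
  using assms by (intro eq_matI) auto

lemma half_combination:
  fixes P Q :: "complex mat"
  assumes "P \<in> carrier_mat d d" "Q \<in> carrier_mat d d"
  shows "(1/2) \<cdot>\<^sub>m ((a \<cdot>\<^sub>m P + b \<cdot>\<^sub>m P) + (c \<cdot>\<^sub>m Q + e \<cdot>\<^sub>m Q)) = ((a + b) / 2) \<cdot>\<^sub>m P + ((c + e) / 2) \<cdot>\<^sub>m Q"
    and "a \<cdot>\<^sub>m P + 0 \<cdot>\<^sub>m Q = a \<cdot>\<^sub>m P" and "0 \<cdot>\<^sub>m P + a \<cdot>\<^sub>m Q = a \<cdot>\<^sub>m Q"
  using assms by (auto intro!: eq_matI simp: field_simps)

lemma sum_sum_product:
  fixes f :: "'a \<Rightarrow> 'b \<Rightarrow> complex"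
  shows "(\<Sum>i\<in>A. \<Sum>j\<in>B. f i j) * (\<Sum>k\<in>A'. \<Sum>l\<in>B'. g k l) =
    (\<Sum>i\<in>A. \<Sum>j\<in>B. \<Sum>k\<in>A'. \<Sum>l\<in>B'. f i j * g k l)"
  unfolding sum_distrib_right unfolding sum_distrib_left ..

text \<open>These axioms are all that the moment computation takes from the qubit structure.
  \<open>PP_complete\<close> is the entrywise form of the statement that the sum of
  \<open>W (x) W\<close> over \<open>PP\<close> is d times the swap of two tensor factors.\<close>

locale pauli_basis =
  fixes d :: nat and PP :: "complex mat set"
  assumes d_pos: "d > 0"
    and finite_PP [simp]: "finite PP"
    and PP_carrier: "PP \<subseteq> carrier_mat d d"
    and one_PP [simp]: "1\<^sub>m d \<in> PP"
    and PP_herm: "W \<in> PP \<Longrightarrow> mat_adjoint W = W"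
    and PP_sq [simp]: "W \<in> PP \<Longrightarrow> W * W = 1\<^sub>m d"
    and PP_mult: "A \<in> PP \<Longrightarrow> B \<in> PP \<Longrightarrow> \<exists>c\<in>{1, -1, \<i>, -\<i>}. \<exists>C\<in>PP. A * B = c \<cdot>\<^sub>m C"
    and PP_orth: "A \<in> PP \<Longrightarrow> B \<in> PP \<Longrightarrow> A \<noteq> B \<Longrightarrow> tr (A * B) = 0"
    and PP_complete: "i < d \<Longrightarrow> j < d \<Longrightarrow> k < d \<Longrightarrow> l < d \<Longrightarrow>
        (\<Sum>W\<in>PP. W $$ (i, j) * W $$ (k, l)) = (if i = l \<and> j = k then of_nat d else 0)"
begin

abbreviation CM where "CM \<equiv> carrier_mat d d :: complex mat set"
abbreviation I where "I \<equiv> 1\<^sub>m d :: complex mat"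
abbreviation D where "D \<equiv> of_nat d :: complex"

lemma PP_CM [simp]: "W \<in> PP \<Longrightarrow> W \<in> CM"
  using PP_carrier by auto

lemma mult_CM [simp]: "A \<in> CM \<Longrightarrow> B \<in> CM \<Longrightarrow> A * B \<in> CM"
  by (rule mult_carrier_mat)

lemma assoc [simp]: "A \<in> CM \<Longrightarrow> B \<in> CM \<Longrightarrow> C \<in> CM \<Longrightarrow> A * B * C = A * (B * C)"
  by (rule assoc_mult_mat)

lemma mult_smult_left [simp]: "A \<in> CM \<Longrightarrow> B \<in> CM \<Longrightarrow> (c \<cdot>\<^sub>m A) * B = c \<cdot>\<^sub>m (A * B)"
  by (rule mult_smult_assoc_mat)

lemma mult_smult_right [simp]: "A \<in> CM \<Longrightarrow> B \<in> CM \<Longrightarrow> A * (c \<cdot>\<^sub>m B) = c \<cdot>\<^sub>m (A * B)"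
  by (rule mult_smult_distrib)

lemma one_left [simp]: "A \<in> CM \<Longrightarrow> I * A = A" and one_right [simp]: "A \<in> CM \<Longrightarrow> A * I = A"
  by auto

lemma mtrace_smult_CM [simp]: "A \<in> CM \<Longrightarrow> tr (c \<cdot>\<^sub>m A) = c * tr A"
  by (rule mtrace_smult)

lemma PP_cancel [simp]: "W \<in> PP \<Longrightarrow> A \<in> CM \<Longrightarrow> W * (W * A) = A"
  by (metis PP_CM PP_sq assoc one_left)

lemma D_nonzero [simp]: "D \<noteq> 0" "d \<noteq> 0"
  using d_pos by auto

text \<open>Completeness replaces a pair of entries of \<open>V\<close> by the deltas
  \<open>l = i\<close> and \<open>k = j\<close>. The kernel \<open>g\<close> stays arbitrary so that
  one computation serves both trace identities below.\<close>

lemma sum_PP_entries: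
  "(\<Sum>V\<in>PP. \<Sum>i<d. \<Sum>j<d. \<Sum>k<d. \<Sum>l<d. V $$ (i,j) * V $$ (k,l) * g i j k l) = D * (\<Sum>i<d. \<Sum>j<d. g i j j i)"
proof -
  have "(\<Sum>V\<in>PP. \<Sum>i<d. \<Sum>j<d. \<Sum>k<d. \<Sum>l<d. V $$ (i,j) * V $$ (k,l) * g i j k l) =
    (\<Sum>i<d. \<Sum>j<d. \<Sum>k<d. \<Sum>l<d. \<Sum>V\<in>PP. V $$ (i,j) * V $$ (k,l) * g i j k l)"
    by (simp only: sum.swap[of _ _ PP])
  also have "\<dots> = (\<Sum>i<d. \<Sum>j<d. \<Sum>k<d. \<Sum>l<d. if l = i then if k = j then D * g i j k l else 0 else 0)"
    by (intro sum.cong refl) (auto simp: PP_complete sum_distrib_right[symmetric])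
  also have "\<dots> = D * (\<Sum>i<d. \<Sum>j<d. g i j j i)" by (simp add: sum.delta sum_distrib_left)
  finally show ?thesis .
qed

text \<open>Two factors \<open>V\<close> in different traces are contracted into a single trace.
  This is also the Parseval identity of the Pauli basis.\<close>

lemma sum_trace_trace:
  assumes "Y \<in> CM" "Z \<in> CM"
  shows "(\<Sum>V\<in>PP. tr (V * Y) * tr (V * Z)) = D * tr (Y * Z)"
proof -
  have "(\<Sum>V\<in>PP. tr (V * Y) * tr (V * Z)) =
    (\<Sum>V\<in>PP. \<Sum>i<d. \<Sum>j<d. \<Sum>k<d. \<Sum>l<d. V $$ (i,j) * V $$ (k,l) * (Y $$ (j,i) * Z $$ (l,k)))"
    using assms by (intro sum.cong refl) (simp add: mtrace_mult[of _ d] sum_sum_product, simp add: mult_ac)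
  also have "\<dots> = D * tr (Y * Z)"
    unfolding sum_PP_entries mtrace_mult[OF assms] by (subst sum.swap) (rule refl)
  finally show ?thesis .
qed

text \<open>The opposite contraction: two factors \<open>V\<close> inside one trace cut it into two,
  since averaging \<open>V Y V\<close> over the Pauli operators leaves a multiple of the
  identity.\<close>

lemma sum_trace_conj:
  assumes "Y \<in> CM" "Z \<in> CM"
  shows "(\<Sum>V\<in>PP. tr (V * (Y * (V * Z)))) = D * (tr Y * tr Z)"
proof -
  have "(\<Sum>V\<in>PP. tr (V * (Y * (V * Z)))) =
    (\<Sum>V\<in>PP. \<Sum>i<d. \<Sum>j<d. \<Sum>k<d. \<Sum>l<d. V $$ (i,j) * V $$ (k,l) * (Y $$ (j,k) * Z $$ (l,i)))"
    using assms by (intro sum.cong refl) (simp add: mtrace_mult4[of _ d] mult_ac)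
  also have "\<dots> = D * (tr Y * tr Z)"
    unfolding sum_PP_entries mtrace_carrier[OF assms(1)] mtrace_carrier[OF assms(2)] sum_product
    by (subst sum.swap) (rule refl)
  finally show ?thesis .
qed

lemma mtrace_PP: "W \<in> PP \<Longrightarrow> tr W = (if W = I then D else 0)"
  using PP_orth[of W I] by (auto simp: mtrace_one)

lemma card_PP: "of_nat (card PP) = D\<^sup>2"
proof -
  have "(\<Sum>V\<in>PP. tr (V * (I * (V * I)))) = D * (tr I * tr I)"
    by (rule sum_trace_conj) auto
  also have "(\<Sum>V\<in>PP. tr (V * (I * (V * I)))) = (\<Sum>V\<in>PP. D)"
    by (intro sum.cong refl) (simp add: mtrace_one)
  finally show ?thesis by (simp add: mtrace_one power2_eq_square)
qed

lemma mult_phase: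
  assumes "A \<in> PP" "B \<in> PP"
  obtains c C where "A * B = c \<cdot>\<^sub>m C" "C \<in> PP" "c ^ 4 = 1" "c * cnj c = 1" "c\<^sup>2 = 1 \<or> c\<^sup>2 = -1"
  using PP_mult[OF assms] by (fastforce simp: power2_eq_square power4_eq_xxxx)

section \<open>Commutation signs as characters\<close>

definition sg :: "complex mat \<Rightarrow> complex mat \<Rightarrow> complex" where
  "sg A B = (if A * B = B * A then 1 else -1)"

lemma sg_cases: "sg A B = 1 \<or> sg A B = -1"
  by (simp add: sg_def)

lemma sg_sym: "sg A B = sg B A"
  by (auto simp: sg_def)

lemma sg_self [simp]: "sg A A = 1"
  by (simp add: sg_def)

lemma sg_square [simp]: "sg A B * sg A B = 1" "sg A B * (sg A B * x) = x"
  by (auto simp: sg_def)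

lemma sg_one [simp]: "A \<in> CM \<Longrightarrow> sg I A = 1" "A \<in> CM \<Longrightarrow> sg A I = 1"
  by (auto simp: sg_def)

text \<open>\<open>B * A\<close> is the adjoint of \<open>A * B\<close>, so if the latter is
  \<open>c\<close> times a Pauli operator, the former is \<open>cnj c\<close> times the same one. As
  \<open>c\<close> squared is 1 or -1, the two products differ by a sign; this is why the value -1
  of \<open>sg\<close> means anticommutation.\<close>

lemma comm_sg:
  assumes "A \<in> PP" "B \<in> PP"
  shows "A * B = sg A B \<cdot>\<^sub>m (B * A)"
proof -
  obtain c C where c: "A * B = c \<cdot>\<^sub>m C" "C \<in> PP" "c * cnj c = 1" "c\<^sup>2 = 1 \<or> c\<^sup>2 = -1"
    by (rule mult_phase[OF assms])
  have "B * A = mat_adjoint (A * B)"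
    using assms by (simp add: mat_adjoint_mult[of _ d] PP_herm)
  also have "\<dots> = cnj c \<cdot>\<^sub>m C" using c by (simp add: mat_adjoint_smult PP_herm)
  also have "C = cnj c \<cdot>\<^sub>m (A * B)"
    using c by (simp add: smult_smult_mat mult.commute)
  finally have "B * A = cnj (c\<^sup>2) \<cdot>\<^sub>m (A * B)"
    by (simp add: smult_smult_mat power2_eq_square)
  moreover have "cnj (c\<^sup>2) = 1 \<or> cnj (c\<^sup>2) = -1" using c(4) by (metis complex_cnj_one complex_cnj_minus)
  ultimately have "B * A = A * B \<or> B * A = (-1) \<cdot>\<^sub>m (A * B)" by auto
  moreover have "A * B = (-1) \<cdot>\<^sub>m (B * A)" if "B * A = (-1) \<cdot>\<^sub>m (A * B)"
    unfolding that smult_smult_mat by simp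
  ultimately show ?thesis by (auto simp: sg_def)
qed

lemma comm_sg_left:
  assumes "A \<in> PP" "B \<in> PP" "C \<in> CM"
  shows "A * (B * C) = sg A B \<cdot>\<^sub>m (B * (A * C))"
proof -
  have "A * (B * C) = (A * B) * C" using assms by simp
  also have "\<dots> = sg A B \<cdot>\<^sub>m (B * (A * C))" unfolding comm_sg[OF assms(1,2)] using assms by simp
  finally show ?thesis .
qed

lemma conj_PP: "A \<in> PP \<Longrightarrow> B \<in> PP \<Longrightarrow> A * (B * A) = sg A B \<cdot>\<^sub>m B"
  by (subst comm_sg_left) auto

lemma smult_eq_imp_eq:
  assumes "c \<cdot>\<^sub>m A = k \<cdot>\<^sub>m A" "A \<in> PP" shows "c = (k::complex)"
proof -
  have "tr ((c \<cdot>\<^sub>m A) * A) = tr ((k \<cdot>\<^sub>m A) * A)" using assms(1) by simp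
  thus ?thesis using assms(2) by (simp add: mtrace_one)
qed

text \<open>\<open>A\<close> is moved past \<open>B\<close> and past \<open>C\<close> separately, so
  \<open>sg A\<close> is a character of the Pauli group modulo phases.\<close>

lemma sg_mult:
  assumes "A \<in> PP" "B \<in> PP" "C \<in> PP" "R \<in> PP" and BC: "B * C = c \<cdot>\<^sub>m R" and "c \<noteq> 0"
  shows "sg A R = sg A B * sg A C"
proof -
  have R: "R = inverse c \<cdot>\<^sub>m (B * C)" unfolding BC using \<open>c \<noteq> 0\<close> by (simp add: smult_smult_mat)
  have "A * (R * A) = inverse c \<cdot>\<^sub>m (A * (B * (C * A)))" unfolding R using assms(1-3) by simp
  also have "A * (B * (C * A)) = sg A B * sg A C \<cdot>\<^sub>m (B * C)"
    using assms(1-3) by (simp add: comm_sg_left[of A B] conj_PP[of A C] smult_smult_mat)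
  also have "inverse c \<cdot>\<^sub>m (sg A B * sg A C \<cdot>\<^sub>m (B * C)) = (sg A B * sg A C) \<cdot>\<^sub>m R"
    unfolding R by (simp add: smult_smult_mat mult_ac)
  finally have "sg A R \<cdot>\<^sub>m R = (sg A B * sg A C) \<cdot>\<^sub>m R"
    using conj_PP[of A R] assms by simp
  from smult_eq_imp_eq[OF this] show ?thesis using assms by simp
qed

text \<open>Character orthogonality, read off from the contraction of \<open>tr (S X S X)\<close>:
  each term equals \<open>D * sg X S\<close>, while the whole sum is \<open>D\<close> times the
  squared trace of \<open>X\<close>.\<close>

lemma sum_sg:
  assumes "X \<in> PP"
  shows "(\<Sum>S\<in>PP. sg X S) = (if X = I then D\<^sup>2 else 0)"
proof -
  have "(\<Sum>S\<in>PP. tr (S * (X * (S * X)))) = D * (tr X * tr X)"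
    using assms by (intro sum_trace_conj) auto
  moreover have "tr (S * (X * (S * X))) = D * sg X S" if "S \<in> PP" for S
    using that assms by (simp add: conj_PP[of X S] mtrace_one)
  ultimately have "D * (\<Sum>S\<in>PP. sg X S) = D * (tr X * tr X)"
    by (simp add: sum_distrib_left)
  thus ?thesis using assms by (simp add: mtrace_PP power2_eq_square)
qed

text \<open>\<open>T\<close> maps \<open>PP\<close> to itself only up to phases, and
  \<open>r\<close> strips the phase. If \<open>r\<close> identified two operators, they would be
  proportional, which orthogonality forbids for distinct elements of \<open>PP\<close>; so
  \<open>r\<close> permutes the finite set \<open>PP\<close>, and \<open>f\<close> does not see the
  stripped phases.\<close>

lemma sum_PP_perm:
  assumes T: "\<And>W. W \<in> PP \<Longrightarrow> \<exists>c. \<exists>C\<in>PP. c ^ 4 = 1 \<and> T W = c \<cdot>\<^sub>m C"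
    and T_inj: "\<And>A B c. A \<in> PP \<Longrightarrow> B \<in> PP \<Longrightarrow> T B = c \<cdot>\<^sub>m T A \<Longrightarrow> c \<noteq> 0 \<Longrightarrow> B = c \<cdot>\<^sub>m A"
    and f: "\<And>c W. c ^ 4 = 1 \<Longrightarrow> W \<in> PP \<Longrightarrow> f (c \<cdot>\<^sub>m W) = f W"
  shows "(\<Sum>W\<in>PP. f (T W)) = (\<Sum>W\<in>PP. f W)"
proof -
  have "\<exists>C. \<exists>c. W \<in> PP \<longrightarrow> (C \<in> PP \<and> c ^ 4 = 1 \<and> T W = c \<cdot>\<^sub>m C)" for W
    using T[of W] by blast
  then obtain r where r: "\<And>W. \<exists>c. W \<in> PP \<longrightarrow> (r W \<in> PP \<and> c ^ 4 = 1 \<and> T W = c \<cdot>\<^sub>m r W)" by metis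
  have inj: "inj_on r PP"
  proof (rule inj_onI)
    fix A B assume AB: "A \<in> PP" "B \<in> PP" "r A = r B"
    obtain a b where a: "a ^ 4 = 1" "T A = a \<cdot>\<^sub>m r A" and b: "b ^ 4 = 1" "T B = b \<cdot>\<^sub>m r A"
      using r[of A] r[of B] AB by auto
    have ba: "b / a \<noteq> 0" "a \<noteq> 0" using a(1) b(1) by auto
    have "T B = (b / a) \<cdot>\<^sub>m T A" unfolding a(2) b(2) using ba by (simp add: smult_smult_mat)
    from T_inj[OF AB(1,2) this ba(1)] have B: "B = (b / a) \<cdot>\<^sub>m A" .
    have "A * B = (b / a) \<cdot>\<^sub>m I" by (subst B) (use AB in simp)
    hence "tr (A * B) = (b / a) * D" by (simp add: mtrace_one)
    thus "A = B" using PP_orth[of A B] AB ba by auto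
  qed
  have "r ` PP \<subseteq> PP" using r by auto
  hence bij: "bij_betw r PP PP" using endo_inj_surj[OF finite_PP _ inj] inj by (auto simp: bij_betw_def)
  have "(\<Sum>W\<in>PP. f (T W)) = (\<Sum>W\<in>PP. f (r W))"
    using r f by (intro sum.cong refl) metis
  also have "\<dots> = (\<Sum>W\<in>PP. f W)" by (rule sum.reindex_bij_betw[OF bij])
  finally show ?thesis .
qed

lemma sum_PP_unitary_conj:
  assumes U: "U \<in> CM" "mat_adjoint U * U = I"
    and conj: "\<And>W. W \<in> PP \<Longrightarrow> \<exists>c\<in>{1, -1, \<i>, -\<i>}. \<exists>C\<in>PP. U * (W * mat_adjoint U) = c \<cdot>\<^sub>m C"
    and f: "\<And>c W. c ^ 4 = 1 \<Longrightarrow> W \<in> PP \<Longrightarrow> f (c \<cdot>\<^sub>m W) = f W"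
  shows "(\<Sum>W\<in>PP. f (U * (W * mat_adjoint U))) = (\<Sum>W\<in>PP. f W)"
proof (rule sum_PP_perm[where T = "\<lambda>W. U * (W * mat_adjoint U)", OF _ _ f])
  show "\<exists>c. \<exists>C\<in>PP. c ^ 4 = 1 \<and> U * (W * mat_adjoint U) = c \<cdot>\<^sub>m C" if W: "W \<in> PP" for W
  proof -
    obtain c C where c: "c \<in> {1, -1, \<i>, -\<i>}" "C \<in> PP" "U * (W * mat_adjoint U) = c \<cdot>\<^sub>m C"
      using conj[OF W] by blast
    have "c ^ 4 = 1" using c(1) by (auto simp: power4_eq_xxxx)
    thus ?thesis using c(2,3) by blast
  qed
  show "B = c \<cdot>\<^sub>m A" if AB: "A \<in> PP" "B \<in> PP" and eq: "U * (B * mat_adjoint U) = c \<cdot>\<^sub>m (U * (A * mat_adjoint U))" for A B c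
  proof -
    have UU: "mat_adjoint U * ((U * (X * mat_adjoint U)) * U) = X" if X: "X \<in> CM" for X
    proof -
      have "mat_adjoint U * ((U * (X * mat_adjoint U)) * U) = (mat_adjoint U * U) * (X * (mat_adjoint U * U))"
        using X U(1) by simp
      thus ?thesis using X unfolding U(2) by simp
    qed
    have "B = mat_adjoint U * ((U * (B * mat_adjoint U)) * U)" using UU[of B] AB by simp
    also have "\<dots> = c \<cdot>\<^sub>m (mat_adjoint U * ((U * (A * mat_adjoint U)) * U))"
      unfolding eq using AB U(1) by (simp del: assoc)
    also have "\<dots> = c \<cdot>\<^sub>m A" using UU[of A] AB by simp
    finally show ?thesis .
  qed
qed auto

lemma sum_PP_mult_right:
  assumes V: "V \<in> PP" and f: "\<And>c W. c ^ 4 = 1 \<Longrightarrow> W \<in> PP \<Longrightarrow> f (c \<cdot>\<^sub>m W) = f W"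
  shows "(\<Sum>W\<in>PP. f (W * V)) = (\<Sum>W\<in>PP. f W)"
proof (rule sum_PP_perm[where T = "\<lambda>W. W * V", OF _ _ f])
  show "\<exists>c. \<exists>C\<in>PP. c ^ 4 = 1 \<and> W * V = c \<cdot>\<^sub>m C" if "W \<in> PP" for W
    using mult_phase[OF that V] by metis
  show "B = c \<cdot>\<^sub>m A" if "A \<in> PP" "B \<in> PP" "B * V = c \<cdot>\<^sub>m (A * V)" for A B c
  proof -
    have "B = (B * V) * V" using that(1,2) V by simp
    also have "\<dots> = c \<cdot>\<^sub>m A" unfolding that(3) using that(1,2) V by simp
    finally show ?thesis .
  qed
qed auto

text \<open>For anticommuting \<open>V\<close> and \<open>V'\<close> this is a Clifford unitary exchanging them. Together with the Pauli
  operators these are the only Clifford gates that the argument uses.\<close>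

definition hada :: "complex mat \<Rightarrow> complex mat \<Rightarrow> complex mat" where
  "hada V V' = complex_of_real (1 / sqrt 2) \<cdot>\<^sub>m (V + V')"

lemma hada_CM [simp]: "V \<in> PP \<Longrightarrow> V' \<in> PP \<Longrightarrow> hada V V' \<in> CM"
  by (simp add: hada_def)

lemma half_square: "complex_of_real (1 / sqrt 2) * complex_of_real (1 / sqrt 2) = 1 / 2"
  by (simp flip: of_real_mult)

lemma hada_conj:
  assumes "V \<in> PP" "V' \<in> PP" "A \<in> CM"
  shows "hada V V' * (A * hada V V') = (1/2) \<cdot>\<^sub>m ((V * (A * V) + V' * (A * V')) + (V * (A * V') + V' * (A * V)))"
proof -
  let ?s = "complex_of_real (1 / sqrt 2)"
  have "hada V V' * (A * hada V V') = (?s * ?s) \<cdot>\<^sub>m ((V + V') * (A * (V + V')))"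
    unfolding hada_def using assms by (simp add: smult_smult_mat)
  also have "(V + V') * (A * (V + V')) = (V * (A * V) + V' * (A * V')) + (V * (A * V') + V' * (A * V))"
  proof -
    have "(V + V') * (A * (V + V')) = (V + V') * (A * V + A * V')"
      using assms by (simp add: mult_add_distrib_mat[of A d d V d V'])
    also have "\<dots> = V * (A * V + A * V') + V' * (A * V + A * V')"
      using assms by (intro add_mult_distrib_mat[of _ d d _ _ d]) auto
    also have "\<dots> = (V * (A * V) + V * (A * V')) + (V' * (A * V) + V' * (A * V'))"
      using assms by (simp add: mult_add_distrib_mat[of _ d d _ d])
    also have "\<dots> = (V * (A * V) + V' * (A * V')) + (V * (A * V') + V' * (A * V))"
      using assms by (intro add_mat_rearrange[of _ d]) auto
    finally show ?thesis .
  qed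
  finally show ?thesis by (simp only: half_square)
qed

text \<open>The diagonal terms \<open>V\<close> and \<open>V' V V' = - V\<close> cancel, while both
  cross terms reduce to \<open>V'\<close>.\<close>

lemma hada_conj_left:
  assumes V: "V \<in> PP" "V' \<in> PP" "sg V V' = -1"
  shows "hada V V' * (V * hada V V') = V'"
proof -
  have "V' * (V * V') = (-1) \<cdot>\<^sub>m V" using V by (simp add: conj_PP sg_sym[of V' V])
  hence "hada V V' * (V * hada V V') = (1/2) \<cdot>\<^sub>m ((1 \<cdot>\<^sub>m V + (-1) \<cdot>\<^sub>m V) + (1 \<cdot>\<^sub>m V' + 1 \<cdot>\<^sub>m V'))"
    using V by (subst hada_conj) auto
  thus ?thesis using V by (simp add: half_combination[of _ d] del: smult_one_mat) simp
qed

lemma hada_sym: "V \<in> PP \<Longrightarrow> V' \<in> PP \<Longrightarrow> hada V V' = hada V' V"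
  unfolding hada_def by (subst comm_add_mat[of _ d d]) auto

lemma hada_conj_right:
  assumes V: "V \<in> PP" "V' \<in> PP" "sg V V' = -1"
  shows "hada V V' * (V' * hada V V') = V"
  using hada_conj_left[of V' V] assms by (simp add: hada_sym[of V V'] sg_sym)

text \<open>The cross terms cancel because \<open>V' V = - V V'\<close>. When \<open>A\<close> has
  opposite signs with \<open>V\<close> and \<open>V'\<close> it is the diagonal terms that cancel,
  and the conjugate is a new Pauli operator up to phase.\<close>

lemma hada_conj_fix:
  assumes V: "V \<in> PP" "V' \<in> PP" "sg V V' = -1" and A: "A \<in> PP" "sg V A = sg V' A"
  shows "hada V V' * (A * hada V V') = sg V A \<cdot>\<^sub>m A"
proof -
  have 1: "V * (A * V') = sg V A \<cdot>\<^sub>m (A * (V * V'))" using V A by (intro comm_sg_left) auto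
  have "V' * (A * V) = sg V' A \<cdot>\<^sub>m (A * (V' * V))" using V A by (intro comm_sg_left) auto
  also have "V' * V = (-1) \<cdot>\<^sub>m (V * V')" using comm_sg[of V' V] V by (simp add: sg_sym)
  finally have 2: "V' * (A * V) = (- sg V A) \<cdot>\<^sub>m (A * (V * V'))" using A V by (simp add: smult_smult_mat)
  have 3: "V * (A * V) = sg V A \<cdot>\<^sub>m A" "V' * (A * V') = sg V A \<cdot>\<^sub>m A"
    using V A by (simp_all add: conj_PP)
  show ?thesis
    unfolding hada_conj[OF V(1,2) PP_CM[OF A(1)]] 1 2 3 using V A by (simp add: half_combination[of _ d])
qed

lemma hada_conj_mixed:
  assumes V: "V \<in> PP" "V' \<in> PP" "sg V V' = -1" and A: "A \<in> PP" "sg V A = - sg V' A"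
  shows "hada V V' * (A * hada V V') = sg V A \<cdot>\<^sub>m (A * (V * V'))"
proof -
  have 1: "V * (A * V') = sg V A \<cdot>\<^sub>m (A * (V * V'))" using V A by (intro comm_sg_left) auto
  have "V' * (A * V) = sg V' A \<cdot>\<^sub>m (A * (V' * V))" using V A by (intro comm_sg_left) auto
  also have "V' * V = (-1) \<cdot>\<^sub>m (V * V')" using comm_sg[of V' V] V by (simp add: sg_sym)
  finally have 2: "V' * (A * V) = (sg V A) \<cdot>\<^sub>m (A * (V * V'))" using A V by (simp add: smult_smult_mat)
  have 3: "V * (A * V) = sg V A \<cdot>\<^sub>m A" "V' * (A * V') = (- sg V A) \<cdot>\<^sub>m A"
    using V A by (simp_all add: conj_PP)
  show ?thesis
    unfolding hada_conj[OF V(1,2) PP_CM[OF A(1)]] 1 2 3 using V A by (simp add: half_combination[of _ d])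
qed

lemma hada_square:
  assumes V: "V \<in> PP" "V' \<in> PP" "sg V V' = -1"
  shows "hada V V' * hada V V' = I"
  using hada_conj_fix[OF V one_PP] V by simp

lemma hada_herm: "V \<in> PP \<Longrightarrow> V' \<in> PP \<Longrightarrow> mat_adjoint (hada V V') = hada V V'"
  by (simp add: hada_def mat_adjoint_smult mat_adjoint_add[of _ d] PP_herm)

section \<open>The gates under which invariance is required\<close>

definition gens :: "complex mat set" where
  "gens = PP \<union> {hada V V' | V V'. V \<in> PP \<and> V' \<in> PP \<and> sg V V' = -1}"

lemma gens_CM [simp]: "U \<in> gens \<Longrightarrow> U \<in> CM"
  by (auto simp: gens_def)

lemma hada_gens [simp]: "V \<in> PP \<Longrightarrow> V' \<in> PP \<Longrightarrow> sg V V' = -1 \<Longrightarrow> hada V V' \<in> gens"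
  by (auto simp: gens_def)

lemma PP_gens [simp]: "V \<in> PP \<Longrightarrow> V \<in> gens"
  by (auto simp: gens_def)

lemma gens_square [simp]: "U \<in> gens \<Longrightarrow> U * U = I"
  by (auto simp: gens_def hada_square)

lemma gens_herm: "U \<in> gens \<Longrightarrow> mat_adjoint U = U"
  by (auto simp: gens_def hada_herm PP_herm)

text \<open>This is the Clifford property of the gates. It keeps the orbit invariant under them and
  allows sums over \<open>PP\<close> to be reindexed by conjugation.\<close>

lemma gens_conj:
  assumes "U \<in> gens" "A \<in> PP"
  shows "\<exists>c\<in>{1, -1, \<i>, -\<i>}. \<exists>C\<in>PP. U * (A * U) = c \<cdot>\<^sub>m C"
proof -
  have sgs: "\<exists>c\<in>{1, -1, \<i>, -\<i>}. \<exists>C\<in>PP. sg V A \<cdot>\<^sub>m A = c \<cdot>\<^sub>m C" for V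
    using assms(2) sg_cases[of V A] by blast
  consider "U \<in> PP" | V V' where "V \<in> PP" "V' \<in> PP" "sg V V' = -1" "U = hada V V'"
    using assms(1) by (auto simp: gens_def)
  thus ?thesis
  proof cases
    case 1 thus ?thesis using sgs[of U] assms(2) by (simp add: conj_PP)
  next
    case 2
    show ?thesis
    proof (cases "sg V A = sg V' A")
      case True thus ?thesis using hada_conj_fix[OF 2(1-3) assms(2) True] sgs[of V] 2(4) by simp
    next
      case False
      hence "sg V A = - sg V' A" using sg_cases[of V A] sg_cases[of V' A] by auto
      hence eq: "U * (A * U) = sg V A \<cdot>\<^sub>m (A * (V * V'))" using hada_conj_mixed 2 assms by auto
      obtain c C where c: "c \<in> {1, -1, \<i>, -\<i>}" "C \<in> PP" "V * V' = c \<cdot>\<^sub>m C" using PP_mult 2 by metis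
      obtain k E where k: "k \<in> {1, -1, \<i>, -\<i>}" "E \<in> PP" "A * C = k \<cdot>\<^sub>m E" using PP_mult assms c by metis
      have "U * (A * U) = (sg V A * c * k) \<cdot>\<^sub>m E"
        unfolding eq c(3) using c(2) k(2,3) assms by (simp add: smult_smult_mat mult_ac)
      moreover have "sg V A * c * k \<in> {1, -1, \<i>, -\<i>}" using sg_cases[of V A] c(1) k(1) by auto
      ultimately show ?thesis using k(2) by blast
    qed
  qed
qed

lemma gens_conj_mult:
  assumes "U \<in> gens" "A \<in> CM" "B \<in> CM"
  shows "U * ((A * B) * U) = (U * (A * U)) * (U * (B * U))"
proof -
  have "(U * (A * U)) * (U * (B * U)) = U * (A * ((U * U) * (B * U)))" using assms by (simp del: gens_square)
  thus ?thesis using assms by simp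
qed

lemma gens_conj_conj:
  assumes U: "U \<in> gens" and A: "A \<in> CM" shows "U * ((U * (A * U)) * U) = A"
proof -
  have "U * ((U * (A * U)) * U) = (U * U) * (A * (U * U))" using U A by (simp del: gens_square)
  thus ?thesis using U A by simp
qed

end

section \<open>Uniqueness of invariant four-linear forms\<close>

context pauli_basis begin

lemma PP_eq_of_mult:
  assumes "A \<in> PP" "B \<in> PP" "A * B = c \<cdot>\<^sub>m I" "c \<noteq> 0"
  shows "A = B"
proof (rule ccontr)
  assume "A \<noteq> B"
  hence "tr (A * B) = 0" using PP_orth assms by blast
  thus False using assms by (simp add: mtrace_one)
qed

text \<open>The product of the two characters is the character of the product \<open>A * B\<close>,
  which is trivial only for \<open>A = B\<close>. Hence Pauli operators are separated by their
  commutation signs.\<close>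

lemma sum_sg_sg:
  assumes "A \<in> PP" "B \<in> PP"
  shows "(\<Sum>S\<in>PP. sg A S * sg B S) = (if A = B then D\<^sup>2 else 0)"
proof -
  obtain c R where c: "A * B = c \<cdot>\<^sub>m R" "R \<in> PP" "c ^ 4 = 1" by (rule mult_phase[OF assms])
  hence c0: "c \<noteq> 0" by auto
  have "sg A S * sg B S = sg R S" if "S \<in> PP" for S
    using sg_mult[of S A B R c] assms c c0 that by (simp add: sg_sym)
  hence "(\<Sum>S\<in>PP. sg A S * sg B S) = (\<Sum>S\<in>PP. sg R S)" by (intro sum.cong) auto
  also have "\<dots> = (if R = I then D\<^sup>2 else 0)" using c by (simp add: sum_sg)
  also have "R = I \<longleftrightarrow> A = B"
  proof
    assume "R = I" thus "A = B" using PP_eq_of_mult[of A B c] assms c c0 by simp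
  next
    assume "A = B"
    hence "c \<cdot>\<^sub>m R = I" using c assms by simp
    hence "tr (c \<cdot>\<^sub>m R) = D" by (simp add: mtrace_one)
    thus "R = I" using c(2) by (auto simp: mtrace_PP split: if_splits)
  qed
  finally show ?thesis .
qed

text \<open>By nondegeneracy of the commutation form, this says that \<open>C\<close> is not, up to a phase, one of
  \<open>1\<close>, \<open>A\<close>, \<open>B\<close>, \<open>A * B\<close>.\<close>

definition indep :: "complex mat \<Rightarrow> complex mat \<Rightarrow> complex mat \<Rightarrow> bool" where
  "indep A B C \<longleftrightarrow> (\<exists>S\<in>PP. sg A S = 1 \<and> sg B S = 1 \<and> sg C S = -1)"

text \<open>Non-independence makes every term of the sum of
  \<open>(1 + sg A S) * (1 + sg B S) * (1 - sg C S)\<close> vanish. Expanded into characters, the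
  term of \<open>I\<close> alone gives \<open>D\<close> squared, the other positive terms are
  nonnegative, and a negative term survives only if \<open>C\<close> is \<open>I\<close>,
  \<open>A\<close>, \<open>B\<close> or the Pauli operator \<open>R\<close> proportional to
  \<open>A * B\<close>.\<close>

lemma not_indep_cases:
  assumes "A \<in> PP" "B \<in> PP" "C \<in> PP" "\<not> indep A B C"
  obtains "C = I" | "C = A" | "C = B" | c where "c \<noteq> 0" "A * B = c \<cdot>\<^sub>m C"
proof -
  obtain c R where c: "A * B = c \<cdot>\<^sub>m R" "R \<in> PP" "c ^ 4 = 1" by (rule mult_phase[OF assms(1,2)])
  hence c0: "c \<noteq> 0" by auto
  have R: "sg R S = sg A S * sg B S" if "S \<in> PP" for S
    using sg_mult[of S A B R c] assms c c0 that by (simp add: sg_sym)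
  have "(\<Sum>S\<in>PP. (1 + sg A S) * (1 + sg B S) * (1 - sg C S)) = 0"
  proof (rule sum.neutral, rule ballI)
    fix S assume "S \<in> PP"
    hence "\<not> (sg A S = 1 \<and> sg B S = 1 \<and> sg C S = -1)" using assms(4) by (auto simp: indep_def)
    thus "(1 + sg A S) * (1 + sg B S) * (1 - sg C S) = 0"
      using sg_cases[of A S] sg_cases[of B S] sg_cases[of C S] by auto
  qed
  moreover have "(1 + sg A S) * (1 + sg B S) * (1 - sg C S) =
      sg I S + sg A S + sg B S + sg R S - sg C S - sg A S * sg C S - sg B S * sg C S - sg R S * sg C S" if "S \<in> PP" for S
    using that by (simp add: R algebra_simps)
  ultimately have "(\<Sum>S\<in>PP. sg I S + sg A S + sg B S + sg R S - sg C S - sg A S * sg C S - sg B S * sg C S - sg R S * sg C S) = 0"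
    by simp
  hence "(\<Sum>S\<in>PP. sg I S) + (\<Sum>S\<in>PP. sg A S) + (\<Sum>S\<in>PP. sg B S) + (\<Sum>S\<in>PP. sg R S) - (\<Sum>S\<in>PP. sg C S)
     - (\<Sum>S\<in>PP. sg A S * sg C S) - (\<Sum>S\<in>PP. sg B S * sg C S) - (\<Sum>S\<in>PP. sg R S * sg C S) = 0"
    by (simp only: sum.distrib sum_subtractf)
  hence "C = I \<or> C = A \<or> C = B \<or> C = R"
    using assms c(2) by (simp add: sum_sg sum_sg_sg card_PP split: if_splits)
  thus ?thesis using that c c0 by blast
qed

lemma indep_same:
  assumes "V \<in> PP" "W \<in> PP" "W \<noteq> I" "W \<noteq> V"
  shows "indep V V W"
proof (rule ccontr)
  assume "\<not> indep V V W"
  thus False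
  proof (rule not_indep_cases[OF assms(1) assms(1) assms(2)])
    fix c assume c: "c \<noteq> 0" "V * V = c \<cdot>\<^sub>m W"
    have "I * W = inverse c \<cdot>\<^sub>m (V * V)" unfolding c(2) using c(1) assms(2) by (simp add: smult_smult_mat)
    hence "I * W = inverse c \<cdot>\<^sub>m I" using assms(1) by simp
    from PP_eq_of_mult[OF one_PP assms(2) this] have "I = W" using c(1) by simp
    thus False using assms by simp
  qed (use assms in auto)
qed

lemma gens_conj_mult3:
  assumes "U \<in> gens" "A \<in> CM" "B \<in> CM" "C \<in> CM"
  shows "U * ((A * (B * C)) * U) = (U * (A * U)) * ((U * (B * U)) * (U * (C * U)))"
  unfolding gens_conj_mult[OF assms(1,2) mult_CM[OF assms(3,4)]] gens_conj_mult[OF assms(1,3,4)] ..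

text \<open>A Witt-type transitivity statement: one or two exchanges suffice to carry \<open>C\<close> to \<open>C'\<close> while fixing
  \<open>A\<close> and \<open>B\<close> up to sign.\<close>

lemma move_indep:
  assumes inv: "\<And>C C'. C \<in> PP \<Longrightarrow> C' \<in> PP \<Longrightarrow> sg C C' = -1 \<Longrightarrow> sg A C = sg A C' \<Longrightarrow> sg B C = sg B C' \<Longrightarrow> f C = f C'"
    and PP: "A \<in> PP" "B \<in> PP" "C \<in> PP" "C' \<in> PP"
    and sg: "sg A C = sg A C'" "sg B C = sg B C'"
    and ind: "indep A B C" "indep A B C'"
  shows "f C = f C'"
proof (cases "sg C C' = -1")
  case True thus ?thesis using inv PP sg by blast
next
  case False
  hence CC: "sg C C' = 1" using sg_cases by blast
  obtain S1 where S1: "S1 \<in> PP" "sg A S1 = 1" "sg B S1 = 1" "sg C S1 = -1" using ind by (auto simp: indep_def)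
  obtain S2 where S2: "S2 \<in> PP" "sg A S2 = 1" "sg B S2 = 1" "sg C' S2 = -1" using ind by (auto simp: indep_def)
  \<comment> \<open>Unless \<open>S1\<close> or \<open>S2\<close> already anticommutes with both
    \<open>C\<close> and \<open>C'\<close>, their product does, each factor contributing one of the
    two signs.\<close>
  have "\<exists>S\<in>PP. sg A S = 1 \<and> sg B S = 1 \<and> sg C S = -1 \<and> sg C' S = -1"
  proof (cases "sg C' S1 = -1 \<or> sg C S2 = -1")
    case True thus ?thesis using S1 S2 by blast
  next
    case False
    hence "sg C' S1 = 1" "sg C S2 = 1" using sg_cases by blast+
    moreover obtain c R where c: "S1 * S2 = c \<cdot>\<^sub>m R" "R \<in> PP" "c ^ 4 = 1" by (rule mult_phase[OF S1(1) S2(1)])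
    moreover have "c \<noteq> 0" using c by auto
    ultimately show ?thesis using S1 S2 PP by (intro bexI[of _ R]) (simp_all add: sg_mult[OF _ S1(1) S2(1) c(2,1)])
  qed
  then obtain S where S: "S \<in> PP" "sg A S = 1" "sg B S = 1" "sg C S = -1" "sg C' S = -1" by blast
  \<comment> \<open>\<open>R\<close>, proportional to \<open>C * S\<close>, is the intermediate
    stop: it anticommutes with \<open>C\<close> and with \<open>C'\<close>, and has the same signs
    as \<open>C\<close> against \<open>A\<close> and \<open>B\<close>.\<close>
  obtain c R where c: "C * S = c \<cdot>\<^sub>m R" "R \<in> PP" "c ^ 4 = 1" by (rule mult_phase[OF PP(3) S(1)])
  have c0: "c \<noteq> 0" using c by auto
  have R: "sg V R = sg V C * sg V S" if "V \<in> PP" for V using sg_mult[OF that PP(3) S(1) c(2,1) c0] .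
  have "f C = f R" using PP S R c(2) by (intro inv) auto
  also have "\<dots> = f C'"
    using PP S R c(2) sg CC by (intro inv) (auto simp: sg_sym[of R C'] sg_sym[of C' C])
  finally show ?thesis .
qed

text \<open>The common pattern of the vanishing proofs: a linear relation reduces to a multiple of
  one value, namely the size of a class on which \<open>f\<close> is constant times that
  value.\<close>

lemma const_sum_zero:
  assumes "(\<Sum>x\<in>PP. f x) = (0::complex)" and "\<And>x. x \<in> PP \<Longrightarrow> x \<notin> K \<Longrightarrow> f x = 0"
    and "\<And>x y. x \<in> K \<Longrightarrow> y \<in> K \<Longrightarrow> x \<in> PP \<Longrightarrow> y \<in> PP \<Longrightarrow> f x = f y" and "x \<in> PP"
  shows "f x = 0"
proof (cases "x \<in> K")
  case True
  have "(\<Sum>x\<in>PP. f x) = (\<Sum>y\<in>PP \<inter> K. f y)"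
    by (rule sum.mono_neutral_right) (use assms(2) in auto)
  also have "\<dots> = (\<Sum>y\<in>PP \<inter> K. f x)" by (intro sum.cong refl assms(3)) (use True assms(4) in auto)
  finally have "of_nat (card (PP \<inter> K)) * f x = 0" using assms(1) by simp
  moreover have "PP \<inter> K \<noteq> {}" using True assms(4) by auto
  ultimately show ?thesis by simp
qed (use assms in auto)

text \<open>All Pauli operators other than \<open>I\<close> form one class, because any two of them
  are joined by a chain of at most two anticommuting exchanges.\<close>

lemma zero_of_exchange:
  assumes sum: "(\<Sum>V\<in>PP. f V) = (0::complex)" and one: "f I = 0"
    and exch: "\<And>V V'. V \<in> PP \<Longrightarrow> V' \<in> PP \<Longrightarrow> sg V V' = -1 \<Longrightarrow> f V = f V'" and V: "V \<in> PP"
  shows "f V = 0"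
proof (rule const_sum_zero[where K = "- {I}", OF sum _ _ V])
  show "f x = f y" if x: "x \<in> - {I}" "y \<in> - {I}" "x \<in> PP" "y \<in> PP" for x y
    by (rule move_indep[where A = I and B = I]) (use x indep_same[of I] exch in auto)
qed (use one in auto)

end

text \<open>The swap operator of two tensor factors is the average \<open>(1/d) \<Sum>V. V \<otimes> V\<close>, so \<open>swap\<close> says that the
  tensor representing the form is supported on the symmetric subspace.\<close>

locale invariant_form = pauli_basis +
  fixes F :: "complex mat \<Rightarrow> complex mat \<Rightarrow> complex mat \<Rightarrow> complex mat \<Rightarrow> complex"
  assumes lin: "\<lbrakk>A \<in> CM; B \<in> CM; C \<in> CM; E \<in> CM\<rbrakk> \<Longrightarrow> F A B C E = (1 / D) * (\<Sum>W\<in>PP. tr (W * A) * F W B C E)"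
    and sym12: "\<lbrakk>A \<in> CM; B \<in> CM; C \<in> CM; E \<in> CM\<rbrakk> \<Longrightarrow> F A B C E = F B A C E"
    and sym23: "\<lbrakk>A \<in> CM; B \<in> CM; C \<in> CM; E \<in> CM\<rbrakk> \<Longrightarrow> F A B C E = F A C B E"
    and sym34: "\<lbrakk>A \<in> CM; B \<in> CM; C \<in> CM; E \<in> CM\<rbrakk> \<Longrightarrow> F A B C E = F A B E C"
    and inv: "\<lbrakk>A \<in> CM; B \<in> CM; C \<in> CM; E \<in> CM; U \<in> gens\<rbrakk> \<Longrightarrow>
       F (U * (A * U)) (U * (B * U)) (U * (C * U)) (U * (E * U)) = F A B C E"
    and swap: "\<lbrakk>A \<in> CM; B \<in> CM; C \<in> CM; E \<in> CM\<rbrakk> \<Longrightarrow> D * F A B C E = (\<Sum>V\<in>PP. F (V * A) (V * B) C E)"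
    and F_one: "F I I I I = 0"
    and F_diag: "(\<Sum>V\<in>PP. F V V V V) = 0"
begin

section \<open>Homogeneity, symmetries and invariance of the form\<close>

lemma hom1 [simp]:
  assumes "A \<in> CM" "B \<in> CM" "C \<in> CM" "E \<in> CM"
  shows "F (c \<cdot>\<^sub>m A) B C E = c * F A B C E"
  using assms by (simp add: lin[of "c \<cdot>\<^sub>m A"] lin[of A] sum_distrib_left mult_ac)

lemma hom2 [simp]:
  assumes "A \<in> CM" "B \<in> CM" "C \<in> CM" "E \<in> CM"
  shows "F A (c \<cdot>\<^sub>m B) C E = c * F A B C E"
  using assms by (simp add: sym12[of A])

lemma hom3 [simp]:
  assumes "A \<in> CM" "B \<in> CM" "C \<in> CM" "E \<in> CM"
  shows "F A B (c \<cdot>\<^sub>m C) E = c * F A B C E"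
  using assms by (simp add: sym23[of A B])

lemma hom4 [simp]:
  assumes "A \<in> CM" "B \<in> CM" "C \<in> CM" "E \<in> CM"
  shows "F A B C (c \<cdot>\<^sub>m E) = c * F A B C E"
  using assms by (simp add: sym34[of A B C])

lemma sym_pairs:
  assumes "A \<in> CM" "B \<in> CM" "C \<in> CM" "E \<in> CM"
  shows "F A B C E = F C E A B"
proof -
  have "F A B C E = F A C B E" using assms by (intro sym23)
  also have "\<dots> = F C A B E" using assms by (intro sym12)
  also have "\<dots> = F C A E B" using assms by (intro sym34)
  also have "\<dots> = F C E A B" using assms by (intro sym23)
  finally show ?thesis .
qed

text \<open>Invariance under the Pauli operators leaves only these values; the sign ambiguities of a Clifford
  conjugation cancel in them.\<close>

definition Ef :: "complex mat \<Rightarrow> complex mat \<Rightarrow> complex mat \<Rightarrow> complex" where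
  "Ef A B C = F A B C (A * (B * C))"

lemma exchange_conj:
  assumes PP: "A \<in> PP" "B \<in> PP" "C \<in> PP" "C' \<in> PP"
    and sg: "sg C C' = -1" "sg A C = sg A C'" "sg B C = sg B C'"
  defines "H \<equiv> hada C C'"
  shows "H \<in> gens" "H * (A * H) = sg C A \<cdot>\<^sub>m A" "H * (B * H) = sg C B \<cdot>\<^sub>m B" "H * (C * H) = C'"
  using hada_conj_fix[OF PP(3,4) sg(1) PP(1)] hada_conj_fix[OF PP(3,4) sg(1) PP(2)] hada_conj_left[OF PP(3,4) sg(1)]
    hada_gens[OF PP(3,4) sg(1)] sg(2,3) unfolding H_def by (simp_all only: sg_sym[of A] sg_sym[of B])

text \<open>The signs picked up by \<open>A\<close> and \<open>B\<close> under the exchange of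
  \<open>C\<close> and \<open>C'\<close> occur a second time in the product that fills the fourth
  slot, and so they cancel.\<close>

lemma Ef_move:
  assumes PP: "A \<in> PP" "B \<in> PP" "C \<in> PP" "C' \<in> PP"
    and sg: "sg C C' = -1" "sg A C = sg A C'" "sg B C = sg B C'"
  shows "Ef A B C = Ef A B C'"
proof -
  let ?c = "\<lambda>A. hada C C' * (A * hada C C')"
  note U = exchange_conj(1)[OF assms] and A = exchange_conj(2)[OF assms] and B = exchange_conj(3)[OF assms]
    and C = exchange_conj(4)[OF assms]
  have ABC: "?c (A * (B * C)) = (sg C A * sg C B) \<cdot>\<^sub>m (A * (B * C'))"
    using gens_conj_mult3[OF U, of A B C] PP unfolding A B C by (simp add: smult_smult_mat mult_ac)
  have "Ef A B C = F (?c A) (?c B) (?c C) (?c (A * (B * C)))"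
    unfolding Ef_def using PP U by (subst inv) auto
  also have "\<dots> = Ef A B C'" unfolding ABC A B C Ef_def using PP by (simp add: mult_ac)
  finally show ?thesis .
qed

text \<open>The summand of the swap relation for \<open>F A B A B\<close>. Its four arguments
  multiply to a phase, so up to a scalar it is again a value of \<open>Ef\<close>.\<close>

definition h :: "complex mat \<Rightarrow> complex mat \<Rightarrow> complex mat \<Rightarrow> complex" where
  "h A B S = F (S * A) (S * B) A B"

lemma h_move:
  assumes PP: "A \<in> PP" "B \<in> PP" "C \<in> PP" "C' \<in> PP"
    and sg: "sg C C' = -1" "sg A C = sg A C'" "sg B C = sg B C'"
  shows "h A B C = h A B C'"
proof -
  let ?c = "\<lambda>A. hada C C' * (A * hada C C')"
  note U = exchange_conj(1)[OF assms] and A = exchange_conj(2)[OF assms] and B = exchange_conj(3)[OF assms]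
    and C = exchange_conj(4)[OF assms]
  have CA: "?c (C * A) = sg C A \<cdot>\<^sub>m (C' * A)" and CB: "?c (C * B) = sg C B \<cdot>\<^sub>m (C' * B)"
    using gens_conj_mult[OF U, of C A] gens_conj_mult[OF U, of C B] PP unfolding A B C by auto
  have "h A B C = F (?c (C * A)) (?c (C * B)) (?c A) (?c B)"
    unfolding h_def using PP U by (subst inv) auto
  also have "\<dots> = h A B C'" unfolding CA CB A B h_def using PP by (simp add: mult_ac)
  finally show ?thesis .
qed

lemma Ef_swap12: "A \<in> PP \<Longrightarrow> B \<in> PP \<Longrightarrow> C \<in> PP \<Longrightarrow> Ef B A C = sg A B * Ef A B C"
  unfolding Ef_def by (simp add: comm_sg_left[of B A] sym12[of B A] sg_sym)

lemma Ef_swap23: "A \<in> PP \<Longrightarrow> B \<in> PP \<Longrightarrow> C \<in> PP \<Longrightarrow> Ef A C B = sg B C * Ef A B C"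
  unfolding Ef_def by (simp add: comm_sg[of C B] sym23[of A C] sg_sym)

text \<open>Exchanging \<open>A\<close> and \<open>B\<close> by a gate fixes \<open>C\<close> up to
  sign and gives \<open>Ef A B C = Ef B A C\<close>. Symmetry of the form gives the same equation
  with a minus sign, because reordering the product in the fourth slot costs
  \<open>sg A B = -1\<close>.\<close>

lemma Ef_odd:
  assumes PP: "A \<in> PP" "B \<in> PP" "C \<in> PP" and sg: "sg A B = -1" "sg A C = sg B C"
  shows "Ef A B C = 0"
proof -
  let ?c = "\<lambda>X. hada A B * (X * hada A B)"
  have U: "hada A B \<in> gens" using PP sg by simp
  have A: "?c A = B" and B: "?c B = A" and C: "?c C = sg A C \<cdot>\<^sub>m C"
    using hada_conj_fix[OF PP(1,2) sg(1) PP(3) sg(2)] hada_conj_left[OF PP(1,2) sg(1)] hada_conj_right[OF PP(1,2) sg(1)]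
    by auto
  have ABC: "?c (A * (B * C)) = sg A C \<cdot>\<^sub>m (B * (A * C))"
    using gens_conj_mult3[OF U, of A B C] PP unfolding A B C by simp
  have "Ef A B C = F (?c A) (?c B) (?c C) (?c (A * (B * C)))"
    unfolding Ef_def using PP U by (subst inv) auto
  also have "\<dots> = Ef B A C" unfolding ABC A B C Ef_def using PP by (simp add: mult_ac)
  also have "\<dots> = - Ef A B C" using Ef_swap12[of A B C] PP sg by simp
  finally show ?thesis by simp
qed

lemma Ef_zero_swap12: "A \<in> PP \<Longrightarrow> B \<in> PP \<Longrightarrow> C \<in> PP \<Longrightarrow> Ef B A C = 0 \<longleftrightarrow> Ef A B C = 0"
  using Ef_swap12[of A B C] sg_cases[of A B] by auto

lemma Ef_zero_swap23: "A \<in> PP \<Longrightarrow> B \<in> PP \<Longrightarrow> C \<in> PP \<Longrightarrow> Ef A C B = 0 \<longleftrightarrow> Ef A B C = 0"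
  using Ef_swap23[of A B C] sg_cases[of B C] by auto

text \<open>If one or three of the three pairs anticommute, some anticommuting pair has equal signs
  against the remaining argument. A permutation of the arguments brings that pair to the
  front.\<close>

lemma Ef_odd':
  assumes PP: "A \<in> PP" "B \<in> PP" "C \<in> PP" and sg: "sg A B * sg A C * sg B C = -1"
  shows "Ef A B C = 0"
proof -
  consider "sg A B = -1" "sg A C = sg B C" | "sg A C = -1" "sg A B = sg C B" | "sg B C = -1" "sg B A = sg C A"
    using sg sg_cases[of A B] sg_cases[of A C] sg_cases[of B C] by (auto simp: sg_sym)
  thus ?thesis
  proof cases
    case 1 thus ?thesis using Ef_odd PP by blast
  next
    case 2 thus ?thesis using Ef_odd[of A C B] Ef_zero_swap23 PP by blast
  next
    case 3 thus ?thesis using Ef_odd[of B C A] Ef_zero_swap23[of B A C] Ef_zero_swap12[of A B C] PP by blast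
  qed
qed

text \<open>Passing from \<open>S * A\<close> to the Pauli operator \<open>R\<close> costs the
  square of a phase together with signs. The equivalence of vanishing is insensitive to all of
  them.\<close>

lemma h_zero_iff:
  assumes PP: "A \<in> PP" "B \<in> PP" "S \<in> PP" "R \<in> PP" and "S * A = c \<cdot>\<^sub>m R" "c \<noteq> 0"
  shows "h A B S = 0 \<longleftrightarrow> Ef A B R = 0"
proof -
  have R: "R = inverse c \<cdot>\<^sub>m (S * A)" unfolding assms(5) using \<open>c \<noteq> 0\<close> by (simp add: smult_smult_mat)
  have "A * (B * (S * A)) = (sg B S * sg A S * sg A B) \<cdot>\<^sub>m (S * B)"
    using PP by (simp add: comm_sg_left[of B S] comm_sg_left[of A S] conj_PP smult_smult_mat mult_ac)
  hence "A * (B * R) = (inverse c * (sg B S * sg A S * sg A B)) \<cdot>\<^sub>m (S * B)"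
    unfolding R using PP by (simp add: smult_smult_mat)
  hence "Ef A B R = F A B (inverse c \<cdot>\<^sub>m (S * A)) ((inverse c * (sg B S * sg A S * sg A B)) \<cdot>\<^sub>m (S * B))"
    unfolding Ef_def by (simp only: R)
  also have "\<dots> = inverse c * inverse c * (sg B S * sg A S * sg A B) * F A B (S * A) (S * B)"
    using PP by simp
  also have "F A B (S * A) (S * B) = h A B S" unfolding h_def using PP by (intro sym_pairs) auto
  finally show ?thesis using \<open>c \<noteq> 0\<close> sg_cases[of B S] sg_cases[of A S] sg_cases[of A B] by auto
qed

lemma h_zero_Ef:
  assumes PP: "A \<in> PP" "B \<in> PP" "S \<in> PP"
  obtains R where "R \<in> PP" "\<forall>V\<in>PP. sg V R = sg V S * sg V A" "h A B S = 0 \<longleftrightarrow> Ef A B R = 0"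
proof -
  obtain c R where c: "S * A = c \<cdot>\<^sub>m R" "R \<in> PP" "c ^ 4 = 1" by (rule mult_phase[OF PP(3,1)])
  have c0: "c \<noteq> 0" using c by auto
  show ?thesis using that[OF c(2) _ h_zero_iff[OF PP c(2,1) c0]] sg_mult[OF _ PP(3,1) c(2,1) c0] by blast
qed

text \<open>Every \<open>C\<close> is \<open>S * A\<close> up to phase, with \<open>S\<close>
  proportional to \<open>C * A\<close>, so the values of \<open>h A B\<close> on \<open>PP\<close>
  control all values \<open>Ef A B C\<close>.\<close>

lemma Ef_zero_of_h:
  assumes PP: "A \<in> PP" "B \<in> PP" "C \<in> PP" and h: "\<And>S. S \<in> PP \<Longrightarrow> h A B S = 0"
  shows "Ef A B C = 0"
proof -
  obtain c S where c: "C * A = c \<cdot>\<^sub>m S" "S \<in> PP" "c ^ 4 = 1" by (rule mult_phase[OF PP(3,1)])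
  have c0: "c \<noteq> 0" using c by auto
  have S: "S = inverse c \<cdot>\<^sub>m (C * A)" unfolding c(1) using c0 by (simp add: smult_smult_mat)
  have "S * A = inverse c \<cdot>\<^sub>m C" unfolding S using PP by simp
  thus ?thesis using h_zero_iff[of A B S C "inverse c"] h PP c c0 by simp
qed

section \<open>Vanishing on repeated or trivial arguments\<close>

lemma F_11VV:
  assumes "V \<in> PP" shows "F I I V V = 0"
proof -
  \<comment> \<open>The swap relation at four identities, whose left side is the normalisation
    \<open>F_one\<close>.\<close>
  have "(\<Sum>W\<in>PP. F W W I I) = 0" using swap[of I I I I] F_one by simp
  hence sum: "(\<Sum>W\<in>PP. Ef I I W) = 0" unfolding Ef_def by (simp add: sym_pairs[of _ _ I I])
  have "Ef I I V = 0"
  proof (rule zero_of_exchange[where f = "Ef I I", OF sum _ _ assms])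
    show "Ef I I I = 0" by (simp add: Ef_def F_one)
  qed (auto intro: Ef_move)
  thus ?thesis using assms by (simp add: Ef_def)
qed

lemma F_VVVV:
  assumes "V \<in> PP" shows "F V V V V = 0"
proof (rule zero_of_exchange[OF F_diag F_one _ assms])
  show "F C C C C = F C' C' C' C'" if C: "C \<in> PP" "C' \<in> PP" "sg C C' = -1" for C C'
    using inv[of C C C C "hada C C'"] C by (simp add: hada_conj_left)
qed

lemma unit_fourth_root: "c ^ 4 = 1 \<Longrightarrow> c * cnj c = (1::complex)"
proof -
  assume "c ^ 4 = 1"
  hence "cmod c ^ 4 = 1" by (metis norm_one norm_power)
  hence "cmod c = 1" using power_eq_imp_eq_base[of "cmod c" 4 1] by simp
  thus ?thesis by (simp add: complex_norm_square[symmetric])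
qed

text \<open>The swap relation at \<open>F V V V V = 0\<close> sums \<open>F (W V) (W V) V V\<close>.
  Replacing the Pauli operator \<open>W V\<close> by \<open>W\<close> produces the sign, because
  \<open>W V\<close> squares to \<open>sg W V\<close> times the identity.\<close>

lemma sum_sg_WWVV:
  assumes V: "V \<in> PP" shows "(\<Sum>W\<in>PP. sg W V * F W W V V) = 0"
proof -
  \<comment> \<open>The adjoint in the second slot and the trace make \<open>g\<close> invariant
    under phases of \<open>X\<close>, as reindexing requires. The trace encodes the sign: on a Pauli
    operator it equals \<open>sg W V * D\<close>, and on \<open>W V\<close> it cancels the sign from
    reordering \<open>V W\<close>.\<close>
  define g where "g X = F X (mat_adjoint X) V V * (tr (X * (V * (mat_adjoint X * V))) / D)" for X
  have g: "g (c \<cdot>\<^sub>m W) = g W" if "c ^ 4 = 1" "W \<in> PP" for c W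
  proof -
    have "g (c \<cdot>\<^sub>m W) = (c * cnj c) * (c * cnj c) * g W"
      using that V by (simp add: g_def mat_adjoint_smult)
    thus ?thesis using unit_fourth_root[OF that(1)] by simp
  qed
  have gW: "g W = sg W V * F W W V V" if "W \<in> PP" for W
  proof -
    have "W * (V * (W * V)) = sg V W \<cdot>\<^sub>m I" using that V by (simp add: conj_PP)
    thus ?thesis using that V by (simp add: g_def PP_herm mtrace_one sg_sym)
  qed
  have gWV: "g (W * V) = F (W * V) (W * V) V V" if W: "W \<in> PP" for W
  proof -
    have adj: "mat_adjoint (W * V) = V * W" using W V by (simp add: mat_adjoint_mult[of _ d] PP_herm)
    have 1: "(W * V) * (V * ((V * W) * V)) = sg V W \<cdot>\<^sub>m I" using W V by (simp add: conj_PP)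
    have 2: "V * W = sg V W \<cdot>\<^sub>m (W * V)" using comm_sg W V by blast
    have "g (W * V) = F (W * V) (V * W) V V * sg V W"
      unfolding g_def adj 1 by (simp add: mtrace_one)
    also have "\<dots> = F (W * V) (sg V W \<cdot>\<^sub>m (W * V)) V V * sg V W" by (simp only: 2[symmetric])
    also have "\<dots> = F (W * V) (W * V) V V" using W V by (simp add: mult_ac)
    finally show ?thesis .
  qed
  have "(\<Sum>W\<in>PP. sg W V * F W W V V) = (\<Sum>W\<in>PP. g W)" using gW by simp
  also have "\<dots> = (\<Sum>W\<in>PP. g (W * V))" using sum_PP_mult_right[of V g] V g by simp
  also have "\<dots> = D * F V V V V" using gWV swap[of V V V V] V by simp
  finally show ?thesis using V by (simp add: F_VVVV)
qed

text \<open>The plain and the signed sum over \<open>W\<close> vanish, hence so do the sums over the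
  \<open>W\<close> commuting with \<open>V\<close> and over those anticommuting with it. On each of
  these classes, with \<open>I\<close> and \<open>V\<close> removed, the value is constant.\<close>

lemma F_VVWW:
  assumes V: "V \<in> PP" "W \<in> PP" shows "F V V W W = 0"
proof -
  define e where "e W = Ef V V W" for W
  have e: "e W = F W W V V" if "W \<in> PP" for W
    using that V sym_pairs[of V V W W] by (simp add: e_def Ef_def)
  have s1: "(\<Sum>W\<in>PP. e W) = 0"
    using swap[of I I V V] V by (simp add: e F_11VV)
  have s2: "(\<Sum>W\<in>PP. sg V W * e W) = 0"
    using sum_sg_WWVV[OF V(1)] by (simp add: e sg_sym[of V])
  \<comment> \<open>The factor is twice the indicator of the class of \<open>W\<close> with
    \<open>sg V W = \<epsilon>\<close>.\<close>
  have half: "(1 + \<epsilon> * sg V W) * e W = 0" if \<epsilon>: "\<epsilon> = 1 \<or> \<epsilon> = -1" for \<epsilon>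
  proof (rule const_sum_zero[where f = "\<lambda>W. (1 + \<epsilon> * sg V W) * e W" and K = "{W. sg V W = \<epsilon> \<and> W \<noteq> I \<and> W \<noteq> V}"])
    show "(\<Sum>W\<in>PP. (1 + \<epsilon> * sg V W) * e W) = 0"
      using s1 s2 by (simp add: distrib_right sum.distrib mult.assoc flip: sum_distrib_left)
    show "(1 + \<epsilon> * sg V x) * e x = 0" if x: "x \<in> PP" "x \<notin> {W. sg V W = \<epsilon> \<and> W \<noteq> I \<and> W \<noteq> V}" for x
    proof -
      consider "sg V x = - \<epsilon>" | "x = I" | "x = V" using x \<epsilon> sg_cases[of V x] by fastforce
      thus ?thesis by cases (use V \<epsilon> in \<open>auto simp: e F_11VV F_VVVV\<close>)
    qed
    show "(1 + \<epsilon> * sg V x) * e x = (1 + \<epsilon> * sg V y) * e y"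
      if x: "x \<in> {W. sg V W = \<epsilon> \<and> W \<noteq> I \<and> W \<noteq> V}" "y \<in> {W. sg V W = \<epsilon> \<and> W \<noteq> I \<and> W \<noteq> V}" "x \<in> PP" "y \<in> PP" for x y
    proof -
      have "e x = e y" unfolding e_def
        by (rule move_indep[where A = V and B = V]) (use x V indep_same Ef_move in auto)
      thus ?thesis using x by simp
    qed
  qed (fact V)
  have "e W = 0" using half[of 1] half[of "-1"] sg_cases[of V W] by auto
  thus ?thesis using V by (simp add: e_def Ef_def)
qed

lemma PP_eq_of_smult:
  assumes "A \<in> PP" "B \<in> PP" "A = c \<cdot>\<^sub>m B" shows "A = B"
proof -
  have "D = tr (A * A)" using assms(1) by (simp add: mtrace_one)
  also have "\<dots> = c * tr (B * A)" by (subst (1) assms(3)) (use assms(1,2) in simp)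
  finally have "tr (B * A) \<noteq> 0" by (metis D_nonzero(1) mult_zero_right)
  thus ?thesis using PP_orth[of B A] assms(1,2) by metis
qed

text \<open>In the swap relation at \<open>F I V I V = 0\<close> the anticommuting terms are zero by
  the parity argument. The commuting operators other than \<open>I\<close> and \<open>V\<close> are
  independent of \<open>I\<close>, \<open>V\<close> and form a single class.\<close>

lemma Ef_1VW:
  assumes V: "V \<in> PP" "W \<in> PP" shows "Ef I V W = 0"
proof -
  have anti: "Ef I V S = 0" if "S \<in> PP" "sg V S = -1" for S
    using Ef_odd'[of I V S] V that by simp
  have s: "(\<Sum>S\<in>PP. sg V S * Ef I V S) = 0"
  proof -
    have "sg V S * Ef I V S = F (S * I) (S * V) I V" if S: "S \<in> PP" for S
    proof -
      have "F (S * I) (S * V) I V = F I V S (S * V)" using S V sym_pairs[of S "S * V" I V] by simp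
      also have "\<dots> = F I V S (sg V S \<cdot>\<^sub>m (V * S))" using comm_sg[of S V] S V by (simp add: sg_sym)
      finally show ?thesis using S V by (simp add: Ef_def)
    qed
    hence "(\<Sum>S\<in>PP. sg V S * Ef I V S) = D * F I V I V" using swap[of I V I V] V by simp
    also have "F I V I V = F I I V V" using V by (intro sym23) auto
    finally show ?thesis using V by (simp add: F_11VV)
  qed
  let ?K = "{W. sg V W = 1 \<and> W \<noteq> I \<and> W \<noteq> V}"
  have "sg V W * Ef I V W = 0"
  proof (rule const_sum_zero[where f = "\<lambda>W. sg V W * Ef I V W" and K = ?K, OF s])
    show "sg V x * Ef I V x = 0" if x: "x \<in> PP" "x \<notin> ?K" for x
    proof -
      consider "sg V x = -1" | "x = I" | "x = V" using x sg_cases[of V x] by blast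
      thus ?thesis
      proof cases
        case 1 thus ?thesis using anti x by simp
      next
        case 2
        have "F I V I V = F I I V V" using V by (intro sym23) auto
        thus ?thesis using 2 V by (simp add: Ef_def F_11VV)
      next
        case 3
        have "F I V V I = F I I V V" using V sym34[of I V V I] sym23[of I V I V] by auto
        thus ?thesis using 3 V by (simp add: Ef_def F_11VV)
      qed
    qed
    have ind: "indep I V x" if "x \<in> PP" "x \<in> ?K" for x
    proof (rule ccontr)
      assume "\<not> indep I V x"
      thus False
      proof (rule not_indep_cases[OF one_PP V(1) that(1)])
        fix c assume "I * V = c \<cdot>\<^sub>m x"
        hence "V = x" using PP_eq_of_smult[of V x c] that V by simp
        thus False using that by simp
      qed (use that in auto)
    qed
    show "sg V x * Ef I V x = sg V y * Ef I V y" if x: "x \<in> ?K" "y \<in> ?K" "x \<in> PP" "y \<in> PP" for x y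
    proof -
      have "Ef I V x = Ef I V y"
        by (rule move_indep[where A = I and B = V]) (use x V ind Ef_move in auto)
      thus ?thesis using x by simp
    qed
  qed (fact V)
  thus ?thesis using sg_cases[of V W] by auto
qed

section \<open>Vanishing on independent arguments\<close>

lemma h_smult: "A \<in> CM \<Longrightarrow> B \<in> CM \<Longrightarrow> S \<in> CM \<Longrightarrow> h A B (c \<cdot>\<^sub>m S) = c * c * h A B S"
  by (simp add: h_def)

text \<open>For \<open>S\<close> equal to \<open>I\<close> or proportional to \<open>A * B\<close>
  the form has arguments in equal pairs; for \<open>S\<close> equal to \<open>A\<close> or
  \<open>B\<close> one argument is the identity. Both patterns are already settled.\<close>

lemma h_dep:
  assumes PP: "A \<in> PP" "B \<in> PP" "S \<in> PP" and "\<not> indep A B S"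
  shows "h A B S = 0"
  using assms(4)
proof (rule not_indep_cases[OF PP])
  have 0: "F A B A B = 0" "F B A A B = 0"
    using PP F_VVWW[of A B] sym23[of A A B B] sym12[of B A A B] by auto
  have 1: "F I (A * B) A B = 0"
    using PP Ef_1VW[of A B] sym_pairs[of I "A * B" A B] sym23[of A I B "A * B"] sym12[of A B I "A * B"]
      sym12[of A I B "A * B"] sym_pairs[of A B I "A * B"]  by (simp add: Ef_def)
  show "h A B S = 0" if "S = I" using that 0 PP by (simp add: h_def)
  show "h A B S = 0" if "S = A" using that 1 PP by (simp add: h_def)
  show "h A B S = 0" if "S = B"
    using that 1 PP sym12[of "A * B" I A B] by (simp add: h_def comm_sg[of B A])
  fix c assume c: "c \<noteq> 0" "A * B = c \<cdot>\<^sub>m S"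
  have "c * c * h A B S = h A B (A * B)" unfolding c(2) using PP by (simp add: h_smult)
  also have "\<dots> = F (A * (B * A)) (A * (B * B)) A B" using PP by (simp add: h_def)
  also have "\<dots> = 0" using PP 0 by (simp add: conj_PP)
  finally show "h A B S = 0" using c by simp
qed

lemma sum_h: "A \<in> PP \<Longrightarrow> B \<in> PP \<Longrightarrow> (\<Sum>S\<in>PP. h A B S) = 0"
  using swap[of A B A B] F_VVWW[of A B] sym23[of A B A B] by (simp add: h_def)

text \<open>\<open>T\<close> is proportional to \<open>S * A * B\<close>. Substituting this product
  swaps the first two arguments of \<open>h A B S\<close> at the cost of a minus sign, since
  \<open>A B A = - B\<close>. The product squares to \<open>- I\<close>, so the squared phase in the
  homogeneity of \<open>h\<close> is a second minus sign. The shift therefore connects the two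
  classes of \<open>S\<close> that commute with both or anticommute with both.\<close>

lemma h_shift:
  assumes PP: "A \<in> PP" "B \<in> PP" "S \<in> PP" and sg: "sg A B = -1" "sg A S = sg B S" and ind: "indep A B S"
  obtains T where "T \<in> PP" "sg A T = - sg A S" "sg B T = - sg B S" "indep A B T" "h A B T = h A B S"
proof -
  obtain c R where c: "A * B = c \<cdot>\<^sub>m R" "R \<in> PP" "c ^ 4 = 1" by (rule mult_phase[OF PP(1,2)])
  obtain e T where e: "S * R = e \<cdot>\<^sub>m T" "T \<in> PP" "e ^ 4 = 1" by (rule mult_phase[OF PP(3) c(2)])
  have c0: "c \<noteq> 0" "e \<noteq> 0" using c e by auto
  have sR: "sg V R = sg V A * sg V B" if "V \<in> PP" for V by (rule sg_mult[OF that PP(1,2) c(2,1) c0(1)])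
  have sT: "sg V T = sg V S * sg V A * sg V B" if "V \<in> PP" for V
    using sg_mult[OF that PP(3) c(2) e(2,1) c0(2)] sR[OF that] by simp
  have kT: "S * (A * B) = (c * e) \<cdot>\<^sub>m T" unfolding c(1) using PP c e by (simp add: smult_smult_mat)
  have "(S * (A * B)) * (S * (A * B)) = S * (A * (B * (S * (A * B))))" using PP by simp
  also have "\<dots> = sg B S * sg A S * sg B A \<cdot>\<^sub>m I"
    using PP by (simp add: comm_sg_left[of B S] comm_sg_left[of A S] conj_PP comm_sg_left[of B A] smult_smult_mat mult_ac)
  also have "sg B S * sg A S * sg B A = -1" using sg by (simp add: sg_sym[of B A])
  finally have "(c * e) * (c * e) \<cdot>\<^sub>m I = (-1) \<cdot>\<^sub>m I" unfolding kT using e by (simp add: smult_smult_mat)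
  hence k: "(c * e) * (c * e) = -1" using smult_eq_imp_eq one_PP by blast
  have "- h A B T = h A B (S * (A * B))" unfolding kT using PP e k by (simp add: h_smult)
  also have "\<dots> = F (S * (A * (B * A))) (S * (A * (B * B))) A B" using PP by (simp add: h_def)
  also have "\<dots> = - F (S * B) (S * A) A B" using PP sg by (simp add: conj_PP)
  also have "F (S * B) (S * A) A B = h A B S" unfolding h_def using PP by (intro sym12) auto
  finally have "h A B T = h A B S" by simp
  moreover have "indep A B T"
  proof -
    obtain Q where Q: "Q \<in> PP" "sg A Q = 1" "sg B Q = 1" "sg S Q = -1" using ind by (auto simp: indep_def)
    hence "sg T Q = -1" using sT[OF Q(1)] by (simp add: sg_sym[of Q])
    thus ?thesis using Q by (auto simp: indep_def)
  qed
  moreover have "sg A T = - sg A S" "sg B T = - sg B S" using sT PP sg by (auto simp: sg_sym[of B A])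
  ultimately show ?thesis using that e by blast
qed

text \<open>Of the independent \<open>S\<close>, those with opposite signs against \<open>A\<close>
  and \<open>B\<close> lead to an odd pattern and contribute zero. The others split into two classes
  by their common sign; \<open>h_shift\<close> identifies their values, so the swap relation forces
  that value to be zero.\<close>

lemma Ef_anti:
  assumes PP: "A \<in> PP" "B \<in> PP" "C \<in> PP" and sg: "sg A B = -1"
  shows "Ef A B C = 0"
proof (rule Ef_zero_of_h[OF PP])
  fix S assume S: "S \<in> PP"
  let ?K = "{S. indep A B S \<and> sg A S = sg B S}"
  show "h A B S = 0"
  proof (rule const_sum_zero[where f = "h A B" and K = ?K, OF sum_h[OF PP(1,2)]])
    show "h A B x = 0" if x: "x \<in> PP" "x \<notin> ?K" for x
    proof (cases "indep A B x")
      case False thus ?thesis using h_dep PP x by blast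
    next
      case True
      hence ne: "sg A x * sg B x = -1" using x sg_cases[of A x] sg_cases[of B x] by auto
      obtain R where R: "R \<in> PP" "\<forall>V\<in>PP. sg V R = sg V x * sg V A" "h A B x = 0 \<longleftrightarrow> Ef A B R = 0"
        by (rule h_zero_Ef[OF PP(1,2) x(1)])
      hence "sg A B * sg A R * sg B R = -1" using PP sg ne by (simp add: sg_sym[of B A])
      hence "Ef A B R = 0" using Ef_odd' PP R(1) by blast
      thus ?thesis using R(3) by simp
    qed
    show "h A B x = h A B y" if x: "x \<in> ?K" "y \<in> ?K" "x \<in> PP" "y \<in> PP" for x y
    proof (cases "sg A x = sg A y")
      case True
      show ?thesis by (rule move_indep[where A = A and B = B]) (use x PP True h_move in auto)
    next
      case False
      hence n: "sg A x = - sg A y" using sg_cases[of A x] sg_cases[of A y] by auto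
      obtain T where T: "T \<in> PP" "sg A T = - sg A y" "sg B T = - sg B y" "indep A B T" "h A B T = h A B y"
        using h_shift[OF PP(1,2) x(4) sg] x by auto
      have "h A B x = h A B T"
        by (rule move_indep[where A = A and B = B]) (use x PP T n h_move in auto)
      thus ?thesis using T by simp
    qed
  qed (fact S)
qed

text \<open>With \<open>A\<close> and \<open>B\<close> commuting, an \<open>S\<close> anticommuting
  with either leads to a triple containing an anticommuting pair, which is already settled. The
  independent \<open>S\<close> commuting with both form one class, on which the swap relation
  decides.\<close>

lemma Ef_zero:
  assumes PP: "A \<in> PP" "B \<in> PP" "C \<in> PP"
  shows "Ef A B C = 0"
proof (cases "sg A B = -1")
  case True thus ?thesis using Ef_anti PP by blast
next
  case False
  hence sg: "sg A B = 1" using sg_cases by blast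
  show ?thesis
  proof (rule Ef_zero_of_h[OF PP])
    fix S assume S: "S \<in> PP"
    let ?K = "{S. indep A B S \<and> sg A S = 1 \<and> sg B S = 1}"
    show "h A B S = 0"
    proof (rule const_sum_zero[where f = "h A B" and K = ?K, OF sum_h[OF PP(1,2)]])
      show "h A B x = 0" if x: "x \<in> PP" "x \<notin> ?K" for x
      proof (cases "indep A B x")
        case False thus ?thesis using h_dep PP x by blast
      next
        case True
        hence ne: "sg A x = -1 \<or> sg B x = -1" using x sg_cases[of A x] sg_cases[of B x] by auto
        obtain R where R: "R \<in> PP" "\<forall>V\<in>PP. sg V R = sg V x * sg V A" "h A B x = 0 \<longleftrightarrow> Ef A B R = 0"
          by (rule h_zero_Ef[OF PP(1,2) x(1)])
        hence "sg A R = -1 \<or> sg B R = -1" using PP sg ne by (auto simp: sg_sym[of B A])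
        hence "Ef A B R = 0"
        proof
          assume "sg A R = -1" thus ?thesis using Ef_anti[of A R B] Ef_zero_swap23[of A B R] PP R(1) by auto
        next
          assume "sg B R = -1"
          thus ?thesis using Ef_anti[of B R A] Ef_zero_swap23[of B A R] Ef_zero_swap12[of A B R] PP R(1) by auto
        qed
        thus ?thesis using R(3) by simp
      qed
      show "h A B x = h A B y" if x: "x \<in> ?K" "y \<in> ?K" "x \<in> PP" "y \<in> PP" for x y
        by (rule move_indep[where A = A and B = B]) (use x PP h_move in auto)
    qed (fact S)
  qed
qed

text \<open>If some Pauli operator sees an odd total sign, conjugation by it negates the value.
  Otherwise \<open>A * B * C\<close> and \<open>E\<close> have the same character, so they are
  proportional and the value is a multiple of \<open>Ef A B C\<close>.\<close>

lemma F_zero_PP: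
  assumes PP: "A \<in> PP" "B \<in> PP" "C \<in> PP" "E \<in> PP"
  shows "F A B C E = 0"
proof (cases "\<exists>V\<in>PP. sg V A * sg V B * sg V C * sg V E = -1")
  case True
  then obtain V where V: "V \<in> PP" "sg V A * sg V B * sg V C * sg V E = -1" by blast
  have "F A B C E = F (V * (A * V)) (V * (B * V)) (V * (C * V)) (V * (E * V))"
    using PP V by (subst inv) auto
  also have "\<dots> = (sg V A * sg V B * sg V C * sg V E) * F A B C E" using PP V(1) by (simp add: conj_PP mult_ac)
  finally show ?thesis unfolding V(2) by simp
next
  case False
  obtain c Q where c: "B * C = c \<cdot>\<^sub>m Q" "Q \<in> PP" "c ^ 4 = 1" by (rule mult_phase[OF PP(2,3)])
  obtain e R where e: "A * Q = e \<cdot>\<^sub>m R" "R \<in> PP" "e ^ 4 = 1" by (rule mult_phase[OF PP(1) c(2)])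
  have c0: "c \<noteq> 0" "e \<noteq> 0" using c e by auto
  have sR: "sg V R = sg V A * sg V B * sg V C" if "V \<in> PP" for V
    using sg_mult[OF that PP(2,3) c(2,1) c0(1)] sg_mult[OF that PP(1) c(2) e(2,1) c0(2)] by simp
  have "sg R V * sg E V = 1" if "V \<in> PP" for V
  proof -
    have "sg V A * sg V B * sg V C * sg V E \<noteq> -1" using False that by blast
    thus ?thesis unfolding sg_sym[of R V] sg_sym[of E V] sR[OF that]
      using sg_cases[of V A] sg_cases[of V B] sg_cases[of V C] sg_cases[of V E] by auto
  qed
  hence "(\<Sum>V\<in>PP. sg R V * sg E V) = D\<^sup>2" by (simp add: card_PP)
  hence "R = E" using sum_sg_sg[OF e(2) PP(4)] by (simp split: if_splits)
  hence "A * (B * C) = (c * e) \<cdot>\<^sub>m E" unfolding c(1) using PP c e by (simp add: smult_smult_mat)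
  hence "Ef A B C = (c * e) * F A B C E" unfolding Ef_def using PP by simp
  thus ?thesis using Ef_zero PP c0 by simp
qed

lemma F_zero:
  assumes "A \<in> CM" "B \<in> CM" "C \<in> CM" "E \<in> CM"
  shows "F A B C E = 0"
proof -
  have 1: "F A B C E = 0" if "A \<in> CM" "B \<in> PP" "C \<in> PP" "E \<in> PP" for A B C E
    using that by (subst lin) (auto simp: F_zero_PP)
  have 2: "F A B C E = 0" if "A \<in> CM" "B \<in> CM" "C \<in> PP" "E \<in> PP" for A B C E
  proof -
    have "F W B C E = 0" if "W \<in> PP" for W
      using 1[of B W C E] sym12[of W B C E] that \<open>B \<in> CM\<close> \<open>C \<in> PP\<close> \<open>E \<in> PP\<close> by simp
    thus ?thesis using that by (subst lin) auto
  qed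
  have 3: "F A B C E = 0" if "A \<in> CM" "B \<in> CM" "C \<in> CM" "E \<in> PP" for A B C E
  proof -
    have "F W B C E = 0" if "W \<in> PP" for W
      using 2[of B C W E] sym12[of W B C E] sym23[of B W C E] that \<open>B \<in> CM\<close> \<open>C \<in> CM\<close> \<open>E \<in> PP\<close> by simp
    thus ?thesis using that by (subst lin) auto
  qed
  have "F W B C E = 0" if "W \<in> PP" for W
    using 3[of B C E W] sym12[of W B C E] sym23[of B W C E] sym34[of B C W E] that assms by simp
  thus ?thesis using assms by (subst lin) auto
qed

end

section \<open>Moments of a pure orbit\<close>

context pauli_basis begin

text \<open>Linearity, phrased as compatibility with the expansion in the Pauli basis.\<close>

definition lin_PP :: "(complex mat \<Rightarrow> complex) \<Rightarrow> bool" where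
  "lin_PP f \<longleftrightarrow> (\<forall>A\<in>CM. f A = (1 / D) * (\<Sum>W\<in>PP. tr (W * A) * f W))"

lemma lin_PP_trace_mult [intro]: "Y \<in> CM \<Longrightarrow> lin_PP (\<lambda>A. tr (A * Y))"
  unfolding lin_PP_def by (simp add: sum_trace_trace)

lemma lin_PPD: "lin_PP f \<Longrightarrow> A \<in> CM \<Longrightarrow> f A = (1 / D) * (\<Sum>W\<in>PP. tr (W * A) * f W)"
  unfolding lin_PP_def by blast

lemma lin_PPI: "(\<And>A. A \<in> CM \<Longrightarrow> f A = (1 / D) * (\<Sum>W\<in>PP. tr (W * A) * f W)) \<Longrightarrow> lin_PP f"
  unfolding lin_PP_def by blast

lemma lin_PP_trace [intro]: "lin_PP tr"
proof (rule lin_PPI)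
  fix A assume A: "A \<in> CM"
  show "tr A = (1 / D) * (\<Sum>W\<in>PP. tr (W * A) * tr W)"
    using sum_trace_trace[OF A one_carrier_mat[of d]] A by simp
qed

lemma lin_PP_sum:
  assumes "\<And>i. i \<in> S \<Longrightarrow> lin_PP (f i)" shows "lin_PP (\<lambda>A. \<Sum>i\<in>S. f i A)"
proof (rule lin_PPI)
  fix A assume A: "A \<in> CM"
  have "(\<Sum>i\<in>S. f i A) = (\<Sum>i\<in>S. (1 / D) * (\<Sum>W\<in>PP. tr (W * A) * f i W))"
    by (intro sum.cong refl lin_PPD assms A)
  also have "\<dots> = (1 / D) * (\<Sum>i\<in>S. \<Sum>W\<in>PP. tr (W * A) * f i W)" by (simp add: sum_distrib_left)
  also have "(\<Sum>i\<in>S. \<Sum>W\<in>PP. tr (W * A) * f i W) = (\<Sum>W\<in>PP. tr (W * A) * (\<Sum>i\<in>S. f i W))"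
    by (subst sum.swap) (simp add: sum_distrib_left)
  finally show "(\<Sum>i\<in>S. f i A) = (1 / D) * (\<Sum>W\<in>PP. tr (W * A) * (\<Sum>i\<in>S. f i W))" .
qed

lemma lin_PP_add [intro]:
  assumes "lin_PP f" "lin_PP g" shows "lin_PP (\<lambda>A. f A + g A)"
proof (rule lin_PPI)
  fix A assume A: "A \<in> CM"
  show "f A + g A = (1 / D) * (\<Sum>W\<in>PP. tr (W * A) * (f W + g W))"
    unfolding lin_PPD[OF assms(1) A] lin_PPD[OF assms(2) A] by (simp add: distrib_left sum.distrib add_divide_distrib)
qed

lemma lin_PP_mult_left [intro]:
  assumes "lin_PP f" shows "lin_PP (\<lambda>A. k * f A)"
proof (rule lin_PPI)
  fix A assume A: "A \<in> CM"
  show "k * f A = (1 / D) * (\<Sum>W\<in>PP. tr (W * A) * (k * f W))"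
    unfolding lin_PPD[OF assms A] by (simp add: sum_distrib_left mult_ac)
qed

lemma lin_PP_mult_right [intro]: "lin_PP f \<Longrightarrow> lin_PP (\<lambda>A. f A * k)"
  using lin_PP_mult_left[of f k] by (simp add: mult.commute)

lemma lin_PP_diff [intro]: "lin_PP f \<Longrightarrow> lin_PP g \<Longrightarrow> lin_PP (\<lambda>A. f A - g A)"
  using lin_PP_add[OF _ lin_PP_mult_left[of g "-1"], of f] by simp

lemma lin_PP_smult:
  assumes "lin_PP f" and A: "A \<in> CM" shows "f (c \<cdot>\<^sub>m A) = c * f A"
proof -
  have cA: "c \<cdot>\<^sub>m A \<in> CM" using A by simp
  show ?thesis unfolding lin_PPD[OF assms(1) cA] lin_PPD[OF assms] using A by (simp add: sum_distrib_left mult_ac)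
qed

lemma lin_PP_comp:
  assumes g: "lin_PP g" and Z: "Z \<in> CM" shows "lin_PP (\<lambda>A. g (Z * A))"
proof (rule lin_PPI)
  fix A assume A: "A \<in> CM"
  have in1: "(\<Sum>V\<in>PP. tr (V * A) * tr (W * (Z * V))) = D * tr (W * (Z * A))" if W: "W \<in> PP" for W
  proof -
    have "tr (W * (Z * V)) = tr (V * (W * Z))" if "V \<in> PP" for V
      using mtrace_comm[of "W * Z" d V] that W Z by simp
    hence "(\<Sum>V\<in>PP. tr (V * A) * tr (W * (Z * V))) = (\<Sum>V\<in>PP. tr (V * A) * tr (V * (W * Z)))" by simp
    also have "\<dots> = D * tr (A * (W * Z))" using A W Z by (intro sum_trace_trace) auto
    also have "tr (A * (W * Z)) = tr (W * (Z * A))" using mtrace_comm[of A d "W * Z"] A W Z by simp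
    finally show ?thesis .
  qed
  have "(\<Sum>V\<in>PP. tr (V * A) * g (Z * V)) = (\<Sum>V\<in>PP. \<Sum>W\<in>PP. (1 / D) * g W * (tr (V * A) * tr (W * (Z * V))))"
    using Z by (intro sum.cong refl) (subst lin_PPD[OF g], simp_all add: sum_distrib_left mult_ac)
  also have "\<dots> = (\<Sum>W\<in>PP. (1 / D) * g W * (\<Sum>V\<in>PP. tr (V * A) * tr (W * (Z * V))))"
    by (subst sum.swap) (simp add: sum_distrib_left)
  also have "\<dots> = (\<Sum>W\<in>PP. tr (W * (Z * A)) * g W)" by (intro sum.cong refl) (simp add: in1)
  finally show "g (Z * A) = (1 / D) * (\<Sum>V\<in>PP. tr (V * A) * g (Z * V))"
    using lin_PPD[OF g, of "Z * A"] A Z by simp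
qed

text \<open>One product of traces for each of the 24 permutations of four tensor factors, so this is \<open>24 tr (P\<^sub>s\<^sub>y\<^sub>m (A \<otimes> B \<otimes> C \<otimes> E))\<close>.\<close>

definition perm_form :: "complex mat \<Rightarrow> complex mat \<Rightarrow> complex mat \<Rightarrow> complex mat \<Rightarrow> complex" where
  "perm_form A B C E =
     tr A * tr B * tr C * tr E
   + tr (A * B) * tr C * tr E + tr (A * C) * tr B * tr E + tr (A * E) * tr B * tr C
   + tr (B * C) * tr A * tr E + tr (B * E) * tr A * tr C + tr (C * E) * tr A * tr B
   + tr (A * B) * tr (C * E) + tr (A * C) * tr (B * E) + tr (A * E) * tr (B * C)
   + tr (A * (B * C)) * tr E + tr (A * (C * B)) * tr E
   + tr (A * (B * E)) * tr C + tr (A * (E * B)) * tr C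
   + tr (A * (C * E)) * tr B + tr (A * (E * C)) * tr B
   + tr (B * (C * E)) * tr A + tr (B * (E * C)) * tr A
   + tr (A * (B * (C * E))) + tr (A * (B * (E * C))) + tr (A * (C * (B * E)))
   + tr (A * (C * (E * B))) + tr (A * (E * (B * C))) + tr (A * (E * (C * B)))"

lemma perm_form_lin: "B \<in> CM \<Longrightarrow> C \<in> CM \<Longrightarrow> E \<in> CM \<Longrightarrow> lin_PP (\<lambda>A. perm_form A B C E)"
  unfolding perm_form_def by (intro lin_PP_add lin_PP_mult_right lin_PP_mult_left lin_PP_trace_mult lin_PP_trace mult_CM)

lemma perm_form_sym12:
  assumes "A \<in> CM" "B \<in> CM" "C \<in> CM" "E \<in> CM"
  shows "perm_form A B C E = perm_form B A C E"
  unfolding perm_form_def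
  using mtrace_comm[of B d A] mtrace_comm[of B d "A * C"] mtrace_comm[of B d "C * A"] mtrace_comm[of B d "A * E"]
    mtrace_comm[of B d "E * A"] mtrace_comm[of B d "A * (C * E)"] mtrace_comm[of B d "A * (E * C)"]
    mtrace_comm[of "B * C" d "A * E"] mtrace_comm[of B d "C * (E * A)"] mtrace_comm[of "B * E" d "A * C"]
    mtrace_comm[of B d "E * (C * A)"] mtrace_comm[of "B * C" d A] mtrace_comm[of "B * E" d A]
    mtrace_comm[of "B * (C * E)" d A] mtrace_comm[of "B * (E * C)" d A] assms
  by (simp add: algebra_simps)

lemma perm_form_sym23:
  assumes "A \<in> CM" "B \<in> CM" "C \<in> CM" "E \<in> CM"
  shows "perm_form A B C E = perm_form A C B E"
  unfolding perm_form_def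
  using mtrace_comm[of C d B] mtrace_comm[of C d "B * E"] mtrace_comm[of "C * E" d B] assms
  by (simp add: algebra_simps)

lemma perm_form_sym34:
  assumes "A \<in> CM" "B \<in> CM" "C \<in> CM" "E \<in> CM"
  shows "perm_form A B C E = perm_form A B E C"
  unfolding perm_form_def using mtrace_comm[of C d E] assms by (simp add: algebra_simps)

text \<open>Composition with the transposition of the first two factors permutes the 24
  permutations. In twelve terms the two copies of \<open>V\<close> lie in different traces, which
  are joined (\<open>S1\<close>); in the other twelve they lie in one trace, which is split
  (\<open>S2\<close>).\<close>

lemma perm_form_swap:
  assumes "A \<in> CM" "B \<in> CM" "C \<in> CM" "E \<in> CM"
  shows "D * perm_form A B C E = (\<Sum>V\<in>PP. perm_form (V * A) (V * B) C E)"
proof -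
  define S1 where "S1 V Y Z k = tr (V * Y) * tr (V * Z) * k" for V Y Z k
  define S2 where "S2 V Y Z k = tr (V * (Y * (V * Z))) * k" for V Y Z k
  let ?c = "tr C" and ?e = "tr E" and ?ce = "tr (C * E)"
  have "perm_form (V * A) (V * B) C E =
     S1 V A B (?c * ?e) + S2 V A B (?c * ?e) + S1 V (A * C) B ?e + S1 V (A * E) B ?c + S1 V A (B * C) ?e
   + S1 V A (B * E) ?c + S1 V A B ?ce + S2 V A B ?ce + S1 V (A * C) (B * E) 1 + S1 V (A * E) (B * C) 1
   + S2 V A (B * C) ?e + S2 V (A * C) B ?e + S2 V A (B * E) ?c + S2 V (A * E) B ?c
   + S1 V (A * (C * E)) B 1 + S1 V (A * (E * C)) B 1 + S1 V A (B * (C * E)) 1 + S1 V A (B * (E * C)) 1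
   + S2 V A (B * (C * E)) 1 + S2 V A (B * (E * C)) 1 + S2 V (A * C) (B * E) 1
   + S2 V (A * (C * E)) B 1 + S2 V (A * E) (B * C) 1 + S2 V (A * (E * C)) B 1" if "V \<in> PP" for V
    unfolding perm_form_def S1_def S2_def using that assms by (simp add: algebra_simps)
  moreover have "(\<Sum>V\<in>PP. S1 V Y Z k) = D * (tr (Y * Z) * k)" if "Y \<in> CM" "Z \<in> CM" for Y Z k
    unfolding S1_def using that by (simp add: sum_trace_trace flip: sum_distrib_right)
  moreover have "(\<Sum>V\<in>PP. S2 V Y Z k) = D * (tr Y * tr Z * k)" if "Y \<in> CM" "Z \<in> CM" for Y Z k
    unfolding S2_def using that by (simp add: sum_trace_conj flip: sum_distrib_right)
  ultimately have "(\<Sum>V\<in>PP. perm_form (V * A) (V * B) C E) = D * perm_form A B C E"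
    unfolding perm_form_def[of A B] using assms by (simp add: sum.distrib algebra_simps cong: sum.cong)
  thus ?thesis ..
qed

lemma mtrace_gens_conj: "U \<in> gens \<Longrightarrow> A \<in> CM \<Longrightarrow> tr (U * (A * U)) = tr A"
  using mtrace_comm[of U d "A * U"] by simp

lemma perm_form_inv:
  assumes U: "U \<in> gens" and "A \<in> CM" "B \<in> CM" "C \<in> CM" "E \<in> CM"
  shows "perm_form (U * (A * U)) (U * (B * U)) (U * (C * U)) (U * (E * U)) = perm_form A B C E"
  unfolding perm_form_def using assms
  by (simp only: gens_conj_mult[OF U, symmetric] mtrace_gens_conj[OF U] mult_CM)

text \<open>The same sum of traces, multiplied by the projector \<open>(1/d\<^sup>2) \<Sum>W. W \<otimes> W \<otimes> W \<otimes> W\<close>.\<close>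

definition pauli_form :: "complex mat \<Rightarrow> complex mat \<Rightarrow> complex mat \<Rightarrow> complex mat \<Rightarrow> complex" where
  "pauli_form A B C E = (1 / D\<^sup>2) * (\<Sum>W\<in>PP. perm_form (W * A) (W * B) (W * C) (W * E))"

lemma perm_form_hom:
  assumes "A \<in> CM" "B \<in> CM" "C \<in> CM" "E \<in> CM"
  shows "perm_form (c \<cdot>\<^sub>m A) B C E = c * perm_form A B C E" "perm_form A (c \<cdot>\<^sub>m B) C E = c * perm_form A B C E"
    "perm_form A B (c \<cdot>\<^sub>m C) E = c * perm_form A B C E" "perm_form A B C (c \<cdot>\<^sub>m E) = c * perm_form A B C E"
proof -
  have 1: "perm_form (c \<cdot>\<^sub>m A) B C E = c * perm_form A B C E" if "A \<in> CM" "B \<in> CM" "C \<in> CM" "E \<in> CM" for A B C E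
    using lin_PP_smult[OF perm_form_lin] that by blast
  have 2: "perm_form A (c \<cdot>\<^sub>m B) C E = c * perm_form A B C E" if "A \<in> CM" "B \<in> CM" "C \<in> CM" "E \<in> CM" for A B C E
    using 1[of B A C E] perm_form_sym12[of A B C E] perm_form_sym12[of A "c \<cdot>\<^sub>m B" C E] that by simp
  have 3: "perm_form A B (c \<cdot>\<^sub>m C) E = c * perm_form A B C E" if "A \<in> CM" "B \<in> CM" "C \<in> CM" "E \<in> CM" for A B C E
    using 2[of A C B E] perm_form_sym23[of A B C E] perm_form_sym23[of A B "c \<cdot>\<^sub>m C" E] that by simp
  show "perm_form A B C (c \<cdot>\<^sub>m E) = c * perm_form A B C E"
    using 3[of A B E C] perm_form_sym34[of A B C E] perm_form_sym34[of A B C "c \<cdot>\<^sub>m E"] assms by simp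
  show "perm_form (c \<cdot>\<^sub>m A) B C E = c * perm_form A B C E" "perm_form A (c \<cdot>\<^sub>m B) C E = c * perm_form A B C E"
    "perm_form A B (c \<cdot>\<^sub>m C) E = c * perm_form A B C E" by (intro 1 2 3 assms)+
qed

lemma perm_form_phase:
  assumes "c ^ 4 = 1" "W \<in> CM" "A \<in> CM" "B \<in> CM" "C \<in> CM" "E \<in> CM"
  shows "perm_form ((c \<cdot>\<^sub>m W) * A) ((c \<cdot>\<^sub>m W) * B) ((c \<cdot>\<^sub>m W) * C) ((c \<cdot>\<^sub>m W) * E) = perm_form (W * A) (W * B) (W * C) (W * E)"
proof -
  have "perm_form ((c \<cdot>\<^sub>m W) * A) ((c \<cdot>\<^sub>m W) * B) ((c \<cdot>\<^sub>m W) * C) ((c \<cdot>\<^sub>m W) * E) = c ^ 4 * perm_form (W * A) (W * B) (W * C) (W * E)"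
    using assms(2-) by (simp add: perm_form_hom power4_eq_xxxx mult_ac)
  thus ?thesis using assms by simp
qed

lemma pauli_form_lin: "B \<in> CM \<Longrightarrow> C \<in> CM \<Longrightarrow> E \<in> CM \<Longrightarrow> lin_PP (\<lambda>A. pauli_form A B C E)"
  unfolding pauli_form_def
  by (intro lin_PP_mult_left lin_PP_sum lin_PP_comp[where g = "\<lambda>A. perm_form A _ _ _"] perm_form_lin) simp_all

lemma pauli_form_sym:
  assumes "A \<in> CM" "B \<in> CM" "C \<in> CM" "E \<in> CM"
  shows "pauli_form A B C E = pauli_form B A C E" "pauli_form A B C E = pauli_form A C B E" "pauli_form A B C E = pauli_form A B E C"
  unfolding pauli_form_def using assms
  by (auto intro!: arg_cong2[where f = "(*)"] sum.cong perm_form_sym12 perm_form_sym23 perm_form_sym34)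

lemma sum_PP_gens_conj:
  assumes U: "U \<in> gens" and f: "\<And>c W. c ^ 4 = 1 \<Longrightarrow> W \<in> PP \<Longrightarrow> f (c \<cdot>\<^sub>m W) = f W"
  shows "(\<Sum>W\<in>PP. f (U * (W * U))) = (\<Sum>W\<in>PP. f W)"
  using sum_PP_unitary_conj[OF gens_CM[OF U], unfolded gens_herm[OF U], OF gens_square[OF U] gens_conj[OF U] f] by simp

text \<open>The summand ignores phases of \<open>W\<close>, so \<open>W\<close> may be replaced by
  its conjugate; the gate then acts on every argument and is absorbed by the permutation
  traces.\<close>

lemma pauli_form_inv:
  assumes U: "U \<in> gens" and CM: "A \<in> CM" "B \<in> CM" "C \<in> CM" "E \<in> CM"
  shows "pauli_form (U * (A * U)) (U * (B * U)) (U * (C * U)) (U * (E * U)) = pauli_form A B C E"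
proof -
  let ?c = "\<lambda>A. U * (A * U)"
  have "(\<Sum>W\<in>PP. perm_form (W * ?c A) (W * ?c B) (W * ?c C) (W * ?c E)) =
    (\<Sum>W\<in>PP. perm_form (?c W * ?c A) (?c W * ?c B) (?c W * ?c C) (?c W * ?c E))"
    by (rule sum_PP_gens_conj[OF U, symmetric]) (use U CM in \<open>intro perm_form_phase; simp\<close>)
  also have "\<dots> = (\<Sum>W\<in>PP. perm_form (?c (W * A)) (?c (W * B)) (?c (W * C)) (?c (W * E)))"
    using CM by (intro sum.cong refl) (simp only: gens_conj_mult[OF U] PP_CM)
  also have "\<dots> = (\<Sum>W\<in>PP. perm_form (W * A) (W * B) (W * C) (W * E))"
    using CM by (intro sum.cong refl perm_form_inv[OF U]) auto
  finally show ?thesis by (simp only: pauli_form_def)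
qed

text \<open>The fourfold power of \<open>W\<close> commutes with \<open>V\<close> acting on two
  factors, as the two commutation signs cancel.\<close>

lemma pauli_form_swap:
  assumes CM: "A \<in> CM" "B \<in> CM" "C \<in> CM" "E \<in> CM"
  shows "D * pauli_form A B C E = (\<Sum>V\<in>PP. pauli_form (V * A) (V * B) C E)"
proof -
  have c: "perm_form (W * (V * A)) (W * (V * B)) (W * C) (W * E) = perm_form (V * (W * A)) (V * (W * B)) (W * C) (W * E)"
    if "V \<in> PP" "W \<in> PP" for V W
    using that CM by (simp add: comm_sg_left[of W V] perm_form_hom)
  have "(\<Sum>V\<in>PP. pauli_form (V * A) (V * B) C E) = (1 / D\<^sup>2) * (\<Sum>V\<in>PP. \<Sum>W\<in>PP. perm_form (V * (W * A)) (V * (W * B)) (W * C) (W * E))"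
    unfolding pauli_form_def by (simp add: c sum_distrib_left)
  also have "\<dots> = (1 / D\<^sup>2) * (\<Sum>W\<in>PP. D * perm_form (W * A) (W * B) (W * C) (W * E))"
    using CM by (subst sum.swap) (simp add: perm_form_swap[of "_ * A" "_ * B"])
  finally show ?thesis by (simp add: pauli_form_def sum_distrib_left mult_ac)
qed

text \<open>At the identity each permutation contributes \<open>D\<close> to the number of its
  cycles. At any other \<open>W\<close> every cycle of odd length has trace zero, leaving the 3
  double transpositions with \<open>D\<close> squared and the 6 four-cycles with
  \<open>D\<close>.\<close>

lemma perm_form_PP:
  assumes "W \<in> PP"
  shows "perm_form W W W W = (if W = I then D ^ 4 + 6 * D ^ 3 + 8 * D\<^sup>2 else 0) + (3 * D\<^sup>2 + 6 * D)"
  unfolding perm_form_def using assms mtrace_PP[OF assms]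
  by (auto simp: mtrace_one power2_eq_square power3_eq_cube power4_eq_xxxx algebra_simps)

lemma sum_perm_form_PP: "(\<Sum>W\<in>PP. perm_form W W W W) = 4 * D ^ 4 + 12 * D ^ 3 + 8 * D\<^sup>2"
  by (simp add: perm_form_PP sum.distrib card_PP power2_eq_square power3_eq_cube power4_eq_xxxx algebra_simps)

lemma pauli_form_one: "pauli_form I I I I = 4 * D\<^sup>2 + 12 * D + 8"
proof -
  have "pauli_form I I I I = (1 / D\<^sup>2) * (\<Sum>W\<in>PP. perm_form W W W W)" unfolding pauli_form_def by simp
  also have "(\<Sum>W\<in>PP. perm_form W W W W) = D\<^sup>2 * (4 * D\<^sup>2 + 12 * D + 8)"
    unfolding sum_perm_form_PP by (simp add: algebra_simps power2_eq_square power3_eq_cube power4_eq_xxxx)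
  finally show ?thesis by simp
qed

text \<open>The fourfold power of \<open>V\<close> is absorbed by the projector Q, so each summand
  equals the value at the identity.\<close>

lemma sum_pauli_form_PP: "(\<Sum>V\<in>PP. pauli_form V V V V) = D\<^sup>2 * (4 * D\<^sup>2 + 12 * D + 8)"
proof -
  have "(\<Sum>W\<in>PP. perm_form (W * V) (W * V) (W * V) (W * V)) = (\<Sum>W\<in>PP. perm_form W W W W)" if V: "V \<in> PP" for V
    using perm_form_phase[of _ _ I I I I] V by (intro sum_PP_mult_right[where f = "\<lambda>W. perm_form W W W W"]) auto
  hence "(\<Sum>V\<in>PP. pauli_form V V V V) = (\<Sum>V\<in>PP. pauli_form I I I I)" by (simp add: pauli_form_def)
  thus ?thesis by (simp add: pauli_form_one card_PP)
qed

end

text \<open>\<open>Orb_pure\<close> is the rank-one identity \<open>P A P = tr (P A) P\<close> in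
  traced form. \<open>Orb_fourth\<close> uses one \<alpha> for all orbit points, since Clifford
  unitaries permute the Pauli operators up to phases that disappear in fourth powers.\<close>

locale pure_orbit = pauli_basis +
  fixes Orb :: "complex mat set" and \<alpha> :: real
  assumes d_ge_2: "d \<ge> 2"
    and finite_Orb: "finite Orb" and Orb_nonempty: "Orb \<noteq> {}"
    and Orb_CM [simp]: "P \<in> Orb \<Longrightarrow> P \<in> CM"
    and Orb_trace [simp]: "P \<in> Orb \<Longrightarrow> tr P = 1"
    and Orb_herm: "P \<in> Orb \<Longrightarrow> mat_adjoint P = P"
    and Orb_pure: "P \<in> Orb \<Longrightarrow> A \<in> CM \<Longrightarrow> B \<in> CM \<Longrightarrow> tr (P * (A * (P * B))) = tr (P * A) * tr (P * B)"
    and Orb_closed: "P \<in> Orb \<Longrightarrow> U \<in> gens \<Longrightarrow> U * (P * U) \<in> Orb"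
    and Orb_fourth: "P \<in> Orb \<Longrightarrow> (\<Sum>W\<in>PP. tr (P * W) ^ 4) = D\<^sup>2 * complex_of_real \<alpha>"
begin

abbreviation N where "N \<equiv> of_nat (card Orb) :: complex"

lemma card_Orb [simp]: "card Orb > 0" "card Orb \<noteq> 0"
  using finite_Orb Orb_nonempty by (simp_all add: card_gt_0_iff)

lemma sum_Orb_conj:
  assumes U: "U \<in> gens" shows "(\<Sum>P\<in>Orb. f (U * (P * U))) = (\<Sum>P\<in>Orb. f P)"
proof (rule sum.reindex_bij_witness[where i = "\<lambda>P. U * (P * U)" and j = "\<lambda>P. U * (P * U)"])
  fix P assume "P \<in> Orb"
  thus "U * ((U * (P * U)) * U) = P" "U * (P * U) \<in> Orb" "f (U * (P * U)) = f (U * (P * U))"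
    using U Orb_closed gens_conj_conj by auto
qed (use U Orb_closed gens_conj_conj in auto)

lemma trace_Orb_conj:
  assumes "U \<in> gens" "P \<in> CM" "A \<in> CM"
  shows "tr (P * (U * (A * U))) = tr ((U * (P * U)) * A)"
  using mtrace_comm[of "P * (U * A)" d U] assms by simp

text \<open>Swapping the two factors leaves \<open>P (x) P\<close> unchanged; after contraction this
  is exactly purity.\<close>

lemma sum_Orb_trace_swap:
  assumes P: "P \<in> Orb" and "A \<in> CM" "B \<in> CM"
  shows "(\<Sum>V\<in>PP. tr (P * (V * A)) * tr (P * (V * B))) = D * (tr (P * A) * tr (P * B))"
proof -
  have "tr (P * (V * A)) = tr (V * (A * P))" if "V \<in> PP" "A \<in> CM" for V A
    using mtrace_comm[of P d "V * A"] that P by simp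
  hence "(\<Sum>V\<in>PP. tr (P * (V * A)) * tr (P * (V * B))) = (\<Sum>V\<in>PP. tr (V * (A * P)) * tr (V * (B * P)))"
    using assms by simp
  also have "\<dots> = D * tr ((A * P) * (B * P))" using assms by (intro sum_trace_trace) auto
  also have "tr ((A * P) * (B * P)) = tr (P * (A * (P * B)))"
    using mtrace_comm[of "A * (P * B)" d P] assms by simp
  finally show ?thesis using assms by (simp add: Orb_pure)
qed

definition moment4 :: "complex mat \<Rightarrow> complex mat \<Rightarrow> complex mat \<Rightarrow> complex mat \<Rightarrow> complex" where
  "moment4 A B C E = (1 / N) * (\<Sum>P\<in>Orb. tr (P * A) * tr (P * B) * tr (P * C) * tr (P * E))"

lemma moment4_lin: "lin_PP (\<lambda>A. moment4 A B C E)"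
  unfolding moment4_def by (intro lin_PP_mult_left lin_PP_mult_right lin_PP_sum lin_PP_comp[where g = tr] lin_PP_trace Orb_CM)

lemma moment4_inv:
  assumes U: "U \<in> gens" and CM: "A \<in> CM" "B \<in> CM" "C \<in> CM" "E \<in> CM"
  shows "moment4 (U * (A * U)) (U * (B * U)) (U * (C * U)) (U * (E * U)) = moment4 A B C E"
  using sum_Orb_conj[OF U, of "\<lambda>P. tr (P * A) * tr (P * B) * tr (P * C) * tr (P * E)"]
  unfolding moment4_def using CM U by (simp add: trace_Orb_conj del: assoc)

lemma moment4_swap:
  assumes CM: "A \<in> CM" "B \<in> CM" "C \<in> CM" "E \<in> CM"
  shows "D * moment4 A B C E = (\<Sum>V\<in>PP. moment4 (V * A) (V * B) C E)"
proof -
  have "(\<Sum>V\<in>PP. moment4 (V * A) (V * B) C E) = (1 / N) * (\<Sum>P\<in>Orb. \<Sum>V\<in>PP.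
      tr (P * (V * A)) * tr (P * (V * B)) * (tr (P * C) * tr (P * E)))"
    unfolding moment4_def by (subst sum.swap) (simp add: sum_distrib_left mult_ac)
  also have "\<dots> = (1 / N) * (\<Sum>P\<in>Orb. D * (tr (P * A) * tr (P * B)) * (tr (P * C) * tr (P * E)))"
    using CM by (simp add: sum_Orb_trace_swap flip: sum_distrib_right)
  finally show ?thesis by (simp add: moment4_def sum_distrib_left mult_ac)
qed

lemma moment4_one: "moment4 I I I I = 1"
  by (simp add: moment4_def)

lemma sum_moment4_PP: "(\<Sum>V\<in>PP. moment4 V V V V) = D\<^sup>2 * complex_of_real \<alpha>"
proof -
  have "(\<Sum>V\<in>PP. moment4 V V V V) = (1 / N) * (\<Sum>P\<in>Orb. \<Sum>V\<in>PP. tr (P * V) ^ 4)"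
    unfolding moment4_def by (subst sum.swap) (simp add: sum_distrib_left power4_eq_xxxx mult_ac)
  thus ?thesis by (simp add: Orb_fourth)
qed

text \<open>With 24 suppressed, the fourth moment operator is
  \<open>lam * (1 - Q) P_sym + (lam + kap) * Q P_sym\<close>. The weight \<alpha> on Q determines
  \<open>lam + kap\<close>, and the remaining weight 1 - \<alpha> determines \<open>lam\<close>. The
  factor \<open>(D - 1) * (D + 4)\<close> is \<open>D * (D + 3) - 4\<close>, from the difference of
  the values of \<open>perm_form\<close> and \<open>pauli_form\<close> at the identity.\<close>

definition lam where "lam = (1 - complex_of_real \<alpha>) / ((D + 1) * (D + 2) * (D - 1) * (D + 4))"
definition kap where "kap = complex_of_real \<alpha> / (4 * (D + 1) * (D + 2)) - lam"

lemma fourth_moment: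
  assumes CM: "A \<in> CM" "B \<in> CM" "C \<in> CM" "E \<in> CM"
  shows "moment4 A B C E = lam * perm_form A B C E + kap * pauli_form A B C E"
proof -
  have nz: "D + 1 \<noteq> 0" "D + 2 \<noteq> 0" "D + 4 \<noteq> 0" "D - 1 \<noteq> 0"
    using of_nat_neq_0[of d, where 'a = complex] of_nat_neq_0[of "d + 1", where 'a = complex]
      of_nat_neq_0[of "d + 3", where 'a = complex] d_ge_2 by (auto simp: add.commute)
  have k4: "kap * (4 * D\<^sup>2 + 12 * D + 8) = complex_of_real \<alpha> - lam * (4 * D\<^sup>2 + 12 * D + 8)"
  proof -
    have "4 * D\<^sup>2 + 12 * D + 8 = 4 * (D + 1) * (D + 2)" by (simp add: algebra_simps power2_eq_square)
    moreover have "4 * (D + 1) * (D + 2) \<noteq> 0" using nz by (simp del: distrib_left_numeral)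
    ultimately show ?thesis unfolding kap_def by (simp add: left_diff_distrib)
  qed
  have l: "lam * ((D + 1) * (D + 2) * (D - 1) * (D + 4)) = 1 - complex_of_real \<alpha>" unfolding lam_def using nz by simp
  let ?G = "\<lambda>A B C E. moment4 A B C E - lam * perm_form A B C E - kap * pauli_form A B C E"
  interpret G: invariant_form d PP ?G
  proof unfold_locales
    fix A B C E assume CM: "A \<in> CM" "B \<in> CM" "C \<in> CM" "E \<in> CM"
    have "lin_PP (\<lambda>A. ?G A B C E)"
      using CM by (intro lin_PP_diff lin_PP_mult_left moment4_lin perm_form_lin pauli_form_lin)
    from lin_PPD[OF this CM(1)]
    show "?G A B C E =
       1 / D * (\<Sum>W\<in>PP. tr (W * A) * (?G W B C E))" .
    show "?G A B C E = ?G B A C E"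
      unfolding perm_form_sym12[OF CM] pauli_form_sym(1)[OF CM] by (simp add: moment4_def mult_ac)
    show "?G A B C E = ?G A C B E"
      unfolding perm_form_sym23[OF CM] pauli_form_sym(2)[OF CM] by (simp add: moment4_def mult_ac)
    show "?G A B C E = ?G A B E C"
      unfolding perm_form_sym34[OF CM] pauli_form_sym(3)[OF CM] by (simp add: moment4_def mult_ac)
    show "D * (?G A B C E) =
       (\<Sum>V\<in>PP. ?G (V * A) (V * B) C E)"
      by (simp add: sum_subtractf right_diff_distrib moment4_swap[OF CM, symmetric] perm_form_swap[OF CM, symmetric]
          pauli_form_swap[OF CM, symmetric] mult_ac flip: sum_distrib_left)
    fix U assume "U \<in> gens"
    thus "?G (U * (A * U)) (U * (B * U)) (U * (C * U)) (U * (E * U)) = ?G A B C E"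
      using CM by (simp only: moment4_inv perm_form_inv pauli_form_inv)
  next
    have "1 - lam * (D ^ 4 + 6 * D ^ 3 + 8 * D\<^sup>2 + (3 * D\<^sup>2 + 6 * D)) - (complex_of_real \<alpha> - lam * (4 * D\<^sup>2 + 12 * D + 8))
      = 1 - complex_of_real \<alpha> - lam * ((D + 1) * (D + 2) * (D - 1) * (D + 4))"
      by (simp add: algebra_simps power2_eq_square power3_eq_cube power4_eq_xxxx)
    thus "?G I I I I = 0"
      using perm_form_PP[OF one_PP] by (simp add: moment4_one pauli_form_one k4 l)
    have "(\<Sum>V\<in>PP. ?G V V V V) =
      D\<^sup>2 * complex_of_real \<alpha> - lam * (4 * D ^ 4 + 12 * D ^ 3 + 8 * D\<^sup>2) - D\<^sup>2 * (kap * (4 * D\<^sup>2 + 12 * D + 8))"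
      by (simp add: sum_subtractf sum_moment4_PP sum_perm_form_PP sum_pauli_form_PP mult_ac flip: sum_distrib_left)
    also have "\<dots> = 0" unfolding k4
      by (simp add: algebra_simps power2_eq_square power3_eq_cube power4_eq_xxxx)
    finally show "(\<Sum>V\<in>PP. ?G V V V V) = 0" .
  qed
  from G.F_zero[OF CM] show ?thesis by (simp add: algebra_simps)
qed

definition moment2 :: "complex mat \<Rightarrow> complex mat \<Rightarrow> complex" where
  "moment2 A B = (1 / N) * (\<Sum>P\<in>Orb. tr (P * A) * tr (P * B))"

lemma moment2_inv:
  assumes U: "U \<in> gens" and CM: "A \<in> CM" "B \<in> CM"
  shows "moment2 (U * (A * U)) (U * (B * U)) = moment2 A B"
  using sum_Orb_conj[OF U, of "\<lambda>P. tr (P * A) * tr (P * B)"]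
  unfolding moment2_def using CM U by (simp add: trace_Orb_conj del: assoc)

text \<open>For distinct \<open>V\<close> and \<open>W\<close> some Pauli operator commutes with
  exactly one of them and negates the moment. The diagonal values agree on all operators other than
  \<open>I\<close>; the value 1 at \<open>I\<close> and the total \<open>D\<close> given by purity
  then fix the common one.\<close>

lemma moment2_PP:
  assumes "V \<in> PP" "W \<in> PP"
  shows "moment2 V W = (if V = W then (1 + (if V = I then D else 0)) / (D + 1) else 0)"
proof (cases "V = W")
  case False
  have "\<exists>S\<in>PP. sg S V * sg S W = -1"
  proof (rule ccontr)
    assume n: "\<not> (\<exists>S\<in>PP. sg S V * sg S W = -1)"
    have "sg V S * sg W S = 1" if "S \<in> PP" for S
      using n that sg_cases[of S V] sg_cases[of S W] by (auto simp: sg_sym[of V] sg_sym[of W])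
    hence "(\<Sum>S\<in>PP. sg V S * sg W S) = D\<^sup>2" by (simp add: card_PP)
    thus False using sum_sg_sg[OF assms] False by simp
  qed
  then obtain S where S: "S \<in> PP" "sg S V * sg S W = -1" by blast
  have "moment2 V W = moment2 (S * (V * S)) (S * (W * S))" using moment2_inv[of S V W] S assms by (simp add: gens_def)
  also have "\<dots> = (sg S V * sg S W) * moment2 V W"
    unfolding conj_PP[OF S(1) assms(1)] conj_PP[OF S(1) assms(2)] moment2_def using assms S(1)
    by (simp add: sum_distrib_left mult_ac)
  finally show ?thesis using False unfolding S(2) by simp
next
  case True
  have nz: "D + 1 \<noteq> 0" using of_nat_neq_0[of d, where 'a = complex] by (simp add: add.commute)
  \<comment> \<open>Subtracting the expected values turns the computation into a vanishing
    statement, to which the exchange argument applies.\<close>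
  define f where "f V = moment2 V V - (1 + (if V = I then D else 0)) / (D + 1)" for V
  have "(\<Sum>V\<in>PP. moment2 V V) = (1 / N) * (\<Sum>P\<in>Orb. \<Sum>V\<in>PP. tr (P * (V * I)) * tr (P * (V * I)))"
    unfolding moment2_def by (subst sum.swap) (simp add: sum_distrib_left)
  also have "\<dots> = D" by (simp add: sum_Orb_trace_swap del: one_right) simp
  finally have s: "(\<Sum>V\<in>PP. moment2 V V) = D" .
  have "(\<Sum>V\<in>PP. (1 + (if V = I then D else 0)) / (D + 1)) = (D\<^sup>2 + D) / (D + 1)"
    by (simp add: sum.distrib card_PP flip: sum_divide_distrib)
  also have "\<dots> = D" using nz by (simp add: field_simps power2_eq_square)
  finally have sf: "(\<Sum>V\<in>PP. f V) = 0" unfolding f_def sum_subtractf s by simp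
  have "f V = 0"
  proof (rule zero_of_exchange[OF sf _ _ assms(1)])
    show "f I = 0" using nz by (simp add: f_def moment2_def add.commute)
    show "f C = f C'" if C: "C \<in> PP" "C' \<in> PP" "sg C C' = -1" for C C'
      using moment2_inv[of "hada C C'" C C] C by (auto simp: hada_conj_left f_def)
  qed
  thus ?thesis using True by (simp add: f_def)
qed

text \<open>The second moment is diagonal in the Pauli basis with equal weights away from
  \<open>I\<close>. The equal weights give the trace of \<open>X * X\<close> by Parseval, and the
  excess at \<open>I\<close> gives the squared trace.\<close>

lemma second_moment:
  assumes X: "X \<in> CM"
  shows "moment2 X X = (tr X * tr X + tr (X * X)) / (D * (D + 1))"
proof -
  have nz: "D + 1 \<noteq> 0" using of_nat_neq_0[of d, where 'a = complex] by (simp add: add.commute)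
  have l1: "lin_PP (\<lambda>A. moment2 A B)" for B
    unfolding moment2_def by (intro lin_PP_mult_left lin_PP_mult_right lin_PP_sum lin_PP_comp[where g = tr] lin_PP_trace Orb_CM)
  have sym: "moment2 A B = moment2 B A" for A B unfolding moment2_def by (simp add: mult.commute)
  have WX: "moment2 W X = (1 / D) * (tr (W * X) * ((1 + (if W = I then D else 0)) / (D + 1)))" if W: "W \<in> PP" for W
  proof -
    have "moment2 X W = (1 / D) * (\<Sum>V\<in>PP. tr (V * X) * moment2 V W)" by (rule lin_PPD[OF l1 X])
    also have "(\<Sum>V\<in>PP. tr (V * X) * moment2 V W) =
      (\<Sum>V\<in>PP. if V = W then tr (W * X) * ((1 + (if W = I then D else 0)) / (D + 1)) else 0)"
      using W by (intro sum.cong refl) (auto simp: moment2_PP)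
    finally show ?thesis using W by (simp add: sym[of W X])
  qed
  have "moment2 X X = (1 / D) * (\<Sum>W\<in>PP. tr (W * X) * moment2 W X)" by (rule lin_PPD[OF l1 X])
  also have "(\<Sum>W\<in>PP. tr (W * X) * moment2 W X) =
     (\<Sum>W\<in>PP. (tr (W * X) * tr (W * X) + (if W = I then D * (tr X * tr X) else 0)) / (D * (D + 1)))"
    using X nz by (intro sum.cong refl) (auto simp: WX field_simps)
  also have "\<dots> = (D * tr (X * X) + D * (tr X * tr X)) / (D * (D + 1))"
    using sum_trace_trace[OF X X] by (simp add: sum.distrib flip: sum_divide_distrib)
  finally show ?thesis by (simp add: distrib_left[symmetric] add.commute)
qed

end

section \<open>Eigenbases and the projector term\<close>

lemma cscalar_prod_sum:
  fixes v w :: "complex vec"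
  shows "v \<in> carrier_vec n \<Longrightarrow> w \<in> carrier_vec n \<Longrightarrow> v \<bullet>c w = (\<Sum>i<n. v $ i * cnj (w $ i))"
  by (auto simp: scalar_prod_def atLeast0LessThan intro!: sum.cong)

text \<open>Gram-Schmidt keeps the first vector of a basis completing \<open>v\<close> but delivers
  orthogonal, not orthonormal, vectors.\<close>

lemma unitary_completion:
  fixes v :: "complex vec"
  assumes v: "v \<in> carrier_vec n" "v \<noteq> 0\<^sub>v n" and n: "n \<noteq> 0"
  obtains W c where "W \<in> carrier_mat n n" "mat_adjoint W * W = 1\<^sub>m n" "col W 0 = c \<cdot>\<^sub>v v"
proof -
  interpret cof_vec_space n "TYPE(complex)" .
  define b where "b = basis_completion v"
  define ws where "ws = gram_schmidt n b"
  from basis_completion[OF v, folded b_def]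
  have dist_b: "distinct b" and indep: "\<not> lin_dep (set b)" and b: "set b \<subseteq> carrier_vec n" and hdb: "hd b = v"
    and len_b: "length b = n" by auto
  from hdb len_b n obtain vs where bv: "b = v # vs" by (cases b) auto
  from gram_schmidt_result[OF b dist_b indep refl, folded ws_def]
  have ws: "set ws \<subseteq> carrier_vec n" "corthogonal ws" "length ws = n" by (auto simp: len_b)
  from gram_schmidt_hd[OF v(1), of vs, folded bv] have hdws: "hd ws = v" unfolding ws_def .
  have wsc: "ws ! i \<in> carrier_vec n" if "i < n" for i using ws that by (metis nth_mem subsetD)
  define q where "q i = (\<Sum>k<n. (cmod (ws ! i $ k))\<^sup>2)" for i
  have qq: "ws ! i \<bullet>c ws ! i = of_real (q i)" if "i < n" for i
    using cscalar_prod_sum[OF wsc wsc, OF that that] by (simp add: q_def complex_norm_square del: of_real_power)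
  have qpos: "q i > 0" if "i < n" for i
  proof -
    have "q i \<noteq> 0" using corthogonalD[OF ws(2), of i i] that ws(3) qq[OF that] by auto
    moreover have "q i \<ge> 0" unfolding q_def by (intro sum_nonneg) auto
    ultimately show ?thesis by simp
  qed
  \<comment> \<open>Columns are divided by their norms, which are positive because \<open>q\<close>
    holds the squared norms of nonzero vectors.\<close>
  define W where "W = mat n n (\<lambda>(i, j). ws ! j $ i / of_real (sqrt (q j)))"
  have W: "W \<in> carrier_mat n n" unfolding W_def by simp
  have "mat_adjoint W * W = 1\<^sub>m n"
  proof (rule eq_matI)
    fix i j assume "i < dim_row (1\<^sub>m n :: complex mat)" "j < dim_col (1\<^sub>m n :: complex mat)"
    hence ij: "i < n" "j < n" by auto
    have "(mat_adjoint W * W) $$ (i, j) = (\<Sum>k<n. cnj (W $$ (k, i)) * W $$ (k, j))"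
      using W ij by (subst mult_mat_index[of _ n]) auto
    also have "\<dots> = (\<Sum>k<n. ws ! j $ k * cnj (ws ! i $ k)) / (of_real (sqrt (q i)) * of_real (sqrt (q j)))"
      unfolding sum_divide_distrib using ij by (intro sum.cong refl) (simp add: W_def mult_ac)
    also have "\<dots> = (ws ! j \<bullet>c ws ! i) / (of_real (sqrt (q i)) * of_real (sqrt (q j)))"
      using cscalar_prod_sum[OF wsc[OF ij(2)] wsc[OF ij(1)]] by simp
    also have "\<dots> = (if i = j then 1 else 0)"
    proof (cases "i = j")
      case True
      have "complex_of_real (sqrt (q i)) * complex_of_real (sqrt (q i)) = of_real (q i)"
        using qpos[OF ij(1)] by (simp flip: of_real_mult)
      thus ?thesis using True qq[OF ij(1)] qpos[OF ij(1)] by simp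
    next
      case False
      thus ?thesis using corthogonalD[OF ws(2), of j i] ij ws(3) by simp
    qed
    finally show "(mat_adjoint W * W) $$ (i, j) = 1\<^sub>m n $$ (i, j)" using ij by simp
  qed (use W in auto)
  moreover have "col W 0 = (1 / of_real (sqrt (q 0))) \<cdot>\<^sub>v v"
  proof -
    have "ws ! 0 = v" using hdws ws(3) n by (metis hd_conv_nth length_0_conv)
    thus ?thesis using n v by (intro eq_vecI) (auto simp: W_def)
  qed
  ultimately show ?thesis using that W by blast
qed

text \<open>Deflation: in a unitary basis starting with an eigenvector the first column is diagonal,
  and Hermitian symmetry makes the first row diagonal too, so the remaining block is a smaller
  Hermitian matrix.\<close>

lemma hermitian_decomposition:
  fixes A :: "complex mat"
  assumes "A \<in> carrier_mat n n" "mat_adjoint A = A"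
  shows "\<exists>U l. U \<in> carrier_mat n n \<and> mat_adjoint U * U = 1\<^sub>m n \<and>
    mat_adjoint U * (A * U) = mat n n (\<lambda>(i, j). if i = j then complex_of_real (l i) else 0)"
  using assms
proof (induction n arbitrary: A)
  case 0
  thus ?case by (intro exI[of _ "1\<^sub>m 0"] exI[of _ "\<lambda>_. 0"]) (auto intro!: eq_matI)
next
  case (Suc m)
  let ?n = "Suc m"
  note A = Suc.prems
  obtain e where "eigenvalue A e" using spectrum_non_empty[OF A(1)] by (auto simp: spectrum_def)
  then obtain v where v: "v \<in> carrier_vec ?n" "v \<noteq> 0\<^sub>v ?n" "A *\<^sub>v v = e \<cdot>\<^sub>v v"
    using A(1) by (auto simp: eigenvalue_def eigenvector_def)
  obtain W c where W: "W \<in> carrier_mat ?n ?n" "mat_adjoint W * W = 1\<^sub>m ?n" "col W 0 = c \<cdot>\<^sub>v v"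
    by (rule unitary_completion[OF v(1,2)]) auto
  note W' = mat_adjoint_carrier[OF W(1)]
  define A' where "A' = mat_adjoint W * (A * W)"
  have A': "A' \<in> carrier_mat ?n ?n" unfolding A'_def using W(1) W' A(1) by auto
  have AW: "A * W \<in> carrier_mat ?n ?n" using A(1) W(1) by auto
  have herm: "mat_adjoint A' = A'"
    unfolding A'_def using W(1) W' A AW
    by (simp add: mat_adjoint_mult[of _ ?n] assoc_mult_mat[of _ ?n ?n _ ?n _ ?n])
  have herm_idx: "A' $$ (i, j) = cnj (A' $$ (j, i))" if "i < ?n" "j < ?n" for i j
    using arg_cong[OF herm, of "\<lambda>M. M $$ (i, j)"] that A' by simp
  have col0: "A' $$ (i, 0) = (if i = 0 then e else 0)" if i: "i < ?n" for i
  proof -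
    have "col (A * W) 0 = A *\<^sub>v col W 0" using A(1) W(1) by (intro col_mult2[of _ ?n ?n _ ?n]) auto
    also have "\<dots> = e \<cdot>\<^sub>v col W 0" unfolding W(3) using v A(1)
      by (simp add: mult_mat_vec[of _ ?n ?n] smult_smult_assoc mult.commute)
    finally have cc: "col (A * W) 0 = e \<cdot>\<^sub>v col W 0" .
    have "(A * W) $$ (k, 0) = e * W $$ (k, 0)" if "k < ?n" for k
      using arg_cong[OF cc, of "\<lambda>u. u $ k"] that A(1) W(1) by simp
    hence "A' $$ (i, 0) = e * (mat_adjoint W * W) $$ (i, 0)"
      unfolding A'_def using W(1) W' AW i by (simp only: mult_mat_index[of _ ?n] zero_less_Suc sum_distrib_left)
        (auto intro!: sum.cong)
    thus ?thesis unfolding W(2) using i by simp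
  qed
  have row0: "A' $$ (0, j) = (if j = 0 then e else 0)" if "j < ?n" for j
    using herm_idx[of 0 j] herm_idx[of 0 0] col0[OF that] col0[of 0] that by auto
  have "e = cnj e" using herm_idx[of 0 0] col0[of 0] by simp
  hence e: "of_real (Re e) = e" by (simp add: complex_eq_iff)
  define A3 where "A3 = mat m m (\<lambda>(i, j). A' $$ (Suc i, Suc j))"
  have A3: "A3 \<in> carrier_mat m m" unfolding A3_def by simp
  have "mat_adjoint A3 = A3"
  proof (rule eq_matI)
    fix i j assume "i < dim_row A3" "j < dim_col A3"
    thus "mat_adjoint A3 $$ (i, j) = A3 $$ (i, j)"
      using herm_idx[of "Suc i" "Suc j"] by (simp add: A3_def)
  qed (simp_all add: A3_def)
  from Suc.IH[OF A3 this] obtain U3 l3 where U3: "U3 \<in> carrier_mat m m" "mat_adjoint U3 * U3 = 1\<^sub>m m"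
    "mat_adjoint U3 * (A3 * U3) = mat m m (\<lambda>(i, j). if i = j then complex_of_real (l3 i) else 0)" by blast
  have U3a: "(\<Sum>k<m. cnj (U3 $$ (k, i)) * U3 $$ (k, j)) = (if i = j then 1 else 0)" if "i < m" "j < m" for i j
    using arg_cong[OF U3(2), of "\<lambda>M. M $$ (i, j)"] that U3(1) by (simp add: mult_mat_index[of _ m] del: index_mult_mat(1))
  have U3b: "(\<Sum>k<m. cnj (U3 $$ (k, i)) * (\<Sum>l<m. A' $$ (Suc k, Suc l) * U3 $$ (l, j))) = (if i = j then of_real (l3 i) else 0)"
    if "i < m" "j < m" for i j
  proof -
    have "(mat_adjoint U3 * (A3 * U3)) $$ (i, j) = (\<Sum>k<m. cnj (U3 $$ (k, i)) * (\<Sum>l<m. A' $$ (Suc k, Suc l) * U3 $$ (l, j)))"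
      using that U3(1) A3 mult_carrier_mat[OF A3 U3(1)]
      by (simp add: mult_mat_index[of _ m] A3_def del: index_mult_mat(1))
    thus ?thesis unfolding U3(3) using that by simp
  qed
  \<comment> \<open>The block sum of the scalar 1 with the unitary \<open>U3\<close> found for the
    smaller matrix.\<close>
  define B where "B = mat ?n ?n (\<lambda>(i, j). case i of 0 \<Rightarrow> (case j of 0 \<Rightarrow> 1 | Suc _ \<Rightarrow> 0)
      | Suc i' \<Rightarrow> (case j of 0 \<Rightarrow> 0 | Suc j' \<Rightarrow> U3 $$ (i', j')))"
  have B: "B \<in> carrier_mat ?n ?n" unfolding B_def by simp
  have Bi: "B $$ (0, 0) = 1" "j < m \<Longrightarrow> B $$ (0, Suc j) = 0" "i < m \<Longrightarrow> B $$ (Suc i, 0) = 0"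
    "i < m \<Longrightarrow> j < m \<Longrightarrow> B $$ (Suc i, Suc j) = U3 $$ (i, j)" for i j
    by (simp_all add: B_def)
  have BB: "mat_adjoint B * B = 1\<^sub>m ?n"
  proof (rule eq_matI)
    fix i j assume "i < dim_row (1\<^sub>m ?n :: complex mat)" "j < dim_col (1\<^sub>m ?n :: complex mat)"
    hence ij: "i < ?n" "j < ?n" by auto
    have "(mat_adjoint B * B) $$ (i, j) = (\<Sum>k<?n. cnj (B $$ (k, i)) * B $$ (k, j))"
      using B ij by (subst mult_mat_index[of _ ?n]) auto
    also have "\<dots> = cnj (B $$ (0, i)) * B $$ (0, j) + (\<Sum>k<m. cnj (B $$ (Suc k, i)) * B $$ (Suc k, j))"
      by (rule sum.lessThan_Suc_shift)
    also have "\<dots> = (if i = j then 1 else 0)"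
      using ij U3a by (cases i; cases j) (auto simp: Bi)
    finally show "(mat_adjoint B * B) $$ (i, j) = 1\<^sub>m ?n $$ (i, j)" using ij by simp
  qed (use B in auto)
  define l where "l i = (case i of 0 \<Rightarrow> Re e | Suc i' \<Rightarrow> l3 i')" for i
  have BAB: "mat_adjoint B * (A' * B) = mat ?n ?n (\<lambda>(i, j). if i = j then complex_of_real (l i) else 0)" (is "_ = ?R")
  proof (rule eq_matI)
    fix i j assume "i < dim_row ?R" "j < dim_col ?R"
    hence ij: "i < ?n" "j < ?n" by auto
    have "(mat_adjoint B * (A' * B)) $$ (i, j) = (\<Sum>k<?n. cnj (B $$ (k, i)) * (\<Sum>l<?n. A' $$ (k, l) * B $$ (l, j)))"
      using B A' mult_carrier_mat[OF A' B] ij by (simp add: mult_mat_index[of _ ?n] del: index_mult_mat(1) sum.lessThan_Suc)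
    also have "\<dots> = cnj (B $$ (0, i)) * (A' $$ (0, 0) * B $$ (0, j) + (\<Sum>l<m. A' $$ (0, Suc l) * B $$ (Suc l, j)))
      + (\<Sum>k<m. cnj (B $$ (Suc k, i)) * (A' $$ (Suc k, 0) * B $$ (0, j) + (\<Sum>l<m. A' $$ (Suc k, Suc l) * B $$ (Suc l, j))))"
      by (simp only: sum.lessThan_Suc_shift)
    also have "\<dots> = (if i = j then complex_of_real (l i) else 0)"
      using ij U3b e by (cases i; cases j) (auto simp: Bi row0 col0 l_def)
    finally show "(mat_adjoint B * (A' * B)) $$ (i, j) = ?R $$ (i, j)" using ij by simp
  qed (use B A' in auto)
  note [simp] = assoc_mult_mat[of _ ?n ?n _ ?n _ ?n]
  note B' = mat_adjoint_carrier[OF B]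
  have "mat_adjoint (W * B) * (W * B) = mat_adjoint B * ((mat_adjoint W * W) * B)"
    using W(1) B W' B' by (simp add: mat_adjoint_mult[of _ ?n])
  hence 1: "mat_adjoint (W * B) * (W * B) = 1\<^sub>m ?n" using W(2) BB B by simp
  have "mat_adjoint (W * B) * (A * (W * B)) = mat_adjoint B * (A' * B)"
    unfolding A'_def using W(1) B W' B' A(1) AW by (simp add: mat_adjoint_mult[of _ ?n])
  hence 2: "mat_adjoint (W * B) * (A * (W * B)) = ?R" using BAB by simp
  show ?case using W(1) B by (intro exI[of _ "W * B"] exI[of _ l] conjI 1 2) auto
qed

section \<open>Spectra and Schatten norms of unitarily diagonalised matrices\<close>

definition diag_of :: "nat \<Rightarrow> (nat \<Rightarrow> complex) \<Rightarrow> complex mat" where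
  "diag_of n g = mat n n (\<lambda>(i, j). if i = j then g i else 0)"

lemma diag_of_carrier [simp]: "diag_of n g \<in> carrier_mat n n"
  by (simp add: diag_of_def)

lemma mult_diag_of_index:
  "A \<in> carrier_mat n n \<Longrightarrow> i < n \<Longrightarrow> j < n \<Longrightarrow> (A * diag_of n g) $$ (i, j) = A $$ (i, j) * g j"
  by (subst mult_mat_index[of _ n]) (auto simp: diag_of_def if_distrib[of "\<lambda>x. _ * x"] cong: if_cong)

lemma diag_of_mult: "diag_of n g * diag_of n h = diag_of n (\<lambda>i. g i * h i)"
proof (rule eq_matI)
  fix i j assume "i < dim_row (diag_of n (\<lambda>i. g i * h i))" "j < dim_col (diag_of n (\<lambda>i. g i * h i))"
  thus "(diag_of n g * diag_of n h) $$ (i, j) = diag_of n (\<lambda>i. g i * h i) $$ (i, j)"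
    by (subst mult_diag_of_index) (auto simp: diag_of_def)
qed (auto simp: diag_of_def)

lemma mtrace_diag_of: "tr (diag_of n g) = (\<Sum>i<n. g i)"
  by (simp add: mtrace_def diag_of_def)

lemma proots_diag_of: "proots (char_poly (diag_of n g)) = image_mset g (mset_set {..<n})"
proof -
  have "upper_triangular (diag_of n g)" by (auto simp: diag_of_def)
  hence "char_poly (diag_of n g) = (\<Prod>a\<leftarrow>diag_mat (diag_of n g). [:- a, 1:])"
    by (rule char_poly_upper_triangular[OF diag_of_carrier])
  also have "diag_mat (diag_of n g) = map g [0..<n]"
    by (auto simp: diag_mat_def diag_of_def)
  finally have "char_poly (diag_of n g) = (\<Prod>p\<leftarrow>map (\<lambda>i. [:- g i, 1:]) [0..<n]. p)" by (simp add: o_def)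
  hence "proots (char_poly (diag_of n g)) = (\<Sum>p\<leftarrow>map (\<lambda>i. [:- g i, 1:]) [0..<n]. proots p)"
    by (simp only:) (rule proots_prod_list, auto)
  also have "\<dots> = (\<Sum>i\<leftarrow>[0..<n]. {#g i#})" by (simp add: o_def)
  also have "\<dots> = image_mset g (mset [0..<n])" by (induction n) auto
  also have "mset [0..<n] = mset_set {..<n}" by (simp add: atLeast0LessThan flip: mset_set_set)
  finally show ?thesis .
qed

text \<open>For Hermitian \<open>X\<close> the matrix whose characteristic polynomial defines the
  singular values is \<open>X * X\<close>, which is similar to the diagonal matrix of squared
  eigenvalues.\<close>

lemma singular_values_unitary_diag:
  assumes U: "U \<in> carrier_mat n n" "mat_adjoint U * U = 1\<^sub>m n"
    and X: "X = U * (diag_of n (\<lambda>i. complex_of_real (l i)) * mat_adjoint U)" and herm: "mat_adjoint X = X"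
  shows "singular_values X = image_mset (\<lambda>i. \<bar>l i\<bar>) (mset_set {..<n})"
proof -
  note U' = mat_adjoint_carrier[OF U(1)]
  note [simp] = assoc_mult_mat[of _ n n _ n _ n]
  let ?L = "diag_of n (\<lambda>i. complex_of_real (l i))"
  have UU: "U * mat_adjoint U = 1\<^sub>m n" by (rule mat_mult_left_right_inverse[OF U' U])
  have "mat_adjoint X * X = X * X" using herm by simp
  also have "\<dots> = U * (?L * ((mat_adjoint U * U) * (?L * mat_adjoint U)))"
    unfolding X using U(1) U' mult_carrier_mat[OF diag_of_carrier U'] by simp
  also have "\<dots> = U * (?L * ?L) * mat_adjoint U"
    unfolding U(2) using U(1) U' left_mult_one_mat[OF mult_carrier_mat[OF diag_of_carrier U']]
      mult_carrier_mat[OF diag_of_carrier U'] mult_carrier_mat[OF diag_of_carrier diag_of_carrier] by simp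
  also have "?L * ?L = diag_of n (\<lambda>i. of_real ((l i)\<^sup>2))" by (simp add: diag_of_mult power2_eq_square)
  finally have XX: "mat_adjoint X * X = U * diag_of n (\<lambda>i. of_real ((l i)\<^sup>2)) * mat_adjoint U" .
  have "similar_mat_wit (mat_adjoint X * X) (diag_of n (\<lambda>i. of_real ((l i)\<^sup>2))) U (mat_adjoint U)"
    by (rule similar_mat_witI[OF UU U(2) XX]) (use U(1) U' XX in auto)
  hence "char_poly (mat_adjoint X * X) = char_poly (diag_of n (\<lambda>i. of_real ((l i)\<^sup>2)))"
    by (intro char_poly_similar) (auto simp: similar_mat_def)
  hence "singular_values X = image_mset (\<lambda>\<mu>. sqrt (Re \<mu>)) (image_mset (\<lambda>i. complex_of_real ((l i)\<^sup>2)) (mset_set {..<n}))"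
    by (simp only: singular_values_def proots_diag_of)
  thus ?thesis by (simp add: image_mset.compositionality o_def del: of_real_power)
qed

lemma schatten_norm_unitary_diag:
  assumes "U \<in> carrier_mat n n" "mat_adjoint U * U = 1\<^sub>m n"
    and "X = U * (diag_of n (\<lambda>i. complex_of_real (l i)) * mat_adjoint U)" "mat_adjoint X = X"
  shows "schatten_norm 1 X = (\<Sum>i<n. \<bar>l i\<bar>)" and "(schatten_norm 2 X)\<^sup>2 = (\<Sum>i<n. (l i)\<^sup>2)"
proof -
  have s: "schatten_norm p X = (\<Sum>i<n. \<bar>l i\<bar> powr p) powr (1 / p)" for p
    unfolding schatten_norm_def singular_values_unitary_diag[OF assms]
    by (simp add: image_mset.compositionality o_def sum_unfold_sum_mset)
  show "schatten_norm 1 X = (\<Sum>i<n. \<bar>l i\<bar>)" unfolding s by (simp add: sum_nonneg)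
  have "(\<Sum>i<n. \<bar>l i\<bar> powr 2) = (\<Sum>i<n. (l i)\<^sup>2)" by (simp add: powr_numeral)
  thus "(schatten_norm 2 X)\<^sup>2 = (\<Sum>i<n. (l i)\<^sup>2)" unfolding s
    by (simp add: sum_nonneg powr_half_sqrt)
qed

locale unitary_frame = pauli_basis +
  fixes U :: "complex mat"
  assumes U_CM [simp]: "U \<in> CM" and U_unitary: "mat_adjoint U * U = I"
begin

abbreviation U' where "U' \<equiv> mat_adjoint U"

lemma U'_CM [simp]: "U' \<in> CM" by simp

lemma U_U': "U * U' = I"
  by (rule mat_mult_left_right_inverse[OF U'_CM U_CM U_unitary])

lemma U'_cancel [simp]: "A \<in> CM \<Longrightarrow> U' * (U * A) = A"
  using U_unitary assoc[of U' U A] by simp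

lemma U_cancel [simp]: "A \<in> CM \<Longrightarrow> U * (U' * A) = A"
  using U_U' assoc[of U U' A] by simp

definition w :: "complex mat \<Rightarrow> nat \<Rightarrow> nat \<Rightarrow> complex" where
  "w A i j = (U' * (A * U)) $$ (i, j)"

lemma w_mult: "A \<in> CM \<Longrightarrow> B \<in> CM \<Longrightarrow> i < d \<Longrightarrow> j < d \<Longrightarrow> w (A * B) i j = (\<Sum>k<d. w A i k * w B k j)"
proof -
  assume a: "A \<in> CM" "B \<in> CM" "i < d" "j < d"
  have "U' * ((A * B) * U) = (U' * (A * U)) * (U' * (B * U))" using a by simp
  hence "w (A * B) i j = ((U' * (A * U)) * (U' * (B * U))) $$ (i, j)" by (simp only: w_def)
  also have "\<dots> = (\<Sum>k<d. w A i k * w B k j)" unfolding w_def using a by (intro mult_mat_index) auto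
  finally show ?thesis .
qed

lemma w_smult: "A \<in> CM \<Longrightarrow> i < d \<Longrightarrow> j < d \<Longrightarrow> w (c \<cdot>\<^sub>m A) i j = c * w A i j"
proof -
  assume a: "A \<in> CM" "i < d" "j < d"
  have "U' * ((c \<cdot>\<^sub>m A) * U) = c \<cdot>\<^sub>m (U' * (A * U))" using a by simp
  thus ?thesis unfolding w_def using a carrier_matD[OF mult_CM[OF U'_CM mult_CM[OF a(1) U_CM]]] by simp
qed

lemma w_herm: "W \<in> PP \<Longrightarrow> i < d \<Longrightarrow> j < d \<Longrightarrow> w W j i = cnj (w W i j)"
proof -
  assume a: "W \<in> PP" "i < d" "j < d"
  have adj: "mat_adjoint (U' * (W * U)) = U' * (W * U)"
    using a by (simp add: mat_adjoint_mult[of _ d] PP_herm)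
  have M: "U' * (W * U) \<in> CM" using a by simp
  have "mat_adjoint (U' * (W * U)) $$ (j, i) = cnj ((U' * (W * U)) $$ (i, j))"
    by (rule mat_adjoint_index) (use a carrier_matD[OF M] in auto)
  thus ?thesis unfolding adj w_def .
qed

lemma w_one: "i < d \<Longrightarrow> j < d \<Longrightarrow> w I i j = (if i = j then 1 else 0)"
  by (simp add: w_def U_unitary)

text \<open>\<open>W\<close> is Hermitian with square the identity, so each of its rows in any
  orthonormal basis has norm 1.\<close>

lemma w_diag_bound:
  assumes W: "W \<in> PP" and i: "i < d" shows "cmod (w W i i) \<le> 1"
proof -
  have "1 = w (W * W) i i" using W i by (simp add: w_one)
  also have "\<dots> = (\<Sum>k<d. w W i k * w W k i)" using W i by (intro w_mult) auto
  also have "\<dots> = (\<Sum>k<d. of_real ((cmod (w W i k))\<^sup>2))"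
    using W i by (intro sum.cong refl) (simp add: w_herm[of W i] complex_norm_square del: of_real_power)
  finally have "(\<Sum>k<d. (cmod (w W i k))\<^sup>2) = 1" by (metis of_real_eq_1_iff of_real_sum)
  moreover have "(cmod (w W i i))\<^sup>2 \<le> (\<Sum>k<d. (cmod (w W i k))\<^sup>2)" using i by (intro member_le_sum) auto
  ultimately show ?thesis by (simp add: abs_square_le_1)
qed

definition spec :: "(nat \<Rightarrow> complex) \<Rightarrow> complex mat" where
  "spec g = U * (diag_of d g * U')"

lemma spec_CM [simp]: "spec g \<in> CM"
  by (simp add: spec_def)

lemma spec_mult: "spec g * spec h = spec (\<lambda>i. g i * h i)"
proof -
  have "spec g * spec h = U * ((diag_of d g * diag_of d h) * U')" unfolding spec_def by simp
  thus ?thesis by (simp only: diag_of_mult spec_def)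
qed

lemma mtrace_conj_U: "A \<in> CM \<Longrightarrow> tr (U * (A * U')) = tr A"
  using mtrace_comm[of U d "A * U'"] by (simp add: U_unitary)

lemma mtrace_spec: "tr (spec g) = (\<Sum>i<d. g i)"
  unfolding spec_def by (simp add: mtrace_conj_U mtrace_diag_of)

lemma mtrace_mult_spec:
  assumes A: "A \<in> CM" shows "tr (A * spec g) = (\<Sum>i<d. w A i i * g i)"
proof -
  have "A * spec g = U * (((U' * (A * U)) * diag_of d g) * U')" unfolding spec_def using A by simp
  hence "tr (A * spec g) = tr ((U' * (A * U)) * diag_of d g)" using A by (simp only: mtrace_conj_U mult_CM diag_of_carrier U_CM U'_CM)
  also have "\<dots> = (\<Sum>i<d. ((U' * (A * U)) * diag_of d g) $$ (i, i))" using A by (intro mtrace_carrier) auto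
  also have "\<dots> = (\<Sum>i<d. w A i i * g i)"
    unfolding w_def using A by (intro sum.cong refl mult_diag_of_index) auto
  finally show ?thesis .
qed

section \<open>Fourfold tensor indices and positivity of the Pauli projector\<close>

definition S4 :: "(nat \<times> nat \<times> nat \<times> nat) set" where
  "S4 = {..<d} \<times> {..<d} \<times> {..<d} \<times> {..<d}"

lemma sum_S4: "(\<Sum>a\<in>S4. f a) = (\<Sum>i<d. \<Sum>j<d. \<Sum>k<d. \<Sum>m<d. f (i, j, k, m))"
  by (simp add: S4_def sum.cartesian_product)

lemma prod_sum_S4:
  fixes f g h q :: "nat \<Rightarrow> 'a :: comm_semiring_1"
  shows "(\<Sum>i<d. f i) * (\<Sum>i<d. g i) * (\<Sum>i<d. h i) * (\<Sum>i<d. q i) = (\<Sum>(i,j,k,m)\<in>S4. f i * g j * h k * q m)"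
  unfolding sum_S4 by (simp add: mult.assoc flip: sum_distrib_left sum_distrib_right)

definition ww :: "complex mat \<Rightarrow> nat \<times> nat \<times> nat \<times> nat \<Rightarrow> nat \<times> nat \<times> nat \<times> nat \<Rightarrow> complex" where
  "ww A = (\<lambda>(i,j,k,m) (i',j',k',m'). w A i i' * w A j j' * w A k k' * w A m m')"

text \<open>The coefficients count the permutations of each cycle type.\<close>

definition cycle_sum where
  "cycle_sum f i j k m = f (i,j,k,m) (i,j,k,m) + 6 * f (i,j,k,m) (i,j,m,k) + 3 * f (i,j,k,m) (j,i,m,k)
       + 8 * f (i,j,k,m) (i,k,m,j) + 6 * f (i,j,k,m) (j,k,m,i)"

text \<open>The matrix of \<open>\<Sum>W. W \<otimes> W \<otimes> W \<otimes> W\<close>, which is \<open>d\<^sup>2\<close> times a projector and hence positive.\<close>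

definition K where "K a b = (\<Sum>W\<in>PP. ww W a b)"

lemma ww_mult:
  assumes "A \<in> CM" "B \<in> CM" "a \<in> S4" "b \<in> S4"
  shows "ww (A * B) a b = (\<Sum>c\<in>S4. ww A a c * ww B c b)"
proof -
  obtain i j k m i' j' k' m' where a: "a = (i,j,k,m)" "b = (i',j',k',m')" by (metis surj_pair)
  have r: "i < d" "j < d" "k < d" "m < d" "i' < d" "j' < d" "k' < d" "m' < d"
    using assms(3,4) unfolding a S4_def by auto
  have "ww (A * B) a b = (\<Sum>c<d. w A i c * w B c i') * (\<Sum>c<d. w A j c * w B c j') * (\<Sum>c<d. w A k c * w B c k') * (\<Sum>c<d. w A m c * w B c m')"
    unfolding a ww_def using w_mult[OF assms(1,2)] r by simp
  also have "\<dots> = (\<Sum>c\<in>S4. ww A a c * ww B c b)"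
    unfolding prod_sum_S4 a ww_def by (intro sum.cong refl) (auto simp: mult_ac)
  finally show ?thesis .
qed

lemma ww_phase: "c ^ 4 = 1 \<Longrightarrow> A \<in> CM \<Longrightarrow> a \<in> S4 \<Longrightarrow> b \<in> S4 \<Longrightarrow> ww (c \<cdot>\<^sub>m A) a b = ww A a b"
proof -
  assume c: "c ^ 4 = 1" and A: "A \<in> CM" and ab: "a \<in> S4" "b \<in> S4"
  have "ww (c \<cdot>\<^sub>m A) a b = c ^ 4 * ww A a b"
    using ab A unfolding S4_def ww_def by (auto simp: w_smult power4_eq_xxxx mult_ac)
  thus ?thesis using c by simp
qed

text \<open>Multiplying two elements of the sum over \<open>W\<close> permutes the Pauli operators
  up to phases that vanish in fourfold products, so the sum squares to \<open>D\<close> squared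
  times itself.\<close>

lemma K_mult:
  assumes "a \<in> S4" "b \<in> S4" shows "D\<^sup>2 * K a b = (\<Sum>c\<in>S4. K a c * K c b)"
proof -
  have "(\<Sum>c\<in>S4. K a c * K c b) = (\<Sum>c\<in>S4. \<Sum>V\<in>PP. \<Sum>W\<in>PP. ww W a c * ww V c b)"
    unfolding K_def sum_product by (subst sum.swap) (rule refl)
  also have "\<dots> = (\<Sum>V\<in>PP. \<Sum>W\<in>PP. \<Sum>c\<in>S4. ww W a c * ww V c b)"
    by (subst sum.swap) (intro sum.cong refl sum.swap)
  also have "\<dots> = (\<Sum>V\<in>PP. \<Sum>W\<in>PP. ww (W * V) a b)"
    using assms by (intro sum.cong refl) (simp add: ww_mult)
  also have "\<dots> = (\<Sum>V\<in>PP. K a b)"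
    unfolding K_def using assms by (intro sum.cong refl sum_PP_mult_right ww_phase) auto
  finally show ?thesis by (simp add: card_PP)
qed

lemma K_herm: "a \<in> S4 \<Longrightarrow> b \<in> S4 \<Longrightarrow> K b a = cnj (K a b)"
  unfolding K_def cnj_sum
proof (intro sum.cong refl)
  fix W assume ab: "a \<in> S4" "b \<in> S4" and W: "W \<in> PP"
  obtain i j k m i' j' k' m' where a: "a = (i,j,k,m)" "b = (i',j',k',m')" by (metis surj_pair)
  have r: "i < d" "j < d" "k < d" "m < d" "i' < d" "j' < d" "k' < d" "m' < d"
    using ab unfolding a S4_def by auto
  show "ww W b a = cnj (ww W a b)"
    unfolding a ww_def using w_herm[OF W r(1,5)] w_herm[OF W r(2,6)] w_herm[OF W r(3,7)] w_herm[OF W r(4,8)] by simp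
qed

lemma K_diag:
  assumes a: "a \<in> S4" shows "K a a = of_real ((\<Sum>c\<in>S4. (cmod (K a c))\<^sup>2) / (real d)\<^sup>2)"
proof -
  have "D\<^sup>2 * K a a = (\<Sum>c\<in>S4. of_real ((cmod (K a c))\<^sup>2))"
    unfolding K_mult[OF a a] by (intro sum.cong refl) (simp add: K_herm[OF a] complex_norm_square del: of_real_power)
  thus ?thesis by (simp add: field_simps)
qed

text \<open>For a positive matrix an off-diagonal entry is at most the geometric mean of the two
  diagonal ones. Here this is Cauchy-Schwarz between rows \<open>a\<close> and \<open>b\<close>,
  whose squared norms are the diagonal entries times the square of \<open>d\<close>.\<close>

lemma K_bound:
  assumes a: "a \<in> S4" "b \<in> S4" and eq: "K a a = K b b"
  shows "cmod (K a b) \<le> Re (K a a)"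
proof -
  let ?s = "\<lambda>a. \<Sum>c\<in>S4. (cmod (K a c))\<^sup>2"
  have d2: "(real d)\<^sup>2 > 0" using d_pos by simp
  have Ka: "Re (K a a) = ?s a / (real d)\<^sup>2" and Kb: "Re (K b b) = ?s b / (real d)\<^sup>2"
    using arg_cong[OF K_diag[OF a(1)], of Re] arg_cong[OF K_diag[OF a(2)], of Re] by (simp_all only: Re_complex_of_real)
  have sa: "?s a = (real d)\<^sup>2 * Re (K a a)" unfolding Ka using d2 by simp
  have sb: "?s b = (real d)\<^sup>2 * Re (K a a)" unfolding eq Kb using d2 by simp
  have nonneg: "Re (K a a) \<ge> 0" unfolding Ka by (intro divide_nonneg_nonneg sum_nonneg) auto
  have "(real d)\<^sup>2 * cmod (K a b) = cmod (\<Sum>c\<in>S4. K a c * K c b)"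
    unfolding K_mult[OF a, symmetric] by (simp add: norm_mult norm_power)
  also have "\<dots> \<le> (\<Sum>c\<in>S4. cmod (K a c) * cmod (K b c))"
    by (rule order_trans[OF norm_sum]) (simp add: norm_mult K_herm[OF a(2)])
  finally have "((real d)\<^sup>2 * cmod (K a b))\<^sup>2 \<le> (\<Sum>c\<in>S4. cmod (K a c) * cmod (K b c))\<^sup>2"
    by (intro power_mono) auto
  also have "\<dots> \<le> ?s a * ?s b" by (rule Cauchy_Schwarz_ineq_sum)
  also have "\<dots> = ((real d)\<^sup>2 * Re (K a a))\<^sup>2" unfolding sa sb by (simp add: power2_eq_square)
  finally have "(real d)\<^sup>2 * cmod (K a b) \<le> (real d)\<^sup>2 * Re (K a a)"
    by (rule power2_le_imp_le) (use nonneg in auto)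
  thus ?thesis using d2 by simp
qed

lemma perm_form_same:
  "Y \<in> CM \<Longrightarrow> perm_form Y Y Y Y = tr Y ^ 4 + 6 * (tr Y ^ 2 * tr (Y * Y)) + 3 * tr (Y * Y) ^ 2
     + 8 * (tr Y * tr (Y * (Y * Y))) + 6 * tr (Y * (Y * (Y * Y)))"
  unfolding perm_form_def by (simp add: power2_eq_square power4_eq_xxxx algebra_simps)

text \<open>In the eigenbasis \<open>W\<close> times the diagonal matrix has entries
  \<open>w W i j * g j\<close>. Every permutation visits each of the four columns once, so the
  product of eigenvalues factors out and only entries of the fourfold power of \<open>W\<close>
  remain.\<close>

lemma perm_form_mult_spec:
  assumes W: "W \<in> PP"
  shows "perm_form (W * spec g) (W * spec g) (W * spec g) (W * spec g) =
    (\<Sum>(i,j,k,m)\<in>S4. g i * g j * g k * g m *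
      cycle_sum (ww W) i j k m)"
proof -
  define Y where "Y = (U' * (W * U)) * diag_of d g"
  define y where "y i j = w W i j * g j" for i j
  have Y: "Y \<in> CM" unfolding Y_def using W by simp
  have yY: "Y $$ (i, j) = y i j" if "i < d" "j < d" for i j
    unfolding Y_def y_def w_def using W that by (intro mult_diag_of_index) auto
  have eq: "W * spec g = U * (Y * U')" unfolding spec_def Y_def using W by simp
  have cm: "(U * (A * U')) * (U * (B * U')) = U * ((A * B) * U')" if "A \<in> CM" "B \<in> CM" for A B
    using that by simp
  have "perm_form (W * spec g) (W * spec g) (W * spec g) (W * spec g) = perm_form Y Y Y Y"
    unfolding perm_form_def eq using Y by (simp only: cm mtrace_conj_U mult_CM U_CM U'_CM)
  moreover have t1: "tr Y = (\<Sum>i<d. y i i)" unfolding mtrace_carrier[OF Y] by (simp add: yY)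
  have t2: "tr (Y * Y) = (\<Sum>i<d. \<Sum>j<d. y i j * y j i)" unfolding mtrace_mult[OF Y Y] by (simp add: yY)
  have t3: "tr (Y * (Y * Y)) = (\<Sum>i<d. \<Sum>j<d. \<Sum>k<d. y i j * (y j k * y k i))"
    unfolding mtrace_mult3[OF Y Y Y] by (simp add: yY)
  have t4: "tr (Y * (Y * (Y * Y))) = (\<Sum>i<d. \<Sum>j<d. \<Sum>k<d. \<Sum>m<d. y i j * (y j k * (y k m * y m i)))"
    unfolding mtrace_mult4[OF Y Y Y Y] by (simp add: yY)
  have p1: "tr Y ^ 4 = (\<Sum>(i,j,k,m)\<in>S4. y i i * y j j * y k k * y m m)"
    unfolding t1 power4_eq_xxxx by (rule prod_sum_S4)
  have p2: "tr Y ^ 2 * tr (Y * Y) = (\<Sum>(i,j,k,m)\<in>S4. y i i * y j j * (y k m * y m k))"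
    unfolding t1 t2 sum_S4 power2_eq_square by (simp add: mult.assoc flip: sum_distrib_left sum_distrib_right)
  have p3: "tr (Y * Y) ^ 2 = (\<Sum>(i,j,k,m)\<in>S4. (y i j * y j i) * (y k m * y m k))"
    unfolding t2 sum_S4 power2_eq_square prod.case by (rule sum_sum_product)
  have p4: "tr Y * tr (Y * (Y * Y)) = (\<Sum>(i,j,k,m)\<in>S4. y i i * (y j k * (y k m * y m j)))"
    unfolding t1 t3 sum_S4 prod.case unfolding sum_distrib_right unfolding sum_distrib_left ..
  have p5: "tr (Y * (Y * (Y * Y))) = (\<Sum>(i,j,k,m)\<in>S4. y i j * (y j k * (y k m * y m i)))"
    unfolding t4 sum_S4 prod.case ..
  have "perm_form Y Y Y Y = (\<Sum>(i,j,k,m)\<in>S4. y i i * y j j * y k k * y m m + 6 * (y i i * y j j * (y k m * y m k))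
    + 3 * ((y i j * y j i) * (y k m * y m k)) + 8 * (y i i * (y j k * (y k m * y m j))) + 6 * (y i j * (y j k * (y k m * y m i))))"
    unfolding perm_form_same[OF Y] p1 p2 p3 p4 p5 by (simp add: case_prod_unfold sum.distrib sum_distrib_left)
  also have "\<dots> = (\<Sum>(i,j,k,m)\<in>S4. g i * g j * g k * g m *
      cycle_sum (ww W) i j k m)"
    by (intro sum.cong refl) (auto simp: y_def ww_def cycle_sum_def algebra_simps)
  ultimately show ?thesis by simp
qed

text \<open>With \<open>Z\<close> the absolute value of the matrix with eigenvalues
  \<open>l\<close>, the left side is the sum of the fourth powers of \<open>tr (W * Z)\<close>. Two
  factors are bounded by the trace norm, since the diagonal entries of \<open>W\<close> are at most
  1 in modulus; the other two are summed by Parseval.\<close>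

lemma sum_abs_K_diag:
  "(\<Sum>(i,j,k,m)\<in>S4. \<bar>l i * l j * l k * l m\<bar> * Re (K (i,j,k,m) (i,j,k,m)))
     \<le> (\<Sum>i<d. \<bar>l i\<bar>)\<^sup>2 * (real d * (\<Sum>i<d. (l i)\<^sup>2))"
proof -
  define \<tau> where "\<tau> W = (\<Sum>i<d. Re (w W i i) * \<bar>l i\<bar>)" for W
  define Z where "Z = spec (\<lambda>i. complex_of_real \<bar>l i\<bar>)"
  have Z: "Z \<in> CM" by (simp add: Z_def)
  have wr: "of_real (Re (w W i i)) = w W i i" if "W \<in> PP" "i < d" for W i
    using w_herm[OF that(1,2,2)] by (simp add: complex_eq_iff)
  have \<tau>: "tr (W * Z) = of_real (\<tau> W)" if "W \<in> PP" for W
    unfolding Z_def \<tau>_def using that by (simp add: mtrace_mult_spec wr)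
  have "complex_of_real (\<Sum>W\<in>PP. (\<tau> W)\<^sup>2) = (\<Sum>W\<in>PP. tr (W * Z) * tr (W * Z))"
    by (simp add: \<tau> power2_eq_square)
  also have "\<dots> = D * tr (Z * Z)" by (rule sum_trace_trace[OF Z Z])
  also have "tr (Z * Z) = of_real (\<Sum>i<d. (l i)\<^sup>2)"
    unfolding Z_def by (simp add: spec_mult mtrace_spec power2_eq_square flip: of_real_mult)
  finally have "complex_of_real (\<Sum>W\<in>PP. (\<tau> W)\<^sup>2) = of_real (real d * (\<Sum>i<d. (l i)\<^sup>2))" by simp
  hence sq: "(\<Sum>W\<in>PP. (\<tau> W)\<^sup>2) = real d * (\<Sum>i<d. (l i)\<^sup>2)" by (rule of_real_eq_iff[THEN iffD1])
  have bound: "\<bar>\<tau> W\<bar> \<le> (\<Sum>i<d. \<bar>l i\<bar>)" if W: "W \<in> PP" for W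
  proof -
    have "\<bar>\<tau> W\<bar> \<le> (\<Sum>i<d. \<bar>Re (w W i i) * \<bar>l i\<bar>\<bar>)" unfolding \<tau>_def by (rule sum_abs)
    also have "\<dots> \<le> (\<Sum>i<d. \<bar>l i\<bar>)"
    proof (rule sum_mono)
      fix i assume "i \<in> {..<d}"
      hence "\<bar>Re (w W i i)\<bar> \<le> 1" using w_diag_bound[OF W, of i] abs_Re_le_cmod[of "w W i i"] by simp
      thus "\<bar>Re (w W i i) * \<bar>l i\<bar>\<bar> \<le> \<bar>l i\<bar>" by (simp add: abs_mult mult_left_le_one_le)
    qed
    finally show ?thesis .
  qed
  have "(\<Sum>(i,j,k,m)\<in>S4. \<bar>l i * l j * l k * l m\<bar> * Re (K (i,j,k,m) (i,j,k,m))) = (\<Sum>W\<in>PP. (\<tau> W) ^ 4)"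
  proof -
    have Kd: "Re (K (i,j,k,m) (i,j,k,m)) = (\<Sum>W\<in>PP. Re (w W i i) * Re (w W j j) * Re (w W k k) * Re (w W m m))"
      if "i < d" "j < d" "k < d" "m < d" for i j k m
    proof -
      have "K (i,j,k,m) (i,j,k,m) = (\<Sum>W\<in>PP. of_real (Re (w W i i) * Re (w W j j) * Re (w W k k) * Re (w W m m)))"
        unfolding K_def ww_def using that by (intro sum.cong refl) (simp add: wr)
      thus ?thesis by (simp only: Re_sum Re_complex_of_real)
    qed
    have "(\<Sum>W\<in>PP. (\<tau> W) ^ 4) = (\<Sum>W\<in>PP. \<Sum>(i,j,k,m)\<in>S4. (Re (w W i i) * \<bar>l i\<bar>) * (Re (w W j j) * \<bar>l j\<bar>) * (Re (w W k k) * \<bar>l k\<bar>) * (Re (w W m m) * \<bar>l m\<bar>))"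
      unfolding \<tau>_def power4_eq_xxxx prod_sum_S4 ..
    also have "\<dots> = (\<Sum>a\<in>S4. \<Sum>W\<in>PP. case a of (i,j,k,m) \<Rightarrow> (Re (w W i i) * \<bar>l i\<bar>) * (Re (w W j j) * \<bar>l j\<bar>) * (Re (w W k k) * \<bar>l k\<bar>) * (Re (w W m m) * \<bar>l m\<bar>))"
      by (rule sum.swap)
    also have "\<dots> = (\<Sum>(i,j,k,m)\<in>S4. \<bar>l i * l j * l k * l m\<bar> * Re (K (i,j,k,m) (i,j,k,m)))"
      by (intro sum.cong refl) (auto simp: S4_def Kd abs_mult sum_distrib_left mult_ac)
    finally show ?thesis ..
  qed
  also have "\<dots> \<le> (\<Sum>W\<in>PP. (\<Sum>i<d. \<bar>l i\<bar>)\<^sup>2 * (\<tau> W)\<^sup>2)"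
  proof (rule sum_mono)
    fix W assume "W \<in> PP"
    hence "(\<tau> W)\<^sup>2 \<le> (\<Sum>i<d. \<bar>l i\<bar>)\<^sup>2" using power_mono[OF bound, of W 2] by simp
    hence "(\<tau> W)\<^sup>2 * (\<tau> W)\<^sup>2 \<le> (\<Sum>i<d. \<bar>l i\<bar>)\<^sup>2 * (\<tau> W)\<^sup>2" by (intro mult_right_mono) auto
    thus "(\<tau> W) ^ 4 \<le> (\<Sum>i<d. \<bar>l i\<bar>)\<^sup>2 * (\<tau> W)\<^sup>2" by (simp add: power4_eq_xxxx power2_eq_square mult.assoc)
  qed
  also have "\<dots> = (\<Sum>i<d. \<bar>l i\<bar>)\<^sup>2 * (real d * (\<Sum>i<d. (l i)\<^sup>2))" by (simp add: sq flip: sum_distrib_left)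
  finally show ?thesis .
qed

text \<open>Permuting the four indices of both arguments leaves \<open>K\<close> unchanged, so all
  diagonal entries along a permutation orbit agree and \<open>K_bound\<close> applies to each cycle
  type. The coefficients 1, 6, 3, 8, 6 add up to 24.\<close>

lemma pauli_form_spec_bound:
  fixes l :: "nat \<Rightarrow> real"
  defines "X \<equiv> spec (\<lambda>i. complex_of_real (l i))"
  shows "cmod (pauli_form X X X X) \<le> 24 * (\<Sum>i<d. \<bar>l i\<bar>)\<^sup>2 * (\<Sum>i<d. (l i)\<^sup>2) / real d"
proof -
  let ?L = "\<lambda>i j k m. complex_of_real (l i * l j * l k * l m)"
  let ?Q = "cycle_sum K"
  have "D\<^sup>2 * pauli_form X X X X = (\<Sum>W\<in>PP. perm_form (W * X) (W * X) (W * X) (W * X))" by (simp add: pauli_form_def)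
  also have "\<dots> = (\<Sum>W\<in>PP. \<Sum>a\<in>S4. case a of (i,j,k,m) \<Rightarrow> ?L i j k m *
      cycle_sum (ww W) i j k m)"
    unfolding X_def by (intro sum.cong refl) (simp add: perm_form_mult_spec)
  also have "\<dots> = (\<Sum>(i,j,k,m)\<in>S4. ?L i j k m * ?Q i j k m)"
    unfolding K_def cycle_sum_def
    by (subst sum.swap) (auto intro!: sum.cong simp: sum_distrib_left sum.distrib distrib_left)
  finally have eq: "D\<^sup>2 * pauli_form X X X X = (\<Sum>(i,j,k,m)\<in>S4. ?L i j k m * ?Q i j k m)" .
  have Q: "cmod (?Q i j k m) \<le> 24 * Re (K (i,j,k,m) (i,j,k,m))" if "(i,j,k,m) \<in> S4" for i j k m
  proof -
    let ?r = "Re (K (i,j,k,m) (i,j,k,m))"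
    have perm: "cmod (K (i,j,k,m) b) \<le> ?r" if "b \<in> {(i,j,k,m), (i,j,m,k), (j,i,m,k), (i,k,m,j), (j,k,m,i)}" for b
    proof (rule K_bound)
      show "b \<in> S4" using that \<open>(i,j,k,m) \<in> S4\<close> by (auto simp: S4_def)
      show "K (i,j,k,m) (i,j,k,m) = K b b" using that by (auto simp: K_def ww_def mult_ac)
    qed fact
    have "cmod (?Q i j k m) \<le> cmod (K (i,j,k,m) (i,j,k,m)) + cmod (6 * K (i,j,k,m) (i,j,m,k)) + cmod (3 * K (i,j,k,m) (j,i,m,k))
       + cmod (8 * K (i,j,k,m) (i,k,m,j)) + cmod (6 * K (i,j,k,m) (j,k,m,i))"
      unfolding cycle_sum_def by (intro norm_triangle_mono order_refl)
    also have "\<dots> \<le> ?r + 6 * ?r + 3 * ?r + 8 * ?r + 6 * ?r"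
      unfolding norm_mult by (intro add_mono mult_mono perm) auto
    finally show ?thesis by simp
  qed
  have "(real d)\<^sup>2 * cmod (pauli_form X X X X) = cmod (D\<^sup>2 * pauli_form X X X X)" by (simp add: norm_mult norm_power)
  also have "\<dots> \<le> (\<Sum>(i,j,k,m)\<in>S4. \<bar>l i * l j * l k * l m\<bar> * (24 * Re (K (i,j,k,m) (i,j,k,m))))"
    unfolding eq
  proof (rule sum_norm_le)
    fix a assume a: "a \<in> S4"
    obtain i j k m where aa: "a = (i,j,k,m)" by (metis surj_pair)
    show "cmod (case a of (i,j,k,m) \<Rightarrow> ?L i j k m * ?Q i j k m) \<le>
      (case a of (i,j,k,m) \<Rightarrow> \<bar>l i * l j * l k * l m\<bar> * (24 * Re (K (i,j,k,m) (i,j,k,m))))"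
      unfolding aa prod.case norm_mult norm_of_real using Q[of i j k m] a aa
      by (intro mult_left_mono) auto
  qed
  also have "\<dots> = 24 * (\<Sum>(i,j,k,m)\<in>S4. \<bar>l i * l j * l k * l m\<bar> * Re (K (i,j,k,m) (i,j,k,m)))"
    by (simp add: sum_distrib_left case_prod_unfold mult_ac)
  also have "\<dots> \<le> 24 * ((\<Sum>i<d. \<bar>l i\<bar>)\<^sup>2 * (real d * (\<Sum>i<d. (l i)\<^sup>2)))"
    by (intro mult_left_mono sum_abs_K_diag) auto
  finally show ?thesis using d_pos by (simp add: field_simps power2_eq_square)
qed

lemma perm_form_spec:
  "perm_form (spec g) (spec g) (spec g) (spec g) = (\<Sum>i<d. g i) ^ 4 + 6 * ((\<Sum>i<d. g i)\<^sup>2 * (\<Sum>i<d. g i ^ 2))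
     + 3 * (\<Sum>i<d. g i ^ 2)\<^sup>2 + 8 * ((\<Sum>i<d. g i) * (\<Sum>i<d. g i ^ 3)) + 6 * (\<Sum>i<d. g i ^ 4)"
  by (simp add: perm_form_same spec_mult mtrace_spec power2_eq_square power3_eq_cube power4_eq_xxxx mult.assoc)

end

section \<open>Pauli operators\<close>

lemma sum_div_mod:
  fixes f :: "nat \<Rightarrow> nat \<Rightarrow> 'a :: comm_monoid_add"
  assumes "b > 0"
  shows "(\<Sum>k<a * b. f (k div b) (k mod b)) = (\<Sum>p<a. \<Sum>q<b. f p q)"
proof -
  have "(\<Sum>k<a * b. f (k div b) (k mod b)) = (\<Sum>(p, q)\<in>{..<a} \<times> {..<b}. f p q)"
  proof (rule sum.reindex_bij_witness[where i = "\<lambda>(p, q). p * b + q" and j = "\<lambda>k. (k div b, k mod b)"])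
    fix x assume "x \<in> {..<a} \<times> {..<b}"
    then obtain p q where x: "x = (p, q)" "p < a" "q < b" by auto
    have "p * b + q < p * b + b" using x by simp
    also have "\<dots> = Suc p * b" by simp
    also have "\<dots> \<le> a * b" using x by (intro mult_right_mono) auto
    finally show "(case x of (p, q) \<Rightarrow> p * b + q) \<in> {..<a * b}" using x by simp
    show "((case x of (p, q) \<Rightarrow> p * b + q) div b, (case x of (p, q) \<Rightarrow> p * b + q) mod b) = x"
      using x assms by simp
  qed (use assms in \<open>auto simp: less_mult_imp_div_less\<close>)
  thus ?thesis by (simp add: sum.cartesian_product)
qed

lemma kron_carrier [simp]:
  "A \<in> carrier_mat a a \<Longrightarrow> B \<in> carrier_mat b b \<Longrightarrow> kron A B \<in> carrier_mat (a * b) (a * b)"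
  by (auto simp: kron_def)

lemma kron_index:
  "A \<in> carrier_mat a a \<Longrightarrow> B \<in> carrier_mat b b \<Longrightarrow> i < a * b \<Longrightarrow> j < a * b \<Longrightarrow>
    kron A B $$ (i, j) = A $$ (i div b, j div b) * B $$ (i mod b, j mod b)"
  by (auto simp: kron_def)

lemma kron_mult:
  assumes A: "A \<in> carrier_mat a a" "C \<in> carrier_mat a a" and B: "B \<in> carrier_mat b b" "E \<in> carrier_mat b b" and b: "b > 0"
  shows "kron A B * kron C E = kron (A * C) (B * E)"
proof (rule eq_matI)
  fix i j assume "i < dim_row (kron (A * C) (B * E))" "j < dim_col (kron (A * C) (B * E))"
  hence ij: "i < a * b" "j < a * b" using A B by (auto simp: kron_def)
  hence ij': "i div b < a" "j div b < a" "i mod b < b" "j mod b < b" using b by (auto simp: less_mult_imp_div_less)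
  have "(kron A B * kron C E) $$ (i, j) = (\<Sum>k<a * b. kron A B $$ (i, k) * kron C E $$ (k, j))"
    using A B ij by (intro mult_mat_index) auto
  also have "\<dots> = (\<Sum>k<a * b. (A $$ (i div b, k div b) * C $$ (k div b, j div b)) * (B $$ (i mod b, k mod b) * E $$ (k mod b, j mod b)))"
    using A B ij by (intro sum.cong refl) (simp add: kron_index)
  also have "\<dots> = (\<Sum>p<a. \<Sum>q<b. (A $$ (i div b, p) * C $$ (p, j div b)) * (B $$ (i mod b, q) * E $$ (q, j mod b)))"
    by (rule sum_div_mod[OF b])
  also have "\<dots> = (\<Sum>p<a. A $$ (i div b, p) * C $$ (p, j div b)) * (\<Sum>q<b. B $$ (i mod b, q) * E $$ (q, j mod b))"
    by (simp only: sum_product)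
  also have "\<dots> = (A * C) $$ (i div b, j div b) * (B * E) $$ (i mod b, j mod b)"
    using A B ij' by (simp only: mult_mat_index)
  also have "\<dots> = kron (A * C) (B * E) $$ (i, j)"
    using A B ij by (intro kron_index[symmetric]) auto
  finally show "(kron A B * kron C E) $$ (i, j) = kron (A * C) (B * E) $$ (i, j)" .
qed (use A B in \<open>auto simp: kron_def\<close>)

lemma kron_adjoint:
  assumes A: "A \<in> carrier_mat a a" and B: "B \<in> carrier_mat b b" and b: "b > 0"
  shows "mat_adjoint (kron A B) = kron (mat_adjoint A) (mat_adjoint B)"
proof (rule eq_matI)
  fix i j assume "i < dim_row (kron (mat_adjoint A) (mat_adjoint B))" "j < dim_col (kron (mat_adjoint A) (mat_adjoint B))"
  hence ij: "i < a * b" "j < a * b" using A B by (auto simp: kron_def)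
  hence ij': "i div b < a" "j div b < a" "i mod b < b" "j mod b < b" using b by (auto simp: less_mult_imp_div_less)
  have "mat_adjoint (kron A B) $$ (i, j) = cnj (kron A B $$ (j, i))"
    using ij carrier_matD[OF kron_carrier[OF A B]] by (intro mat_adjoint_index) auto
  also have "\<dots> = kron (mat_adjoint A) (mat_adjoint B) $$ (i, j)"
    using A B ij ij' by (subst (1 2) kron_index) auto
  finally show "mat_adjoint (kron A B) $$ (i, j) = kron (mat_adjoint A) (mat_adjoint B) $$ (i, j)" .
qed (use A B in \<open>auto simp: kron_def\<close>)

lemma kron_smult: "kron (c \<cdot>\<^sub>m A) (e \<cdot>\<^sub>m B) = (c * e) \<cdot>\<^sub>m kron A B" if "A \<in> carrier_mat a a" "B \<in> carrier_mat b b" "b > 0"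
  using that by (intro eq_matI) (auto simp: kron_def less_mult_imp_div_less)

lemma kron_one: "b > 0 \<Longrightarrow> kron (1\<^sub>m a) (1\<^sub>m b) = 1\<^sub>m (a * b)"
proof (rule eq_matI)
  assume b: "b > 0"
  fix i j assume "i < dim_row (1\<^sub>m (a * b) :: complex mat)" "j < dim_col (1\<^sub>m (a * b) :: complex mat)"
  hence ij: "i < a * b" "j < a * b" by auto
  have "i = j \<longleftrightarrow> i div b = j div b \<and> i mod b = j mod b" by (metis div_mult_mod_eq)
  thus "kron (1\<^sub>m a) (1\<^sub>m b) $$ (i, j) = 1\<^sub>m (a * b) $$ (i, j)"
    using ij b by (auto simp: kron_def less_mult_imp_div_less)
qed (auto simp: kron_def)

lemma mtrace_kron:
  assumes A: "A \<in> carrier_mat a a" and B: "B \<in> carrier_mat b b" and b: "b > 0"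
  shows "tr (kron A B) = tr A * tr B"
proof -
  have "tr (kron A B) = (\<Sum>k<a * b. A $$ (k div b, k div b) * B $$ (k mod b, k mod b))"
    using mtrace_carrier[OF kron_carrier[OF A B]] A B by (simp add: kron_index)
  also have "\<dots> = (\<Sum>p<a. \<Sum>q<b. A $$ (p, p) * B $$ (q, q))" by (rule sum_div_mod[OF b])
  finally show ?thesis unfolding mtrace_carrier[OF A] mtrace_carrier[OF B] by (simp only: sum_product)
qed

section \<open>Single-qubit Pauli matrices\<close>

lemma pauli1_carrier [simp]: "pauli1 k \<in> carrier_mat 2 2"
  by (auto simp: pauli1_def mat_of_rows_list_def)

lemma less_2: "i < 2 \<longleftrightarrow> i = 0 \<or> i = (1::nat)"
  by auto

lemma less_4: "k < 4 \<longleftrightarrow> k = 0 \<or> k = 1 \<or> k = 2 \<or> k = (3::nat)"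
  by auto

lemma pauli1_index:
  "pauli1 k $$ (0, 0) = (if k = 1 \<or> k = 2 then 0 else 1)"
  "pauli1 k $$ (0, 1) = (if k = 1 then 1 else if k = 2 then -\<i> else 0)"
  "pauli1 k $$ (1, 0) = (if k = 1 then 1 else if k = 2 then \<i> else 0)"
  "pauli1 k $$ (1, 1) = (if k = 1 \<or> k = 2 then 0 else if k = 3 then -1 else 1)"
  by (auto simp: pauli1_def mat_of_rows_list_def)

lemmas pauli1_index_simps = pauli1_index pauli1_index[unfolded One_nat_def]
  mult_carrier_mat[OF pauli1_carrier pauli1_carrier]

lemma eq_mat2I:
  assumes "A \<in> carrier_mat 2 2" "B \<in> carrier_mat 2 2" "A $$ (0,0) = B $$ (0,0)" "A $$ (0,1) = B $$ (0,1)"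
    "A $$ (1,0) = B $$ (1,0)" "A $$ (1,1) = B $$ (1,1)"
  shows "A = B"
  using assms by (intro eq_matI) (auto simp: less_2)

lemma mult_mat2_index:
  assumes "A \<in> carrier_mat 2 2" "B \<in> carrier_mat 2 2" "i < 2" "j < 2"
  shows "(A * B) $$ (i, j) = A $$ (i, 0) * B $$ (0, j) + A $$ (i, 1) * B $$ (1, j)"
  by (subst mult_mat_index[OF assms]) (simp add: numeral_2_eq_2)

lemma pauli1_herm: "mat_adjoint (pauli1 k) = pauli1 k"
  using carrier_matD[OF pauli1_carrier[of k]] by (intro eq_mat2I) (auto simp: pauli1_index_simps)

lemma pauli1_sq: "pauli1 k * pauli1 k = 1\<^sub>m 2"
  by (intro eq_mat2I) (auto simp: mult_mat2_index[OF pauli1_carrier pauli1_carrier] pauli1_index_simps simp del: index_mult_mat(1))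

lemma pauli1_mult:
  assumes "k < 4" "l < 4"
  shows "\<exists>c\<in>{1, -1, \<i>, -\<i>}. \<exists>m<4. pauli1 k * pauli1 l = c \<cdot>\<^sub>m pauli1 m"
proof -
  \<comment> \<open>Two different indices in 1, 2, 3 multiply to the third, which is
    \<open>6 - k - l\<close>; the phase in \<open>c\<close> is given by their cyclic order.\<close>
  define m where "m = (if k = 0 then l else if l = 0 then k else if k = l then 0 else 6 - k - l)"
  define c where "c = (if k = 0 \<or> l = 0 \<or> k = l then 1 else if (k, l) \<in> {(1,2), (2,3), (3,1)} then \<i> else -\<i>)"
  have "pauli1 k * pauli1 l = c \<cdot>\<^sub>m pauli1 m"
    using assms unfolding less_4
    by (elim disjE; intro eq_mat2I) (simp_all add: m_def c_def mult_mat2_index[OF pauli1_carrier pauli1_carrier] pauli1_index_simps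
       carrier_matD[OF pauli1_carrier] del: index_mult_mat(1))
  moreover have "c \<in> {1, -1, \<i>, -\<i>}" by (auto simp: c_def)
  moreover have "m < 4" using assms unfolding less_4 by (auto simp: m_def)
  ultimately show ?thesis by blast
qed

lemma pauli1_orth:
  assumes "k < 4" "l < 4" "k \<noteq> l" shows "tr (pauli1 k * pauli1 l) = 0"
proof -
  have tr2: "tr A = A $$ (0, 0) + A $$ (1, 1)" if "A \<in> carrier_mat 2 2" for A
    unfolding mtrace_carrier[OF that] by (simp add: numeral_2_eq_2)
  have "tr (pauli1 k * pauli1 l) = (pauli1 k * pauli1 l) $$ (0, 0) + (pauli1 k * pauli1 l) $$ (1, 1)"
    by (rule tr2[OF mult_carrier_mat[OF pauli1_carrier pauli1_carrier]])
  thus ?thesis using assms unfolding less_4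
    by (elim disjE) (simp_all add: mult_mat2_index[OF pauli1_carrier pauli1_carrier] pauli1_index_simps del: index_mult_mat(1))
qed

lemma pauli1_complete:
  assumes "i < 2" "j < 2" "k < 2" "l < 2"
  shows "(\<Sum>q\<in>{0..<4}. pauli1 q $$ (i, j) * pauli1 q $$ (k, l)) = (if i = l \<and> j = k then 2 else 0)"
proof -
  have "{0..<4} = {0, 1, 2, 3::nat}" by auto
  thus ?thesis using assms unfolding less_2 by (elim disjE) (simp_all add: pauli1_index_simps)
qed

section \<open>Tensor products of Pauli matrices\<close>

lemma pauli_op_Nil: "pauli_op [] = 1\<^sub>m 1"
  by (simp add: pauli_op_def)

lemma pauli_op_Cons: "pauli_op (k # ks) = kron (pauli1 k) (pauli_op ks)"
  by (simp add: pauli_op_def)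

lemma pauli_op_carrier [simp]: "length ks = n \<Longrightarrow> pauli_op ks \<in> carrier_mat (2 ^ n) (2 ^ n)"
  by (induction ks arbitrary: n) (auto simp: pauli_op_Nil pauli_op_Cons)

lemma pauli_indices_0: "pauli_indices 0 = {[]}"
  by (auto simp: pauli_indices_def)

lemma pauli_indices_Suc: "pauli_indices (Suc n) = (\<lambda>(k, ks). k # ks) ` ({0..<4} \<times> pauli_indices n)"
  by (auto simp: pauli_indices_def length_Suc_conv image_iff)

lemma finite_pauli_indices [simp]: "finite (pauli_indices n)"
  by (induction n) (auto simp: pauli_indices_0 pauli_indices_Suc)

lemma pauli_indices_length: "ks \<in> pauli_indices n \<Longrightarrow> length ks = n"
  by (simp add: pauli_indices_def)

lemma pauli_op_herm: "mat_adjoint (pauli_op ks) = pauli_op ks"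
  by (induction ks) (simp_all add: pauli_op_Nil pauli_op_Cons kron_adjoint[OF pauli1_carrier pauli_op_carrier[OF refl]] pauli1_herm)

lemma pauli_op_sq: "pauli_op ks * pauli_op ks = 1\<^sub>m (2 ^ length ks)"
  by (induction ks) (simp_all add: pauli_op_Nil pauli_op_Cons pauli1_sq kron_one
      kron_mult[OF pauli1_carrier pauli1_carrier pauli_op_carrier[OF refl] pauli_op_carrier[OF refl]])

lemma pauli_op_Cons_mult:
  assumes "ks \<in> pauli_indices n" "ls \<in> pauli_indices n"
  shows "pauli_op (k # ks) * pauli_op (l # ls) = kron (pauli1 k * pauli1 l) (pauli_op ks * pauli_op ls)"
  unfolding pauli_op_Cons
  by (rule kron_mult[OF pauli1_carrier pauli1_carrier, of _ "2 ^ n"]) (use assms pauli_indices_length in auto)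

lemma pauli_op_mult:
  "ks \<in> pauli_indices n \<Longrightarrow> ls \<in> pauli_indices n \<Longrightarrow>
    \<exists>c\<in>{1, -1, \<i>, -\<i>}. \<exists>ms\<in>pauli_indices n. pauli_op ks * pauli_op ls = c \<cdot>\<^sub>m pauli_op ms"
proof (induction n arbitrary: ks ls)
  case 0
  thus ?case by (auto simp: pauli_indices_0 pauli_op_Nil)
next
  case (Suc n)
  obtain k ks' where k: "ks = k # ks'" "k < 4" "ks' \<in> pauli_indices n" using Suc.prems by (auto simp: pauli_indices_Suc)
  obtain l ls' where l: "ls = l # ls'" "l < 4" "ls' \<in> pauli_indices n" using Suc.prems by (auto simp: pauli_indices_Suc)
  obtain c m where c: "c \<in> {1, -1, \<i>, -\<i>}" "m < 4" "pauli1 k * pauli1 l = c \<cdot>\<^sub>m pauli1 m"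
    using pauli1_mult k l by blast
  obtain e ms where e: "e \<in> {1, -1, \<i>, -\<i>}" "ms \<in> pauli_indices n" "pauli_op ks' * pauli_op ls' = e \<cdot>\<^sub>m pauli_op ms"
    using Suc.IH k l by blast
  have "pauli_op ks * pauli_op ls = kron (pauli1 k * pauli1 l) (pauli_op ks' * pauli_op ls')"
    unfolding k l using k(3) l(3) by (rule pauli_op_Cons_mult)
  also have "\<dots> = (c * e) \<cdot>\<^sub>m pauli_op (m # ms)"
    unfolding c e pauli_op_Cons by (rule kron_smult[OF pauli1_carrier pauli_op_carrier[OF pauli_indices_length[OF e(2)]]]) auto
  finally have "pauli_op ks * pauli_op ls = (c * e) \<cdot>\<^sub>m pauli_op (m # ms)" .
  moreover have "c * e \<in> {1, -1, \<i>, -\<i>}" using c(1) e(1) by auto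
  moreover have "m # ms \<in> pauli_indices (Suc n)" using c e by (auto simp: pauli_indices_Suc)
  ultimately show ?case by blast
qed

lemma pauli_op_orth:
  "ks \<in> pauli_indices n \<Longrightarrow> ls \<in> pauli_indices n \<Longrightarrow> ks \<noteq> ls \<Longrightarrow> tr (pauli_op ks * pauli_op ls) = 0"
proof (induction n arbitrary: ks ls)
  case 0
  thus ?case by (auto simp: pauli_indices_0)
next
  case (Suc n)
  obtain k ks' where k: "ks = k # ks'" "k < 4" "ks' \<in> pauli_indices n" using Suc.prems by (auto simp: pauli_indices_Suc)
  obtain l ls' where l: "ls = l # ls'" "l < 4" "ls' \<in> pauli_indices n" using Suc.prems by (auto simp: pauli_indices_Suc)
  have "pauli_op ks * pauli_op ls = kron (pauli1 k * pauli1 l) (pauli_op ks' * pauli_op ls')"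
    unfolding k l using k(3) l(3) by (rule pauli_op_Cons_mult)
  hence "tr (pauli_op ks * pauli_op ls) = tr (pauli1 k * pauli1 l) * tr (pauli_op ks' * pauli_op ls')"
    using mtrace_kron[OF mult_carrier_mat[OF pauli1_carrier pauli1_carrier] mult_carrier_mat,
      OF pauli_op_carrier pauli_op_carrier, OF pauli_indices_length pauli_indices_length, OF k(3) l(3)] by simp
  moreover have "k \<noteq> l \<or> ks' \<noteq> ls'" using Suc.prems(3) k l by auto
  ultimately show ?case using pauli1_orth[OF k(2) l(2)] Suc.IH[OF k(3) l(3)] by auto
qed

text \<open>Entries of a Kronecker product factor through quotient and remainder of the indices, so
  the sum over index lists is the single-qubit sum times the sum for one qubit less.\<close>

lemma pauli_op_complete:
  "i < 2 ^ n \<Longrightarrow> j < 2 ^ n \<Longrightarrow> k < 2 ^ n \<Longrightarrow> l < 2 ^ n \<Longrightarrow>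
    (\<Sum>ks\<in>pauli_indices n. pauli_op ks $$ (i, j) * pauli_op ks $$ (k, l)) = (if i = l \<and> j = k then 2 ^ n else 0)"
proof (induction n arbitrary: i j k l)
  case 0
  thus ?case by (simp add: pauli_indices_0 pauli_op_Nil)
next
  case (Suc n)
  let ?b = "2 ^ n :: nat"
  have lt: "x div ?b < 2" "x mod ?b < ?b" if "x < 2 ^ Suc n" for x
    using that by (auto simp: less_mult_imp_div_less)
  have op: "pauli_op (q # ks) $$ (x, y) = pauli1 q $$ (x div ?b, y div ?b) * pauli_op ks $$ (x mod ?b, y mod ?b)"
    if "x < 2 ^ Suc n" "y < 2 ^ Suc n" "ks \<in> pauli_indices n" for x y q ks
    unfolding pauli_op_Cons using that by (intro kron_index pauli1_carrier pauli_op_carrier pauli_indices_length) auto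
  have "(\<Sum>ks\<in>pauli_indices (Suc n). pauli_op ks $$ (i, j) * pauli_op ks $$ (k, l)) =
    (\<Sum>(q, ks)\<in>{0..<4} \<times> pauli_indices n. pauli_op (q # ks) $$ (i, j) * pauli_op (q # ks) $$ (k, l))"
    unfolding pauli_indices_Suc by (subst sum.reindex) (auto simp: inj_on_def case_prod_unfold)
  also have "\<dots> = (\<Sum>q\<in>{0..<4}. \<Sum>ks\<in>pauli_indices n. (pauli1 q $$ (i div ?b, j div ?b) * pauli1 q $$ (k div ?b, l div ?b)) *
     (pauli_op ks $$ (i mod ?b, j mod ?b) * pauli_op ks $$ (k mod ?b, l mod ?b)))"
    unfolding sum.cartesian_product[symmetric] using Suc.prems
    by (intro sum.cong refl) (simp add: op del: power_Suc)
  also have "\<dots> = (if i div ?b = l div ?b \<and> j div ?b = k div ?b then 2 else 0) * (if i mod ?b = l mod ?b \<and> j mod ?b = k mod ?b then 2 ^ n else 0)"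
    using Suc.prems lt by (simp only: sum_product[symmetric] pauli1_complete Suc.IH)
  also have "\<dots> = (if i = l \<and> j = k then 2 ^ Suc n else 0)"
  proof -
    have "x = y \<longleftrightarrow> x div ?b = y div ?b \<and> x mod ?b = y mod ?b" for x y by (metis div_mult_mod_eq)
    from this[of i l] this[of j k] show ?thesis by auto
  qed
  finally show ?case .
qed

lemma pauli_op_inj: "inj_on pauli_op (pauli_indices n)"
proof (rule inj_onI, rule ccontr)
  fix ks ls assume ks: "ks \<in> pauli_indices n" "ls \<in> pauli_indices n" "pauli_op ks = pauli_op ls" "ks \<noteq> ls"
  have "tr (pauli_op ks * pauli_op ks) = 0" using pauli_op_orth[OF ks(1,2,4)] ks(3) by simp
  thus False by (simp add: pauli_op_sq mtrace_one)
qed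

lemma pauli_basis_pauli_ops: "pauli_basis (2 ^ n) (pauli_ops n)"
proof
  show "1\<^sub>m (2 ^ n) \<in> pauli_ops n"
  proof -
    have "pauli_op (replicate n 0) = 1\<^sub>m (2 ^ n)"
      by (induction n) (auto simp: pauli_op_Nil pauli_op_Cons pauli1_def kron_one)
    moreover have "replicate n 0 \<in> pauli_indices n" by (auto simp: pauli_indices_def)
    ultimately show ?thesis by (force simp: pauli_ops_def)
  qed
  show "pauli_ops n \<subseteq> carrier_mat (2 ^ n) (2 ^ n)"
    by (auto simp: pauli_ops_def dest!: pauli_indices_length)
  show "mat_adjoint W = W" if "W \<in> pauli_ops n" for W using that by (auto simp: pauli_ops_def pauli_op_herm)
  show "W * W = 1\<^sub>m (2 ^ n)" if "W \<in> pauli_ops n" for W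
    using that by (auto simp: pauli_ops_def pauli_op_sq dest!: pauli_indices_length)
  show "\<exists>c\<in>{1, -1, \<i>, -\<i>}. \<exists>C\<in>pauli_ops n. A * B = c \<cdot>\<^sub>m C" if "A \<in> pauli_ops n" "B \<in> pauli_ops n" for A B
    using that pauli_op_mult unfolding pauli_ops_def by blast
  show "tr (A * B) = 0" if "A \<in> pauli_ops n" "B \<in> pauli_ops n" "A \<noteq> B" for A B
    using that pauli_op_orth unfolding pauli_ops_def by blast
  show "(\<Sum>W\<in>pauli_ops n. W $$ (i, j) * W $$ (k, l)) = (if i = l \<and> j = k then of_nat (2 ^ n) else 0)"
    if "i < 2 ^ n" "j < 2 ^ n" "k < 2 ^ n" "l < 2 ^ n" for i j k l
    unfolding pauli_ops_def using pauli_op_complete[OF that] by (simp add: sum.reindex[OF pauli_op_inj])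
qed (auto simp: pauli_ops_def)

section \<open>The moment inequality\<close>

text \<open>Cauchy-Schwarz twice, with the third absolute moment in between:
  \<open>s2^2 <= s1 s3\<close> and \<open>s3^2 <= s2 s4\<close>. Squaring the first, inserting the
  second and dividing by \<open>s2\<close> eliminates \<open>s3\<close>.\<close>

lemma moment_interpolation:
  fixes f :: "'a \<Rightarrow> real"
  assumes "finite A"
  shows "(\<Sum>x\<in>A. (f x)\<^sup>2) ^ 3 \<le> (\<Sum>x\<in>A. \<bar>f x\<bar>)\<^sup>2 * (\<Sum>x\<in>A. f x ^ 4)"
proof -
  define s1 s2 s3 s4 where "s1 = (\<Sum>x\<in>A. \<bar>f x\<bar>)" "s2 = (\<Sum>x\<in>A. (f x)\<^sup>2)" "s3 = (\<Sum>x\<in>A. \<bar>f x\<bar> ^ 3)" "s4 = (\<Sum>x\<in>A. f x ^ 4)"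
  note s = this
  have nonneg: "s1 \<ge> 0" "s2 \<ge> 0" "s3 \<ge> 0" "s4 \<ge> 0" unfolding s by (auto intro: sum_nonneg)
  have "(\<Sum>x\<in>A. sqrt \<bar>f x\<bar> * (sqrt \<bar>f x\<bar> * \<bar>f x\<bar>))\<^sup>2 \<le> (\<Sum>x\<in>A. (sqrt \<bar>f x\<bar>)\<^sup>2) * (\<Sum>x\<in>A. (sqrt \<bar>f x\<bar> * \<bar>f x\<bar>)\<^sup>2)"
    by (rule Cauchy_Schwarz_ineq_sum)
  moreover have "sqrt \<bar>f x\<bar> * (sqrt \<bar>f x\<bar> * \<bar>f x\<bar>) = (f x)\<^sup>2" for x
    by (simp add: power2_eq_square flip: mult.assoc)
  moreover have "(sqrt \<bar>f x\<bar> * \<bar>f x\<bar>)\<^sup>2 = \<bar>f x\<bar> ^ 3" for x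
    by (simp only: power_mult_distrib real_sqrt_pow2 abs_ge_zero power3_eq_cube power2_eq_square[of "\<bar>f x\<bar>"] mult.assoc)
  ultimately have a: "s2\<^sup>2 \<le> s1 * s3" unfolding s by simp
  have "(\<Sum>x\<in>A. \<bar>f x\<bar> * (f x)\<^sup>2)\<^sup>2 \<le> (\<Sum>x\<in>A. \<bar>f x\<bar>\<^sup>2) * (\<Sum>x\<in>A. ((f x)\<^sup>2)\<^sup>2)"
    by (rule Cauchy_Schwarz_ineq_sum)
  moreover have "\<bar>f x\<bar> * (f x)\<^sup>2 = \<bar>f x\<bar> ^ 3" for x by (simp add: power3_eq_cube power2_eq_square flip: abs_mult)
  ultimately have b: "s3\<^sup>2 \<le> s2 * s4" unfolding s by (simp flip: power_mult)
  have "s2 * s2 ^ 3 = (s2\<^sup>2)\<^sup>2" by (simp add: power2_eq_square power3_eq_cube)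
  also have "\<dots> \<le> (s1 * s3)\<^sup>2" using a by (intro power_mono) auto
  also have "\<dots> = s1\<^sup>2 * s3\<^sup>2" by (simp add: power_mult_distrib)
  also have "\<dots> \<le> s1\<^sup>2 * (s2 * s4)" using b by (intro mult_left_mono) auto
  finally have "s2 * s2 ^ 3 \<le> s2 * (s1\<^sup>2 * s4)" by (simp add: mult_ac)
  hence "s2 ^ 3 \<le> s1\<^sup>2 * s4" if "s2 > 0" using that by simp
  moreover have "s2 ^ 3 \<le> s1\<^sup>2 * s4" if "s2 = 0" using that nonneg by simp
  ultimately show ?thesis using nonneg unfolding s by fastforce
qed

text \<open>Here \<open>T1\<close> and \<open>T2\<close> stand for the traces of \<open>X\<close>
  and its square, \<open>N1\<close> for the trace norm, and \<open>f1\<close>, \<open>f2\<close> for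
  the permutation part and the projector part. The cube of \<open>T1\<^sup>2 + T2\<close> on the
  right is the numerator of the cubed second moment, against which it later cancels.\<close>

lemma fourth_moment_coefficient_bound:
  fixes d \<alpha> N1 T1 T2 f1 f2 :: real
  assumes d: "d \<ge> 2" and T2: "T2 > 0"
    and f1: "f1 \<le> T1 ^ 4 + 6 * (T1\<^sup>2 * T2) + 9 * T2\<^sup>2 + 8 * (\<bar>T1\<bar> * (T2 * sqrt T2))"
    and f2: "\<bar>f2\<bar> \<le> 24 * N1\<^sup>2 * T2 / d"
    and \<alpha>: "2 / (d * (d + 1)) \<le> \<alpha>" "\<alpha> \<le> 1 / d"
  defines "lam \<equiv> (1 - \<alpha>) / ((d + 1) * (d + 2) * (d - 1) * (d + 4))"
  defines "kap \<equiv> \<alpha> / (4 * (d + 1) * (d + 2)) - lam"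
  shows "d * (d + 1) ^ 3 * (lam * f1 + kap * f2) \<le> (T1\<^sup>2 + T2) ^ 3 / T2 * (6 * d * \<alpha> * (N1\<^sup>2 / T2) + 10)"
proof -
  define A where "A = T1\<^sup>2 + T2"
  have A: "A \<ge> T2" "A > 0" using T2 by (auto simp: A_def add_nonneg_pos)
  have \<alpha>1: "0 < \<alpha>" using \<alpha>(1) d by (smt (verit) divide_pos_pos mult_pos_pos)
  have \<alpha>2: "\<alpha> \<le> 1 / 2" using \<alpha>(2) d by (smt (verit) frac_le)
  let ?q = "(d + 2) * (d - 1) * (d + 4)"
  have q: "?q > 0" using d by simp
  have lam0: "d * (d + 1) ^ 3 * lam = (1 - \<alpha>) * (d * (d + 1)\<^sup>2 / ?q)"
  proof -
    have "d * e ^ 3 * ((1 - \<alpha>) / (e * g * p * h)) = (1 - \<alpha>) * (d * e\<^sup>2 / (g * p * h))" if "e \<noteq> 0" for e g p h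
      using that by (simp add: power2_eq_square power3_eq_cube mult_ac)
    from this[of "d + 1"] show ?thesis unfolding lam_def using d by simp
  qed
  define B1 where "B1 = T1 ^ 4 + 6 * (T1\<^sup>2 * T2) + 9 * T2\<^sup>2 + 8 * (\<bar>T1\<bar> * (T2 * sqrt T2))"
  have B1: "B1 \<ge> 0" unfolding B1_def using T2 by (intro add_nonneg_nonneg mult_nonneg_nonneg) auto
  \<comment> \<open>With \<open>T1 = 0\<close> the constant 9 would do. The term linear in
    \<open>s = \<bar>T1\<bar>\<close> requires more, and the additional \<open>r^6\<close> provided
    by 10 completes the square \<open>(4 s - r)^2\<close>.\<close>
  have B1A: "B1 \<le> 10 * (A ^ 3 / T2)"
  proof -
    define r s where "r = sqrt T2" "s = \<bar>T1\<bar>"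
    note rs = this
    have r: "T2 = r\<^sup>2" "r > 0" using T2 by (auto simp: rs)
    have s: "T1\<^sup>2 = s\<^sup>2" "T1 ^ 4 = s ^ 4" by (auto simp: rs)
    have "10 * (s\<^sup>2 + r\<^sup>2) ^ 3 - r\<^sup>2 * (s ^ 4 + 6 * (s\<^sup>2 * r\<^sup>2) + 9 * (r\<^sup>2)\<^sup>2 + 8 * (s * (r\<^sup>2 * r)))
      = 10 * s ^ 6 + 29 * s ^ 4 * r\<^sup>2 + r ^ 4 * (8 * s\<^sup>2 + (4 * s - r)\<^sup>2)"
      by (simp add: eval_nat_numeral algebra_simps)
    also have "\<dots> \<ge> 0" by (intro add_nonneg_nonneg mult_nonneg_nonneg) (auto simp: zero_le_even_power)
    finally have "r\<^sup>2 * (s ^ 4 + 6 * (s\<^sup>2 * r\<^sup>2) + 9 * (r\<^sup>2)\<^sup>2 + 8 * (s * (r\<^sup>2 * r))) \<le> 10 * (s\<^sup>2 + r\<^sup>2) ^ 3" by simp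
    moreover have "B1 = s ^ 4 + 6 * (s\<^sup>2 * r\<^sup>2) + 9 * (r\<^sup>2)\<^sup>2 + 8 * (s * (r\<^sup>2 * r))"
      unfolding B1_def using r s rs by simp
    ultimately have "T2 * B1 \<le> 10 * A ^ 3" unfolding A_def using r s by simp
    thus ?thesis using T2 by (simp add: field_simps)
  qed
  have rho: "0 \<le> d * (d + 1)\<^sup>2 / ?q" "d * (d + 1)\<^sup>2 / ?q \<le> 1"
  proof -
    show "0 \<le> d * (d + 1)\<^sup>2 / ?q" using q d by simp
    have "2 * 2 \<le> d * d" using d by (intro mult_mono) auto
    moreover have "?q - d * (d + 1)\<^sup>2 = 3 * (d * d) + d - 8" by (simp add: power2_eq_square algebra_simps)
    ultimately have "d * (d + 1)\<^sup>2 \<le> ?q" using d by linarith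
    thus "d * (d + 1)\<^sup>2 / ?q \<le> 1" using q by simp
  qed
  have "(1 - \<alpha>) * (d * (d + 1)\<^sup>2 / ?q) * f1 \<le> (1 - \<alpha>) * (d * (d + 1)\<^sup>2 / ?q) * B1"
    using f1 \<alpha>2 rho by (intro mult_left_mono mult_nonneg_nonneg) (auto simp: B1_def)
  also have "\<dots> \<le> 1 * B1"
    using \<alpha>1 \<alpha>2 rho B1 by (intro mult_right_mono mult_le_one) auto
  finally have part1: "d * (d + 1) ^ 3 * lam * f1 \<le> 10 * (A ^ 3 / T2)" using B1A lam0 by simp
  \<comment> \<open>The coefficient \<open>kap\<close> rescaled so that the factor
    \<open>24 / d\<close> in the bound on \<open>f2\<close> cancels.\<close>
  define k where "k = (d + 1)\<^sup>2 * (6 * \<alpha> * ((d - 1) * (d + 4)) - 24 * (1 - \<alpha>)) / ?q"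
  have kap0: "d * (d + 1) ^ 3 * kap = k * d / 24"
  proof -
    have "d * e ^ 3 * (\<alpha> / (4 * e * g) - (1 - \<alpha>) / (e * g * p * h)) =
      e\<^sup>2 * (6 * \<alpha> * (p * h) - 24 * (1 - \<alpha>)) / (g * p * h) * d / 24"
      if "e \<noteq> 0" "g \<noteq> 0" "p \<noteq> 0" "h \<noteq> 0" for e g p h
      using that by (simp add: field_simps power2_eq_square power3_eq_cube)
    from this[of "d + 1" "d + 2" "d - 1" "d + 4"] show ?thesis unfolding kap_def lam_def k_def using d by simp
  qed
  \<comment> \<open>Since \<open>(d + 1)^2 = d (d + 2) + 1\<close>, all but one copy of
    \<open>6 \<alpha> (d - 1) (d + 4)\<close> cancels against the right side; \<alpha> at most 1/2
    takes care of that copy.\<close>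
  have up: "(d + 1)\<^sup>2 * (6 * \<alpha> * ((d - 1) * (d + 4)) - 24 * (1 - \<alpha>)) \<le> 6 * d * \<alpha> * ?q"
  proof -
    have "6 * \<alpha> * ((d - 1) * (d + 4)) \<le> 3 * ((d - 1) * (d + 4))"
      using \<alpha>2 d by (intro mult_right_mono) auto
    also have "\<dots> \<le> 12 * (d + 1)\<^sup>2" using d by (simp add: power2_eq_square algebra_simps)
    also have "\<dots> \<le> 24 * (1 - \<alpha>) * (d + 1)\<^sup>2" using \<alpha>2 by (intro mult_right_mono) auto
    finally show ?thesis by (simp add: power2_eq_square algebra_simps)
  qed
  \<comment> \<open>Solved for \<alpha>, the claim is \<open>24 (d + 1)^2 <= \<alpha> c\<close>,
    where \<open>c\<close> collects all coefficients of \<alpha>. This is where the lower bound on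
    \<alpha> enters.\<close>
  have lo: "- ((d + 1)\<^sup>2 * (6 * \<alpha> * ((d - 1) * (d + 4)) - 24 * (1 - \<alpha>))) \<le> 6 * d * \<alpha> * ?q"
  proof -
    define c where "c = 6 * ((d - 1) * (d + 4)) * (2 * d\<^sup>2 + 4 * d + 1) + 24 * (d + 1)\<^sup>2"
    have c: "c > 0" unfolding c_def using d by (intro add_nonneg_pos mult_nonneg_nonneg) auto
    have "24 * (d + 1)\<^sup>2 * (d * (d + 1)) \<le> 2 * c"
    proof -
      have "2 * c - 24 * (d + 1)\<^sup>2 * (d * (d + 1)) = 12 * (d - 1) * (4 * d\<^sup>2 + 7 * d)"
        unfolding c_def by (simp add: power2_eq_square algebra_simps)
      moreover have "12 * (d - 1) * (4 * d\<^sup>2 + 7 * d) \<ge> 0" using d by (intro mult_nonneg_nonneg) auto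
      ultimately show ?thesis by linarith
    qed
    hence "24 * (d + 1)\<^sup>2 \<le> 2 * c / (d * (d + 1))" using d by (subst pos_le_divide_eq) simp_all
    also have "\<dots> = 2 / (d * (d + 1)) * c" by simp
    also have "\<dots> \<le> \<alpha> * c" using \<alpha>(1) c by (intro mult_right_mono) auto
    finally show ?thesis unfolding c_def by (simp add: power2_eq_square algebra_simps)
  qed
  have "\<bar>k\<bar> \<le> 6 * d * \<alpha>"
    unfolding k_def abs_divide using q up lo by (simp add: divide_le_eq abs_le_iff)
  have "k * d / 24 * f2 \<le> \<bar>k\<bar> * d / 24 * \<bar>f2\<bar>"
    using d abs_ge_self[of "k * d / 24 * f2"] by (simp add: abs_mult)
  also have "\<dots> \<le> \<bar>k\<bar> * d / 24 * (24 * N1\<^sup>2 * T2 / d)" using f2 d by (intro mult_left_mono) auto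
  also have "\<dots> = \<bar>k\<bar> * (N1\<^sup>2 * T2)" using d by simp
  also have "\<dots> \<le> 6 * d * \<alpha> * (N1\<^sup>2 * T2)" using \<open>\<bar>k\<bar> \<le> _\<close> T2 by (intro mult_right_mono) auto
  also have "\<dots> \<le> 6 * d * \<alpha> * (A ^ 3 / T2 * (N1\<^sup>2 / T2))"
  proof -
    have "T2 ^ 3 \<le> A ^ 3" using A T2 by (intro power_mono) auto
    hence "T2 \<le> A ^ 3 / T2 / T2" using T2 by (simp add: field_simps power3_eq_cube)
    hence "N1\<^sup>2 * T2 \<le> N1\<^sup>2 * (A ^ 3 / T2 / T2)" by (intro mult_left_mono) auto
    thus ?thesis using d \<alpha>1 by (intro mult_left_mono) (auto simp: mult_ac)
  qed
  finally have part2: "d * (d + 1) ^ 3 * kap * f2 \<le> 6 * d * \<alpha> * (A ^ 3 / T2 * (N1\<^sup>2 / T2))" unfolding kap0 .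
  show ?thesis using part1 part2 unfolding A_def[symmetric] by (simp add: algebra_simps)
qed

context pure_orbit begin

lemma Orb_real:
  assumes "P \<in> Orb" "X \<in> CM" "mat_adjoint X = X"
  shows "complex_of_real (Re (tr (P * X))) = tr (P * X)"
  using assms Orb_herm by (intro mtrace_hermitian_mult[of _ d]) auto

lemma Orb_sum_square:
  assumes P: "P \<in> Orb" shows "(\<Sum>W\<in>PP. (Re (tr (P * W)))\<^sup>2) = real d"
proof -
  have "complex_of_real (\<Sum>W\<in>PP. (Re (tr (P * W)))\<^sup>2) = (\<Sum>W\<in>PP. tr (P * (W * I)) * tr (P * (W * I)))"
    using P by (simp add: Orb_real PP_herm power2_eq_square)
  also have "\<dots> = D" using P by (subst sum_Orb_trace_swap) auto
  finally show ?thesis by (metis of_real_of_nat_eq of_real_eq_iff)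
qed

text \<open>By purity the square is \<open>tr (P W P W)\<close>. In the Pauli expansion this is a
  signed average of the squared coefficients, whose unsigned total is \<open>d\<close>.\<close>

lemma Orb_coefficient_bound:
  assumes P: "P \<in> Orb" and W: "W \<in> PP" shows "(Re (tr (P * W)))\<^sup>2 \<le> 1"
proof -
  have tr: "tr (V * (W * (P * W))) = sg V W * tr (P * V)" if V: "V \<in> PP" for V
  proof -
    have "tr (V * (W * (P * W))) = sg V W * tr (W * (V * (P * W)))"
      using V W P by (simp add: comm_sg_left[of V W])
    also have "tr (W * (V * (P * W))) = tr (V * P)"
      using mtrace_comm[of W d "V * (P * W)"] V W P by simp
    also have "tr (V * P) = tr (P * V)" using V P by (intro mtrace_comm[of _ d]) auto
    finally show ?thesis .
  qed
  have "complex_of_real ((Re (tr (P * W)))\<^sup>2) = tr (P * W) * tr (P * W)"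
    using Orb_real[OF P, of W] W by (simp add: PP_herm power2_eq_square)
  also have "\<dots> = tr (P * (W * (P * W)))" using P W by (simp add: Orb_pure)
  also have "\<dots> = (1 / D) * (\<Sum>V\<in>PP. tr (V * P) * tr (V * (W * (P * W))))"
    by (rule lin_PPD[OF lin_PP_trace_mult]) (use P W in auto)
  also have "(\<Sum>V\<in>PP. tr (V * P) * tr (V * (W * (P * W)))) = (\<Sum>V\<in>PP. sg V W * of_real ((Re (tr (P * V)))\<^sup>2))"
  proof (intro sum.cong refl)
    fix V assume V: "V \<in> PP"
    have "tr (V * P) = tr (P * V)" using V P by (intro mtrace_comm[of _ d]) auto
    thus "tr (V * P) * tr (V * (W * (P * W))) = sg V W * of_real ((Re (tr (P * V)))\<^sup>2)"
      using Orb_real[OF P, of V] V by (simp add: tr PP_herm power2_eq_square)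
  qed
  finally have "(Re (tr (P * W)))\<^sup>2 = cmod ((1 / D) * (\<Sum>V\<in>PP. sg V W * of_real ((Re (tr (P * V)))\<^sup>2)))"
    by (metis norm_of_real abs_of_nonneg zero_le_power2)
  also have "\<dots> = (1 / real d) * cmod (\<Sum>V\<in>PP. sg V W * of_real ((Re (tr (P * V)))\<^sup>2))" by (simp add: norm_mult norm_divide)
  also have "\<dots> \<le> (1 / real d) * (\<Sum>V\<in>PP. (Re (tr (P * V)))\<^sup>2)"
    by (intro mult_left_mono sum_norm_le) (auto simp: norm_mult sg_def norm_power)
  finally show ?thesis using Orb_sum_square[OF P] by simp
qed

text \<open>The upper bound follows from the fourth powers being at most the squares, which sum to
  \<open>d\<close>. For the lower bound the identity, with coefficient 1, is split off and
  Cauchy-Schwarz is applied to the other \<open>d^2 - 1\<close> coefficients.\<close>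

lemma alpha_bounds: "2 / (real d * (real d + 1)) \<le> \<alpha>" "\<alpha> \<le> 1 / real d"
proof -
  obtain P where P: "P \<in> Orb" using Orb_nonempty by blast
  define c where "c W = Re (tr (P * W))" for W
  have dp: "real d > 1" using d_ge_2 by simp
  have "complex_of_real (\<Sum>W\<in>PP. c W ^ 4) = (\<Sum>W\<in>PP. tr (P * W) ^ 4)"
    unfolding c_def using P by (simp add: Orb_real PP_herm)
  also have "\<dots> = complex_of_real ((real d)\<^sup>2 * \<alpha>)" using Orb_fourth[OF P] by simp
  finally have s4: "(\<Sum>W\<in>PP. c W ^ 4) = (real d)\<^sup>2 * \<alpha>" by (rule of_real_eq_iff[THEN iffD1])
  have s2: "(\<Sum>W\<in>PP. (c W)\<^sup>2) = real d" unfolding c_def by (rule Orb_sum_square[OF P])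
  have cI: "c I = 1" unfolding c_def using P by simp
  have four: "c W ^ 4 = (c W)\<^sup>2 * (c W)\<^sup>2" for W by (simp add: power4_eq_xxxx power2_eq_square)
  have "(\<Sum>W\<in>PP. c W ^ 4) \<le> (\<Sum>W\<in>PP. (c W)\<^sup>2)"
    unfolding four using Orb_coefficient_bound[OF P] by (intro sum_mono mult_left_le) (auto simp: c_def)
  thus "\<alpha> \<le> 1 / real d" unfolding s4 s2 using dp by (simp add: field_simps power2_eq_square)
  have cardPP: "real (card PP) = (real d)\<^sup>2"
    using card_PP by (metis of_nat_eq_iff of_nat_power)
  have "(\<Sum>W\<in>PP - {I}. (c W)\<^sup>2 * 1)\<^sup>2 \<le> (\<Sum>W\<in>PP - {I}. ((c W)\<^sup>2)\<^sup>2) * (\<Sum>W\<in>PP - {I}. 1\<^sup>2)"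
    by (rule Cauchy_Schwarz_ineq_sum)
  moreover have "(\<Sum>W\<in>PP - {I}. (c W)\<^sup>2) = real d - 1" using s2 by (simp add: sum_diff1 cI)
  moreover have "(\<Sum>W\<in>PP - {I}. ((c W)\<^sup>2)\<^sup>2) = (real d)\<^sup>2 * \<alpha> - 1"
    using s4 by (simp add: sum_diff1 cI flip: power_mult)
  moreover have "real (card (PP - {I})) = (real d)\<^sup>2 - 1"
  proof -
    have "card PP \<ge> 1" using card_gt_0_iff[of PP] one_PP finite_PP by fastforce
    thus ?thesis using cardPP by (simp add: card_Diff_singleton of_nat_diff)
  qed
  ultimately have "(real d - 1)\<^sup>2 \<le> ((real d)\<^sup>2 * \<alpha> - 1) * ((real d)\<^sup>2 - 1)" by simp
  also have "\<dots> = (real d - 1) * (((real d)\<^sup>2 * \<alpha> - 1) * (real d + 1))" by (simp add: power2_eq_square algebra_simps)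
  finally have "real d - 1 \<le> ((real d)\<^sup>2 * \<alpha> - 1) * (real d + 1)" using dp by (simp add: power2_eq_square mult.assoc)
  hence "2 * real d \<le> real d * (\<alpha> * (real d * (real d + 1)))" by (simp add: power2_eq_square algebra_simps)
  hence "2 \<le> \<alpha> * (real d * (real d + 1))" using dp by simp
  thus "2 / (real d * (real d + 1)) \<le> \<alpha>" using dp by (simp add: divide_le_eq)
qed

end

locale frame_orbit = pure_orbit + unitary_frame
begin

text \<open>The moment inequality is applied to the unnormalised sums over the orbit; its two outer
  sides share the factor containing \<open>A ^ 3\<close>, and cancelling it removes the dependence
  on the trace.\<close>

lemma abs_sum_lower_bound:
  fixes l :: "nat \<Rightarrow> real"
  defines "X \<equiv> spec (\<lambda>i. complex_of_real (l i))"
  defines "T2 \<equiv> (\<Sum>i<d. (l i)\<^sup>2)" and "N1 \<equiv> (\<Sum>i<d. \<bar>l i\<bar>)"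
  assumes herm: "mat_adjoint X = X" and T2: "T2 > 0"
  shows "T2 / (6 * real d * \<alpha> * (N1\<^sup>2 / T2) + 10) \<le> (real d / real (card Orb) * (\<Sum>P\<in>Orb. cmod (tr (P * X))))\<^sup>2"
proof -
  define T1 where "T1 = (\<Sum>i<d. l i)"
  define S where "S P = Re (tr (P * X))" for P
  define n where "n = real (card Orb)"
  define f1 where "f1 = T1 ^ 4 + 6 * (T1\<^sup>2 * T2) + 3 * T2\<^sup>2 + 8 * (T1 * (\<Sum>i<d. l i ^ 3)) + 6 * (\<Sum>i<d. l i ^ 4)"
  define lamr where "lamr = (1 - \<alpha>) / ((real d + 1) * (real d + 2) * (real d - 1) * (real d + 4))"
  define kapr where "kapr = \<alpha> / (4 * (real d + 1) * (real d + 2)) - lamr"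
  define A where "A = T1\<^sup>2 + T2"
  define Z where "Z = 6 * real d * \<alpha> * (N1\<^sup>2 / T2) + 10"
  have n: "n > 0" unfolding n_def by simp
  have dp: "real d \<ge> 2" using d_ge_2 by simp
  have A: "A > 0" using T2 by (simp add: A_def add_nonneg_pos)
  have X: "X \<in> CM" by (simp add: X_def)
  have S: "tr (P * X) = of_real (S P)" if "P \<in> Orb" for P
    using Orb_real[OF that X herm] by (simp add: S_def)
  have t1: "tr X = of_real T1" unfolding X_def by (simp add: mtrace_spec T1_def)
  have t2: "tr (X * X) = of_real T2" unfolding X_def by (simp add: spec_mult mtrace_spec T2_def power2_eq_square)
  have "complex_of_real ((1 / n) * (\<Sum>P\<in>Orb. (S P)\<^sup>2)) = moment2 X X"
    unfolding moment2_def n_def by (simp add: S power2_eq_square)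
  also have "\<dots> = of_real (A / (real d * (real d + 1)))"
    unfolding second_moment[OF X] t1 t2 A_def by (simp add: power2_eq_square)
  finally have m2: "(1 / n) * (\<Sum>P\<in>Orb. (S P)\<^sup>2) = A / (real d * (real d + 1))" by (rule of_real_eq_iff[THEN iffD1])
  have lam: "lam = of_real lamr" and kap: "kap = of_real kapr" unfolding lam_def kap_def lamr_def kapr_def by simp_all
  have perm_form: "perm_form X X X X = of_real f1"
    unfolding X_def perm_form_spec f1_def T1_def T2_def by simp
  have "complex_of_real ((1 / n) * (\<Sum>P\<in>Orb. S P ^ 4)) = moment4 X X X X"
    unfolding moment4_def n_def by (simp add: S power4_eq_xxxx)
  also have "\<dots> = of_real lamr * of_real f1 + of_real kapr * pauli_form X X X X"
    unfolding fourth_moment[OF X X X X] lam kap perm_form ..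
  finally have "Re (complex_of_real ((1 / n) * (\<Sum>P\<in>Orb. S P ^ 4))) = Re (of_real lamr * of_real f1 + of_real kapr * pauli_form X X X X)"
    by simp
  hence m4: "(1 / n) * (\<Sum>P\<in>Orb. S P ^ 4) = lamr * f1 + kapr * Re (pauli_form X X X X)"
    by (simp only: Re_complex_of_real plus_complex.sel times_complex.sel Im_complex_of_real)
  have li: "\<bar>l i\<bar> \<le> sqrt T2" if "i < d" for i
  proof -
    have "(l i)\<^sup>2 \<le> T2" unfolding T2_def using that by (intro member_le_sum) auto
    thus ?thesis by (metis real_sqrt_abs real_sqrt_le_iff)
  qed
  have b3: "\<bar>\<Sum>i<d. l i ^ 3\<bar> \<le> T2 * sqrt T2"
  proof -
    have "\<bar>\<Sum>i<d. l i ^ 3\<bar> \<le> (\<Sum>i<d. \<bar>l i ^ 3\<bar>)" by (rule sum_abs)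
    also have "\<dots> \<le> (\<Sum>i<d. (l i)\<^sup>2 * sqrt T2)"
    proof (rule sum_mono)
      fix i assume "i \<in> {..<d}"
      hence "(l i)\<^sup>2 * \<bar>l i\<bar> \<le> (l i)\<^sup>2 * sqrt T2" using li by (intro mult_left_mono) auto
      thus "\<bar>l i ^ 3\<bar> \<le> (l i)\<^sup>2 * sqrt T2" by (simp add: power3_eq_cube power2_eq_square abs_mult)
    qed
    finally show ?thesis by (simp add: T2_def sum_distrib_right)
  qed
  have b4: "(\<Sum>i<d. l i ^ 4) \<le> T2\<^sup>2"
  proof -
    have "(\<Sum>i<d. l i ^ 4) \<le> (\<Sum>i<d. (l i)\<^sup>2 * T2)"
    proof (rule sum_mono)
      fix i assume "i \<in> {..<d}"
      hence "(l i)\<^sup>2 \<le> T2" unfolding T2_def by (intro member_le_sum) auto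
      hence "(l i)\<^sup>2 * (l i)\<^sup>2 \<le> (l i)\<^sup>2 * T2" by (intro mult_left_mono) auto
      thus "l i ^ 4 \<le> (l i)\<^sup>2 * T2" by (simp add: power4_eq_xxxx power2_eq_square mult.assoc)
    qed
    also have "\<dots> = T2 * T2" by (simp add: T2_def sum_distrib_right)
    finally show ?thesis by (simp add: power2_eq_square)
  qed
  \<comment> \<open>The coefficient 9 is 3 + 6, the fourth power sum being bounded by the square of
    \<open>T2\<close>.\<close>
  have f1b: "f1 \<le> T1 ^ 4 + 6 * (T1\<^sup>2 * T2) + 9 * T2\<^sup>2 + 8 * (\<bar>T1\<bar> * (T2 * sqrt T2))"
  proof -
    have "T1 * (\<Sum>i<d. l i ^ 3) \<le> \<bar>T1\<bar> * \<bar>\<Sum>i<d. l i ^ 3\<bar>" by (simp flip: abs_mult)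
    also have "\<dots> \<le> \<bar>T1\<bar> * (T2 * sqrt T2)" using b3 by (intro mult_left_mono) auto
    finally show ?thesis unfolding f1_def using b4 by simp
  qed
  have f2b: "\<bar>Re (pauli_form X X X X)\<bar> \<le> 24 * N1\<^sup>2 * T2 / real d"
    using pauli_form_spec_bound[of l] abs_Re_le_cmod[of "pauli_form X X X X"] unfolding X_def N1_def T2_def by linarith
  have "real d * (real d + 1) ^ 3 * ((1 / n) * (\<Sum>P\<in>Orb. S P ^ 4)) \<le> A ^ 3 / T2 * Z"
    unfolding m4 A_def Z_def lamr_def kapr_def
    by (rule fourth_moment_coefficient_bound[OF dp T2 f1b f2b alpha_bounds])
  hence m4b: "(\<Sum>P\<in>Orb. S P ^ 4) \<le> n * (A ^ 3 / T2 * Z) / (real d * (real d + 1) ^ 3)"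
  proof -
    have "x \<le> n * q / c" if "c * ((1 / n) * x) \<le> q" "c > 0" for x q c
      using that n by (simp add: field_simps)
    from this[OF \<open>real d * (real d + 1) ^ 3 * _ \<le> _\<close>] show ?thesis using dp by simp
  qed
  have m2': "(\<Sum>P\<in>Orb. (S P)\<^sup>2) = n * A / (real d * (real d + 1))" using m2 n by (simp add: field_simps)
  have Zpos: "Z > 0" unfolding Z_def using T2 dp alpha_bounds(1)
    by (intro add_nonneg_pos mult_nonneg_nonneg) (auto intro: order_trans[rotated])
  define s1 where "s1 = (\<Sum>P\<in>Orb. \<bar>S P\<bar>)"
  have "(n * A / (real d * (real d + 1))) ^ 3 \<le> s1\<^sup>2 * (\<Sum>P\<in>Orb. S P ^ 4)"
    using moment_interpolation[OF finite_Orb, of S] unfolding m2' s1_def .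
  also have "\<dots> \<le> s1\<^sup>2 * (n * (A ^ 3 / T2 * Z) / (real d * (real d + 1) ^ 3))"
    using m4b by (intro mult_left_mono) auto
  finally have "(n * A / (real d * (real d + 1))) ^ 3 \<le> s1\<^sup>2 * (n * (A ^ 3 / T2 * Z) / (real d * (real d + 1) ^ 3))" .
  moreover have "(n * A / (real d * (real d + 1))) ^ 3 = (n * A ^ 3 / (real d * (real d + 1) ^ 3)) * (n\<^sup>2 / (real d)\<^sup>2)"
    using dp by (simp add: field_simps power2_eq_square power3_eq_cube)
  moreover have "s1\<^sup>2 * (n * (A ^ 3 / T2 * Z) / (real d * (real d + 1) ^ 3)) = (n * A ^ 3 / (real d * (real d + 1) ^ 3)) * (s1\<^sup>2 * Z / T2)"
    by (simp add: mult_ac)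
  moreover have "n * A ^ 3 / (real d * (real d + 1) ^ 3) > 0" using n A dp by simp
  ultimately have "n\<^sup>2 / (real d)\<^sup>2 \<le> s1\<^sup>2 * Z / T2" by (simp only: mult_le_cancel_left_pos)
  hence "T2 / Z \<le> (real d / n * s1)\<^sup>2"
    using n dp T2 Zpos by (simp add: field_simps power2_eq_square)
  moreover have "s1 = (\<Sum>P\<in>Orb. cmod (tr (P * X)))" unfolding s1_def by (simp add: S)
  ultimately show ?thesis unfolding Z_def n_def by simp
qed

end

section \<open>The Clifford orbit\<close>

lemma proj_carrier: "z \<in> carrier_vec d \<Longrightarrow> proj z \<in> carrier_mat d d"
  by (auto simp: proj_def)

lemma proj_index: "z \<in> carrier_vec d \<Longrightarrow> i < d \<Longrightarrow> j < d \<Longrightarrow> proj z $$ (i, j) = z $ i * cnj (z $ j)"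
  by (auto simp: proj_def)

lemma proj_herm: "mat_adjoint (proj z) = proj z"
  by (intro eq_matI) (auto simp: proj_def)

lemma mtrace_proj_mult:
  assumes z: "z \<in> carrier_vec d" and A: "A \<in> carrier_mat d d"
  shows "tr (proj z * A) = (A *\<^sub>v z) \<bullet>c z"
proof -
  have "(A *\<^sub>v z) \<bullet>c z = (\<Sum>i<d. (A *\<^sub>v z) $ i * cnj (z $ i))"
    using z A by (intro cscalar_prod_sum) auto
  also have "\<dots> = (\<Sum>i<d. \<Sum>j<d. A $$ (i, j) * z $ j * cnj (z $ i))"
    using z A by (intro sum.cong refl) (auto simp: scalar_prod_def atLeast0LessThan sum_distrib_right)
  also have "\<dots> = (\<Sum>j<d. \<Sum>i<d. A $$ (i, j) * z $ j * cnj (z $ i))" by (rule sum.swap)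
  also have "\<dots> = tr (proj z * A)"
    unfolding mtrace_mult[OF proj_carrier[OF z] A] using z by (intro sum.cong refl) (simp add: proj_index mult_ac)
  finally show ?thesis ..
qed

context pauli_basis begin

text \<open>The rank-one identity from which the purity axiom of the orbit is derived.\<close>

lemma proj_sandwich:
  assumes z: "z \<in> carrier_vec d" and A: "A \<in> CM"
  shows "proj z * (A * proj z) = tr (proj z * A) \<cdot>\<^sub>m proj z"
proof (rule eq_matI)
  note P = proj_carrier[OF z]
  fix i j assume "i < dim_row (tr (proj z * A) \<cdot>\<^sub>m proj z)" "j < dim_col (tr (proj z * A) \<cdot>\<^sub>m proj z)"
  hence ij: "i < d" "j < d" using P by auto
  have "(proj z * (A * proj z)) $$ (i, j) = (\<Sum>k<d. proj z $$ (i, k) * (\<Sum>l<d. A $$ (k, l) * proj z $$ (l, j)))"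
    using P A ij by (simp add: mult_mat_index[of _ d] del: index_mult_mat(1))
  also have "\<dots> = (\<Sum>k<d. \<Sum>l<d. (proj z $$ (l, k) * A $$ (k, l)) * proj z $$ (i, j))"
    unfolding sum_distrib_left using z ij by (intro sum.cong refl) (simp add: proj_index mult_ac)
  also have "\<dots> = (\<Sum>l<d. \<Sum>k<d. (proj z $$ (l, k) * A $$ (k, l)) * proj z $$ (i, j))" by (rule sum.swap)
  also have "\<dots> = tr (proj z * A) * proj z $$ (i, j)"
    unfolding mtrace_mult[OF P A] by (simp add: sum_distrib_right)
  finally show "(proj z * (A * proj z)) $$ (i, j) = (tr (proj z * A) \<cdot>\<^sub>m proj z) $$ (i, j)" using ij P by simp
qed (use proj_carrier[OF z] A in auto)

text \<open>Completeness reconstructs each entry of a matrix from its traces against the Pauli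
  operators.\<close>

lemma CM_eqI:
  assumes A: "A \<in> CM" "B \<in> CM" and eq: "\<And>W. W \<in> PP \<Longrightarrow> tr (W * A) = tr (W * B)"
  shows "A = B"
proof (rule eq_matI)
  have expand: "D * A $$ (i, j) = (\<Sum>W\<in>PP. tr (W * A) * W $$ (i, j))" if A: "A \<in> CM" and ij: "i < d" "j < d" for A i j
  proof -
    have "(\<Sum>W\<in>PP. tr (W * A) * W $$ (i, j)) = (\<Sum>W\<in>PP. \<Sum>k<d. \<Sum>l<d. W $$ (k, l) * W $$ (i, j) * A $$ (l, k))"
      using A by (intro sum.cong refl) (simp add: mtrace_mult[of _ d] sum_distrib_right sum_distrib_left mult_ac)
    also have "\<dots> = (\<Sum>k<d. \<Sum>l<d. \<Sum>W\<in>PP. W $$ (k, l) * W $$ (i, j) * A $$ (l, k))"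
      by (simp only: sum.swap[of _ _ PP])
    also have "\<dots> = (\<Sum>k<d. \<Sum>l<d. if l = i then if k = j then D * A $$ (l, k) else 0 else 0)"
      using ij by (intro sum.cong refl) (auto simp: PP_complete sum_distrib_right[symmetric])
    also have "\<dots> = D * A $$ (i, j)" using ij by (simp add: sum.delta)
    finally show ?thesis ..
  qed
  fix i j assume "i < dim_row B" "j < dim_col B"
  hence ij: "i < d" "j < d" using A by auto
  have "D * A $$ (i, j) = D * B $$ (i, j)" unfolding expand[OF A(1) ij] expand[OF A(2) ij] using eq by simp
  thus "A $$ (i, j) = B $$ (i, j)" by simp
qed (use A in auto)

end

locale clifford_data =
  fixes n :: nat and z :: "complex vec"
  assumes n: "n \<ge> 1" and z: "z \<in> carrier_vec (2 ^ n)" and z1: "z \<bullet>c z = 1"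
begin

sublocale pauli_basis "2 ^ n" "pauli_ops n" by (rule pauli_basis_pauli_ops)

abbreviation \<rho> where "\<rho> \<equiv> proj z"

lemma rho_CM [simp]: "\<rho> \<in> CM" by (rule proj_carrier[OF z])

lemma pauli_group_CM: "Q \<in> pauli_group n \<Longrightarrow> Q \<in> CM"
  by (auto simp: pauli_group_def)

lemma PP_pauli_group: "W \<in> pauli_ops n \<Longrightarrow> W \<in> pauli_group n"
  unfolding pauli_group_def by (rule CollectI, rule exI[of _ 1]) auto

lemma finite_pauli_group: "finite (pauli_group n)"
proof -
  have "pauli_group n \<subseteq> (\<lambda>(c, W). c \<cdot>\<^sub>m W) ` ({1, -1, \<i>, -\<i>} \<times> pauli_ops n)"
    by (auto simp: pauli_group_def)
  thus ?thesis by (rule finite_subset) simp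
qed

lemma clifford_CM [simp]: "U \<in> clifford_group n \<Longrightarrow> U \<in> CM"
  and clifford_unitary: "U \<in> clifford_group n \<Longrightarrow> mat_adjoint U * U = I"
  by (auto simp: clifford_group_def unitary_mat_def)

lemma clifford_cancel [simp]:
  assumes "U \<in> clifford_group n" "A \<in> CM" shows "mat_adjoint U * (U * A) = A"
proof -
  have "mat_adjoint U * (U * A) = (mat_adjoint U * U) * A" using assms by simp
  thus ?thesis using assms(2) unfolding clifford_unitary[OF assms(1)] by simp
qed

lemma clifford_conj:
  assumes "U \<in> clifford_group n" "Q \<in> pauli_group n"
  shows "U * (Q * mat_adjoint U) \<in> pauli_group n"
proof -
  have "U * Q * mat_adjoint U \<in> pauli_group n" using assms by (simp add: clifford_group_def)
  thus ?thesis using assms pauli_group_CM by simp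
qed

lemma clifford_orbit_alt: "clifford_orbit n z = (\<lambda>U. U * (\<rho> * mat_adjoint U)) ` clifford_group n"
proof -
  have "clifford_orbit n z = (\<lambda>U. U * \<rho> * mat_adjoint U) ` clifford_group n"
    unfolding clifford_orbit_def by (rule Setcompr_eq_image)
  also have "\<dots> = (\<lambda>U. U * (\<rho> * mat_adjoint U)) ` clifford_group n"
    by (intro image_cong refl) simp
  finally show ?thesis .
qed

lemma mtrace_clifford_conj:
  assumes "U \<in> clifford_group n" "A \<in> CM"
  shows "tr (U * (A * mat_adjoint U)) = tr A"
  using mtrace_comm[of U "2 ^ n" "A * mat_adjoint U"] assms clifford_unitary[of U] by simp

lemma mtrace_orbit_mult:
  assumes "U \<in> clifford_group n" "A \<in> CM"
  shows "tr ((U * (\<rho> * mat_adjoint U)) * A) = tr (\<rho> * (mat_adjoint U * (A * U)))"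
  using mtrace_comm[of U "2 ^ n" "\<rho> * (mat_adjoint U * A)"] assms by simp

text \<open>A Clifford unitary acts on the state only through its permutation of the Pauli group.\<close>

lemma orbit_determined:
  assumes U: "U \<in> clifford_group n" "V \<in> clifford_group n"
    and eq: "\<And>W. W \<in> pauli_ops n \<Longrightarrow> U * (W * mat_adjoint U) = V * (W * mat_adjoint V)"
  shows "U * (\<rho> * mat_adjoint U) = V * (\<rho> * mat_adjoint V)"
proof (rule CM_eqI)
  fix S assume S: "S \<in> pauli_ops n"
  have key: "tr (S * (T * (\<rho> * mat_adjoint T))) = (1 / D) * (\<Sum>W\<in>pauli_ops n. tr (W * \<rho>) * tr (S * (T * (W * mat_adjoint T))))"
    if T: "T \<in> clifford_group n" for T
  proof -
    have rot: "tr (S * (T * (A * mat_adjoint T))) = tr (A * (mat_adjoint T * (S * T)))" if "A \<in> CM" for A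
      using mtrace_comm[of "S * T" "2 ^ n" "A * mat_adjoint T"] S T that by simp
    have "tr (\<rho> * (mat_adjoint T * (S * T))) = (1 / D) * (\<Sum>W\<in>pauli_ops n. tr (W * \<rho>) * tr (W * (mat_adjoint T * (S * T))))"
      by (rule lin_PPD[OF lin_PP_trace_mult]) (use S T in auto)
    thus ?thesis by (simp add: rot)
  qed
  show "tr (S * (U * (\<rho> * mat_adjoint U))) = tr (S * (V * (\<rho> * mat_adjoint V)))"
    unfolding key[OF U(1)] key[OF U(2)] using eq by simp
qed (use U in auto)

text \<open>The Clifford group contains all scalar phases and is infinite, but an orbit point
  depends only on the induced map from Pauli operators to the finite Pauli group, and there are
  finitely many such maps.\<close>

lemma finite_orbit: "finite (clifford_orbit n z)"
proof -
  define \<phi> where "\<phi> U = restrict (\<lambda>W. U * (W * mat_adjoint U)) (pauli_ops n)" for U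
  have "\<phi> ` clifford_group n \<subseteq> (\<Pi>\<^sub>E W\<in>pauli_ops n. pauli_group n)"
    unfolding \<phi>_def using clifford_conj PP_pauli_group by auto
  hence fin: "finite (\<phi> ` clifford_group n)"
    by (rule finite_subset) (auto intro!: finite_PiE finite_pauli_group)
  have "U * (\<rho> * mat_adjoint U) = V * (\<rho> * mat_adjoint V)"
    if "U \<in> clifford_group n" "V \<in> clifford_group n" "\<phi> U = \<phi> V" for U V
    using orbit_determined[OF that(1,2)] fun_cong[OF that(3)] unfolding \<phi>_def by (metis restrict_apply')
  \<comment> \<open>Each induced map is given one chosen Clifford representative; by the previous
    fact the orbit point does not depend on the choice.\<close>
  hence "clifford_orbit n z \<subseteq> (\<lambda>f. (\<lambda>U. U * (\<rho> * mat_adjoint U)) (SOME U. U \<in> clifford_group n \<and> \<phi> U = f)) ` (\<phi> ` clifford_group n)"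
    unfolding clifford_orbit_alt image_image
    by (smt (verit, ccfv_threshold) image_iff subsetI someI_ex)
  thus ?thesis using fin by (meson finite_imageI finite_subset)
qed

lemma mtrace_rho_PP:
  assumes "ks \<in> pauli_indices n"
  shows "tr (\<rho> * pauli_op ks) = of_real (Re ((pauli_op ks *\<^sub>v z) \<bullet>c z))"
proof -
  have W: "pauli_op ks \<in> pauli_ops n" using assms by (simp add: pauli_ops_def)
  have "complex_of_real (Re (tr (\<rho> * pauli_op ks))) = tr (\<rho> * pauli_op ks)"
    using W by (intro mtrace_hermitian_mult[of _ "2 ^ n"] proj_herm PP_herm) auto
  thus ?thesis using mtrace_proj_mult[OF z PP_CM[OF W]] by simp
qed

sublocale pure_orbit "2 ^ n" "pauli_ops n" "clifford_orbit n z" "pauli_alpha n z"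
proof
  show "2 \<le> (2::nat) ^ n" using n by (metis power_increasing power_one_right one_le_numeral)
  show "finite (clifford_orbit n z)" by (rule finite_orbit)
  have "I \<in> clifford_group n"
    unfolding clifford_group_def unitary_mat_def
  proof (intro CollectI conjI ballI)
    fix Q assume Q: "Q \<in> pauli_group n"
    thus "I * Q * mat_adjoint I \<in> pauli_group n" using pauli_group_CM[OF Q] by simp
  qed auto
  thus "clifford_orbit n z \<noteq> {}" by (auto simp: clifford_orbit_alt)
next
  fix P assume "P \<in> clifford_orbit n z"
  then obtain U where U: "U \<in> clifford_group n" and P: "P = U * (\<rho> * mat_adjoint U)" by (auto simp: clifford_orbit_alt)
  note U' = mat_adjoint_carrier[OF clifford_CM[OF U]]
  show "P \<in> CM" unfolding P using U by simp
  have "tr \<rho> = tr (\<rho> * I)" by simp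
  also have "\<dots> = 1" using mtrace_proj_mult[OF z one_carrier_mat] z z1 by simp
  finally show "tr P = 1" unfolding P using U by (simp add: mtrace_clifford_conj)
  show "mat_adjoint P = P" unfolding P using U by (simp add: mat_adjoint_mult[of _ "2 ^ n"] proj_herm)
  show "tr (P * (A * (P * B))) = tr (P * A) * tr (P * B)" if AB: "A \<in> CM" "B \<in> CM" for A B
  proof -
    let ?A = "mat_adjoint U * (A * U)" and ?B = "mat_adjoint U * (B * U)"
    have "tr (P * (A * (P * B))) = tr (\<rho> * (mat_adjoint U * ((A * (P * B)) * U)))"
      unfolding P using U AB by (intro mtrace_orbit_mult) auto
    also have "\<rho> * (mat_adjoint U * ((A * (P * B)) * U)) = (\<rho> * (?A * \<rho>)) * ?B"
      unfolding P using U U' AB by simp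
    also have "\<dots> = tr (\<rho> * ?A) \<cdot>\<^sub>m (\<rho> * ?B)"
      using U U' AB by (subst proj_sandwich[OF z]) auto
    finally show ?thesis using U U' AB by (simp add: P mtrace_orbit_mult del: assoc)
  qed
  \<comment> \<open>The gate is absorbed into the Clifford unitary defining \<open>P\<close>; the
    two phases from conjugating a Pauli operator multiply to another fourth root of unity.\<close>
  show "V * (P * V) \<in> clifford_orbit n z" if V: "V \<in> gens" for V
  proof -
    have adj: "mat_adjoint (V * U) = mat_adjoint U * V" using U V by (simp add: mat_adjoint_mult[of _ "2 ^ n"] gens_herm)
    have "V * U \<in> clifford_group n"
      unfolding clifford_group_def unitary_mat_def
    proof (intro CollectI conjI ballI)
      show "V * U \<in> CM" using U V by simp
      have "mat_adjoint (V * U) * (V * U) = mat_adjoint U * ((V * V) * U)"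
        unfolding adj using U U' V by (simp del: gens_square)
      thus "mat_adjoint (V * U) * (V * U) = I" using U V clifford_unitary by simp
      fix Q assume Q: "Q \<in> pauli_group n"
      obtain c W where c: "c \<in> {1, -1, \<i>, -\<i>}" "W \<in> pauli_ops n" "U * (Q * mat_adjoint U) = c \<cdot>\<^sub>m W"
        using clifford_conj[OF U Q] by (auto simp: pauli_group_def)
      obtain e W' where e: "e \<in> {1, -1, \<i>, -\<i>}" "W' \<in> pauli_ops n" "V * (W * V) = e \<cdot>\<^sub>m W'"
        using gens_conj[OF V c(2)] by blast
      have "(V * U) * Q * mat_adjoint (V * U) = V * ((U * (Q * mat_adjoint U)) * V)"
        unfolding adj using U U' V pauli_group_CM[OF Q] by simp
      also have "\<dots> = (c * e) \<cdot>\<^sub>m W'" unfolding c(3) using c(2) V e(2,3) by (simp add: smult_smult_mat)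
      finally have "(V * U) * Q * mat_adjoint (V * U) = (c * e) \<cdot>\<^sub>m W'" .
      moreover have "c * e \<in> {1, -1, \<i>, -\<i>}" using c(1) e(1) by auto
      ultimately show "(V * U) * Q * mat_adjoint (V * U) \<in> pauli_group n"
        unfolding pauli_group_def using e(2) by blast
    qed
    moreover have "V * (P * V) = (V * U) * (\<rho> * mat_adjoint (V * U))"
      unfolding adj P using U U' V by simp
    ultimately show ?thesis unfolding clifford_orbit_alt by blast
  qed
  show "(\<Sum>W\<in>pauli_ops n. tr (P * W) ^ 4) = D\<^sup>2 * complex_of_real (pauli_alpha n z)"
  proof -
    \<comment> \<open>Reindexing by conjugation with \<open>U\<close> moves the orbit point back to
      the initial state, where the sum is the defining one of \<alpha>.\<close>
    have "(\<Sum>W\<in>pauli_ops n. tr (P * W) ^ 4) = (\<Sum>W\<in>pauli_ops n. tr (P * (U * (W * mat_adjoint U))) ^ 4)"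
    proof (rule sum_PP_unitary_conj[symmetric, OF clifford_CM[OF U] clifford_unitary[OF U]])
      show "\<exists>c\<in>{1, -1, \<i>, -\<i>}. \<exists>C\<in>pauli_ops n. U * (W * mat_adjoint U) = c \<cdot>\<^sub>m C" if "W \<in> pauli_ops n" for W
        using clifford_conj[OF U PP_pauli_group[OF that]] unfolding pauli_group_def by blast
      show "tr (P * (c \<cdot>\<^sub>m W)) ^ 4 = tr (P * W) ^ 4" if "c ^ 4 = 1" "W \<in> pauli_ops n" for c W
        using that \<open>P \<in> CM\<close> by (simp add: power_mult_distrib)
    qed
    also have "\<dots> = (\<Sum>W\<in>pauli_ops n. tr (\<rho> * W) ^ 4)"
    proof (intro sum.cong refl)
      fix W assume W: "W \<in> pauli_ops n"
      have "P * (U * (W * mat_adjoint U)) = U * ((\<rho> * W) * mat_adjoint U)" unfolding P using U U' W by simp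
      thus "tr (P * (U * (W * mat_adjoint U))) ^ 4 = tr (\<rho> * W) ^ 4"
        using U W by (simp add: mtrace_clifford_conj del: assoc)
    qed
    also have "\<dots> = (\<Sum>ks\<in>pauli_indices n. of_real (Re ((pauli_op ks *\<^sub>v z) \<bullet>c z) ^ 4))"
      unfolding pauli_ops_def by (simp add: sum.reindex[OF pauli_op_inj] mtrace_rho_PP)
    also have "\<dots> = D\<^sup>2 * complex_of_real (pauli_alpha n z)" by (simp add: pauli_alpha_def)
    finally show ?thesis .
  qed
qed

end

theorem theorem1:
  fixes n :: nat and z :: "complex vec" and X :: "complex mat"
  assumes "n \<ge> 1"
    and "z \<in> carrier_vec (2 ^ n)" and "z \<bullet>c z = 1"
    and "X \<in> carrier_mat (2 ^ n) (2 ^ n)" and "mat_adjoint X = X"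
    and "X \<noteq> 0\<^sub>m (2 ^ n) (2 ^ n)"
  shows "clifford_povm_l1 n z X \<ge>
    schatten_norm 1 X /
      sqrt ((6 * 2 ^ n * pauli_alpha n z * r_eff X + 10) * r_eff X)"
proof -
  interpret clifford_data n z using assms(1-3) by unfold_locales
  obtain U l where U: "U \<in> CM" "mat_adjoint U * U = I"
    and l: "mat_adjoint U * (X * U) = mat (2 ^ n) (2 ^ n) (\<lambda>(i, j). if i = j then complex_of_real (l i) else 0)"
    using hermitian_decomposition[OF assms(4,5)] by blast
  interpret frame_orbit "2 ^ n" "pauli_ops n" "clifford_orbit n z" "pauli_alpha n z" U
    using U by unfold_locales
  define T2 where "T2 = (\<Sum>i<2 ^ n. (l i)\<^sup>2)"
  define N1 where "N1 = (\<Sum>i<2 ^ n. \<bar>l i\<bar>)"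
  define Z where "Z = 6 * 2 ^ n * pauli_alpha n z * (N1\<^sup>2 / T2) + 10"
  have X: "X = spec (\<lambda>i. complex_of_real (l i))"
  proof -
    have "spec (\<lambda>i. complex_of_real (l i)) = U * ((mat_adjoint U * (X * U)) * mat_adjoint U)"
      unfolding l spec_def diag_of_def ..
    thus ?thesis using assms(4) U U_U' by simp
  qed
  note schatten = schatten_norm_unitary_diag[OF U X[unfolded spec_def] assms(5)]
  have N1: "schatten_norm 1 X = N1" and T2: "(schatten_norm 2 X)\<^sup>2 = T2"
    using schatten by (auto simp: N1_def T2_def)
  have r: "r_eff X = N1\<^sup>2 / T2" by (simp add: r_eff_def N1 T2)
  \<comment> \<open>Nonvanishing of \<open>X\<close> enters here: a nonzero eigenvalue makes both
    norms positive, so that the effective rank is a genuine quotient.\<close>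
  have "\<exists>i<2 ^ n. l i \<noteq> 0"
  proof (rule ccontr)
    assume "\<not> (\<exists>i<2 ^ n. l i \<noteq> 0)"
    hence "diag_of (2 ^ n) (\<lambda>i. complex_of_real (l i)) = 0\<^sub>m (2 ^ n) (2 ^ n)"
      by (intro eq_matI) (auto simp: diag_of_def)
    hence "X = 0\<^sub>m (2 ^ n) (2 ^ n)" unfolding X spec_def
      by (simp add: left_mult_zero_mat[OF U'_CM] right_mult_zero_mat[OF U_CM])
    thus False using assms(6) by simp
  qed
  then obtain i where i: "i < 2 ^ n" "l i \<noteq> 0" by blast
  have T2pos: "T2 > 0" unfolding T2_def using i by (intro sum_pos2[of _ i]) auto
  have N1pos: "N1 > 0" unfolding N1_def using i by (intro sum_pos2[of _ i]) auto
  have \<alpha>: "pauli_alpha n z \<ge> 0" unfolding pauli_alpha_def by (intro mult_nonneg_nonneg sum_nonneg) auto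
  have Zpos: "Z > 0" unfolding Z_def using \<alpha> T2pos by (intro add_nonneg_pos mult_nonneg_nonneg) auto
  let ?q = "real (2 ^ n) / real (card (clifford_orbit n z))"
  have povm: "clifford_povm_l1 n z X = ?q * (\<Sum>P\<in>clifford_orbit n z. cmod (tr (P * X)))"
    unfolding clifford_povm_l1_def clifford_povm_elem_def sum_distrib_left
    using assms(4) by (intro sum.cong refl) (simp add: norm_mult norm_divide norm_power)
  have "T2 / Z \<le> (clifford_povm_l1 n z X)\<^sup>2"
    using abs_sum_lower_bound[of l] assms(5) T2pos unfolding povm X[symmetric] Z_def T2_def N1_def by simp
  hence "sqrt (T2 / Z) \<le> sqrt ((clifford_povm_l1 n z X)\<^sup>2)" by (rule real_sqrt_le_mono)
  also have "\<dots> = clifford_povm_l1 n z X"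
    unfolding clifford_povm_l1_def by (simp add: sum_nonneg)
  \<comment> \<open>The 2-norm in the bound is traded for the trace norm through the effective rank
    \<open>N1\<^sup>2 / T2\<close>.\<close>
  also have "sqrt (T2 / Z) = N1 / sqrt (Z * (N1\<^sup>2 / T2))"
    using N1pos T2pos Zpos by (simp add: real_sqrt_mult real_sqrt_divide field_simps)
  finally show ?thesis unfolding N1 r Z_def by simp
qed

end
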